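(* Let $n\ge1$, $\gamma\in[1,2)$, and let $u_0\in H^1(\mathbb{R}^n)\cap L^\gamma(\mathbb{R}^n)$ with $u_0\ge0$ a.e. in $\mathbb{R}^n$. There exists a constant $C>0$, depending only on $n$, $\gamma$, and $u_0$, such that for every $\varepsilon\in(0,1)$ and every minimizer $u_\varepsilon$ of $\mathcal{E}_\varepsilon$ in $\mathcal{U}_0$ we have $$\int_0^\infty\int_{\mathbb{R}^n}|\partial_t u_\varepsilon|^2\,dx\,d\tau\le C$$ and, for every $r\ge\varepsilon$, $$\int_0^r\int_{\mathbb{R}^n}\big(|\nabla u_\varepsilon|^2+2(u_\varepsilon)_+^\gamma\big)\,dx\,d\tau\le Cr.$$
   Context: Notation: $Q_r^+:=B_r\times(0,r^2)$, with $B_r\subset\mathbb{R}^n$ the open ball of radius $r$ centered at the origin; $\nabla$ is the gradient in $x$; $w_+=\max\{w,0\}$. $\mathcal{U}:=\bigcap_{r>0}H^1(Q_r^+)$ (first weak derivatives in $x$ and $t$ in $L^2(Q_r^+)$ for every $r>0$) and $\mathcal{U}_0:=\{u\in\mathcal{U}:u|_{t=0}=u_0\}$ in the sense of traces. For $\varepsilon\in(0,1)$ and $w\in\mathcal{U}$, $$\mathcal{E}_\varepsilon(w):=\int_0^\infty\frac{e^{-t/\varepsilon}}{\varepsilon}\left(\int_{\mathbb{R}^n}(\varepsilon|\partial_t w|^2+|\nabla w|^2)\,dx+2\int_{\mathbb{R}^n}w_+^\gamma\,dx\right)dt\in[0,+\infty].$$ A minimizer in $\mathcal{U}_0$ is an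 absolute minimizer over $\mathcal{U}_0$. *)

theory Defs
  imports "HOL-Analysis.Analysis"
begin

text \<open>
  Measurable functions stand for their classes modulo Lebesgue-null sets. A function on
  \<open>\<real>\<^sup>n \<times> (0,\<infinity>)\<close> is a total function on \<open>'a \<times> real\<close> of which only the values
  at positive times matter.
\<close>

primrec C_k :: "nat \<Rightarrow> ('a::real_normed_vector \<Rightarrow> real) \<Rightarrow> bool" where
  "C_k 0 f \<longleftrightarrow> continuous_on UNIV f"
| "C_k (Suc k) f \<longleftrightarrow> (\<forall>x. f differentiable (at x)) \<and>
     (\<forall>v. C_k k (\<lambda>x. frechet_derivative f (at x) v))"

definition smooth :: "('a::real_normed_vector \<Rightarrow> real) \<Rightarrow> bool" where
  "smooth f \<longleftrightarrow> (\<forall>k. C_k k f)"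

definition test_functions :: "'a::real_normed_vector set \<Rightarrow> ('a \<Rightarrow> real) set" where
  "test_functions \<Omega> = {\<phi>. smooth \<phi> \<and> compact (closure {x. \<phi> x \<noteq> 0}) \<and> closure {x. \<phi> x \<noteq> 0} \<subseteq> \<Omega>}"

definition Lp :: "real \<Rightarrow> 'a::euclidean_space set \<Rightarrow> ('a \<Rightarrow> 'b::euclidean_space) set" where
  "Lp p \<Omega> = {f. f \<in> borel_measurable (lebesgue_on \<Omega>) \<and>
                 integrable (lebesgue_on \<Omega>) (\<lambda>x. norm (f x) powr p)}"

definition locally_integrable :: "'a::euclidean_space set \<Rightarrow> ('a \<Rightarrow> 'b::euclidean_space) \<Rightarrow> bool" where
  "locally_integrable \<Omega> f \<longleftrightarrow> (\<forall>K. compact K \<and> K \<subseteq> \<Omega> \<longrightarrow> f absolutely_integrable_on K)"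

definition is_weak_gradient ::
  "'a::euclidean_space set \<Rightarrow> ('a \<Rightarrow> real) \<Rightarrow> ('a \<Rightarrow> 'a) \<Rightarrow> bool" where
  "is_weak_gradient \<Omega> u G \<longleftrightarrow> locally_integrable \<Omega> u \<and> locally_integrable \<Omega> G \<and>
     (\<forall>\<phi>\<in>test_functions \<Omega>. \<forall>b\<in>Basis.
        (LINT x:\<Omega>|lebesgue. u x * frechet_derivative \<phi> (at x) b)
        = - (LINT x:\<Omega>|lebesgue. (G x \<bullet> b) * \<phi> x))"

text \<open>The weak gradient is unique up to a null set of \<open>\<Omega>\<close>; an arbitrary representative is chosen.\<close>

definition weak_grad :: "'a::euclidean_space set \<Rightarrow> ('a \<Rightarrow> real) \<Rightarrow> 'a \<Rightarrow> 'a" where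
  "weak_grad \<Omega> u = (SOME G. is_weak_gradient \<Omega> u G)"

definition H1 :: "'a::euclidean_space set \<Rightarrow> ('a \<Rightarrow> real) set" where
  "H1 \<Omega> = {u \<in> Lp 2 \<Omega>. \<exists>G \<in> Lp 2 \<Omega>. is_weak_gradient \<Omega> u G}"

definition L2_normsq :: "'a::euclidean_space set \<Rightarrow> ('a \<Rightarrow> 'b::euclidean_space) \<Rightarrow> ennreal" where
  "L2_normsq \<Omega> f = (\<integral>\<^sup>+x\<in>\<Omega>. ennreal ((norm (f x))\<^sup>2) \<partial>lebesgue)"

definition H1_normsq :: "'a::euclidean_space set \<Rightarrow> ('a \<Rightarrow> real) \<Rightarrow> ennreal" where
  "H1_normsq \<Omega> f = L2_normsq \<Omega> f + L2_normsq \<Omega> (weak_grad \<Omega> f)"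

definition Q_plus :: "real \<Rightarrow> ('a::euclidean_space \<times> real) set" where
  "Q_plus r = ball 0 r \<times> {0<..<r\<^sup>2}"

definition spacetime :: "('a::euclidean_space \<times> real) set" where
  "spacetime = UNIV \<times> {0<..}"

definition U_space :: "('a::euclidean_space \<times> real \<Rightarrow> real) set" where
  "U_space = (\<Inter>r\<in>{0<..}. H1 (Q_plus r))"

text \<open>
  The trace on \<open>{t = 0}\<close> is the continuous extension to \<open>H\<^sup>1(Q\<^sub>r\<^sup>+)\<close> of the restriction map
  \<open>\<phi> \<mapsto> \<phi>(\<cdot>,0)\<close> on functions smooth up to the boundary: the trace of \<open>u\<close> is the
  \<open>L\<^sup>2(B\<^sub>r)\<close>-limit of \<open>\<phi>\<^sub>k(\<cdot>,0)\<close> for smooth \<open>\<phi>\<^sub>k\<close> converging to \<open>u\<close> in \<open>H\<^sup>1(Q\<^sub>r\<^sup>+)\<close>.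
\<close>

definition has_initial_trace ::
  "('a::euclidean_space \<times> real \<Rightarrow> real) \<Rightarrow> ('a \<Rightarrow> real) \<Rightarrow> bool" where
  "has_initial_trace u u0 \<longleftrightarrow> (\<forall>r>0. \<exists>\<phi> :: nat \<Rightarrow> 'a \<times> real \<Rightarrow> real.
     (\<forall>k. smooth (\<phi> k)) \<and>
     (\<lambda>k. H1_normsq (Q_plus r) (\<lambda>z. \<phi> k z - u z)) \<longlonglongrightarrow> 0 \<and>
     (\<lambda>k. L2_normsq (ball 0 r) (\<lambda>x. \<phi> k (x, 0) - u0 x)) \<longlonglongrightarrow> 0)"

definition U0_space :: "('a::euclidean_space \<Rightarrow> real) \<Rightarrow> ('a \<times> real \<Rightarrow> real) set" where
  "U0_space u0 = {u \<in> U_space. has_initial_trace u u0}"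

definition grad_x :: "('a::euclidean_space \<times> real \<Rightarrow> real) \<Rightarrow> 'a \<times> real \<Rightarrow> 'a" where
  "grad_x w z = fst (weak_grad spacetime w z)"

definition deriv_t :: "('a::euclidean_space \<times> real \<Rightarrow> real) \<Rightarrow> 'a \<times> real \<Rightarrow> real" where
  "deriv_t w z = snd (weak_grad spacetime w z)"

definition energy :: "real \<Rightarrow> real \<Rightarrow> ('a::euclidean_space \<times> real \<Rightarrow> real) \<Rightarrow> ennreal" where
  "energy \<gamma> \<epsilon> w =
     (\<integral>\<^sup>+t\<in>{0<..}. ennreal (exp (- t / \<epsilon>) / \<epsilon>) *
        ((\<integral>\<^sup>+x. ennreal (\<epsilon> * \<bar>deriv_t w (x, t)\<bar>\<^sup>2 + (norm (grad_x w (x, t)))\<^sup>2) \<partial>lebesgue)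
         + 2 * (\<integral>\<^sup>+x. ennreal ((max (w (x, t)) 0) powr \<gamma>) \<partial>lebesgue)) \<partial>lebesgue)"

definition is_minimizer ::
  "real \<Rightarrow> real \<Rightarrow> ('a::euclidean_space \<Rightarrow> real) \<Rightarrow> ('a \<times> real \<Rightarrow> real) \<Rightarrow> bool" where
  "is_minimizer \<gamma> \<epsilon> u0 u \<longleftrightarrow>
     u \<in> U0_space u0 \<and> (\<forall>w\<in>U0_space u0. energy \<gamma> \<epsilon> u \<le> energy \<gamma> \<epsilon> w)"

end

theory Submission
  imports Defs
begin

text \<open>
  The constant extension \<open>u\<^sub>0(x)\<close> is a competitor of energy
  \<open>E\<^sub>0 = \<integral>|\<nabla>u\<^sub>0|\<^sup>2 + 2 (u\<^sub>0)\<^sub>+\<^sup>\<gamma>\<close>, which does not depend on \<open>\<epsilon>\<close>.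
  The other competitors are the inner variations \<open>u(x, \<theta>(t))\<close> of the minimizer itself, where \<open>\<theta>\<close>
  is a smooth diffeomorphism with \<open>\<theta>(0) = 0\<close> and \<open>\<theta>(t) \<le> t\<close>. Write
  \<open>I(t) = \<epsilon> \<integral>|\<partial>\<^sub>t u|\<^sup>2\<close>, \<open>R(t) = \<integral>|\<nabla>u|\<^sup>2 + 2 u\<^sub>+\<^sup>\<gamma>\<close> and
  \<open>q = exp (-t/\<epsilon>)\<close>. Perturbing \<open>q\<close> to first order by \<open>g(q) = q (1 - q) / (q + a)\<close> gives
  \<open>\<integral> q (2q + a - q\<^sup>2) / (q + a)\<^sup>2 I + q a (1 + a) / (q + a)\<^sup>2 R \<le> \<integral> q (I + R) \<le> \<epsilon> E\<^sub>0\<close>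
  for every \<open>a \<in> (0, 1]\<close>. On \<open>q \<ge> a\<close> the first weight is at least \<open>1/2\<close>, which bounds the
  kinetic term up to the time \<open>T\<close> with \<open>a = exp (-T/\<epsilon>)\<close>; on \<open>q \<le> a\<close> the second one is at
  least \<open>q / (4 a)\<close>, which bounds \<open>R\<close> on \<open>[T, T + \<epsilon>]\<close>, and these intervals are summed up to \<open>r\<close>.
\<close>

subsection \<open>Smooth functions\<close>

text \<open>The energy bound alone controls R near a time T only up to a factor exp (T/\<epsilon>).
  The parameter a repairs this: for small a the field g is comparable to q/a on q \<le> a, so the
  gain near T is as large as near time 0. The exact first-order condition is that the integral of q
  ((2g/q - g') I + g' R) is at most 0. As g' has no sign, the integral of q R is added on both
  sides; this gives the displayed estimate and explains why its right side is the energy rather than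
  0. Only \<delta> > 0 is used, so an inequality for each \<delta> suffices and no energy has to be
  differentiated. A change of time acts on whole slices: R is transported and I gains a factor
  \<open>\<theta>'\<close> squared, so the nonlinearity is never differentiated. The obstacle is
  admissibility, since the trace in the definition of the competitors asks for smooth functions
  converging on each cylinder. Smooth \<theta> keeps the approximants smooth,
  \<open>\<theta>'\<close> > 0 bounds the Jacobian from below on bounded times, and \<theta>(t)
  \<le> t maps each cylinder into itself. Hence a rational g instead of a piecewise linear
  one.\<close>

lemma C_k_imp_continuous: "C_k k f \<Longrightarrow> continuous_on UNIV f"
proof (cases k)
  case (Suc n)
  assume "C_k k f"
  then have "\<And>x. f differentiable (at x)" using Suc by simp
  then show ?thesis
    by (simp add: continuous_at_imp_continuous_on differentiable_imp_continuous_within)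
qed simp

lemma C_k_SucD: "C_k (Suc k) f \<Longrightarrow> C_k k f"
proof (induction k arbitrary: f)
  case 0
  then show ?case using C_k_imp_continuous[OF 0] by simp
next
  case (Suc k)
  then show ?case by simp
qed

lemma C_k_const: "C_k k (\<lambda>x. c)"
  by (induction k arbitrary: c) simp_all

lemma C_k_SucI:
  assumes "\<And>x. (f has_derivative f' x) (at x)" and "\<And>v. C_k k (\<lambda>x. f' x v)"
  shows "C_k (Suc k) f"
proof -
  have "frechet_derivative f (at x) = f' x" for x
    using assms(1) by (metis frechet_derivative_at)
  then show ?thesis using assms by (auto simp: differentiable_def)
qed

lemma C_k_Suc_has_derivative:
  "C_k (Suc k) f \<Longrightarrow> (f has_derivative frechet_derivative f (at x)) (at x)"
  by (simp add: frechet_derivative_works)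

lemma C_k_add: "C_k k f \<Longrightarrow> C_k k g \<Longrightarrow> C_k k (\<lambda>x. f x + g x)"
proof (induction k arbitrary: f g)
  case 0
  then show ?case by (simp add: continuous_on_add)
next
  case (Suc k)
  show ?case
    by (rule C_k_SucI[OF has_derivative_add[OF Suc.prems[THEN C_k_Suc_has_derivative]]])
      (use Suc in auto)
qed

lemma C_k_sum: "(\<And>i. i \<in> A \<Longrightarrow> C_k k (f i)) \<Longrightarrow> C_k k (\<lambda>x. \<Sum>i\<in>A. f i x)"
  by (induction A rule: infinite_finite_induct) (auto intro: C_k_const C_k_add)

lemma C_k_mult: "C_k k f \<Longrightarrow> C_k k g \<Longrightarrow> C_k k (\<lambda>x. f x * g x)"
proof (induction k arbitrary: f g)
  case 0
  then show ?case by (simp add: continuous_on_mult)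
next
  case (Suc k)
  have "C_k k f" "C_k k g" using Suc.prems by (blast intro: C_k_SucD)+
  then show ?case
    by (intro C_k_SucI[OF has_derivative_mult[OF Suc.prems[THEN C_k_Suc_has_derivative]]] C_k_add Suc.IH)
      (use Suc in auto)
qed

lemma C_k_bounded_linear: "bounded_linear f \<Longrightarrow> C_k k f"
proof (cases k)
  case 0
  assume "bounded_linear f"
  then show ?thesis using 0 by (simp add: linear_continuous_on)
next
  case (Suc n)
  assume f: "bounded_linear f"
  show ?thesis unfolding Suc
    by (rule C_k_SucI[OF bounded_linear_imp_has_derivative[OF f]]) (rule C_k_const)
qed

text \<open>\<open>C_k\<close> speaks of real-valued functions only, so the regularity of the inner
  map is stated through its components. The induction generalises \<open>f\<close> alone: every
  partial derivative of \<open>f\<close> is composed with the same \<open>g\<close>, and the chain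
  rule is a finite sum of products.\<close>

lemma C_k_compose:
  fixes g :: "'a::real_normed_vector \<Rightarrow> 'b::euclidean_space"
  assumes "C_k k f" "\<And>b. b \<in> Basis \<Longrightarrow> C_k k (\<lambda>x. g x \<bullet> b)"
  shows "C_k k (\<lambda>x. f (g x))"
  using assms
proof (induction k arbitrary: f)
  case 0
  have "continuous_on UNIV g"
    using 0 by (subst continuous_on_componentwise) auto
  then show ?case using 0 by (auto intro: continuous_on_compose2[of UNIV f])
next
  case (Suc k)
  let ?D = "\<lambda>x v. \<Sum>b\<in>Basis. frechet_derivative (\<lambda>y. g y \<bullet> b) (at x) v *\<^sub>R b"
  have g: "(g has_derivative ?D x) (at x)" for x
    using Suc.prems(2)[THEN C_k_Suc_has_derivative]
    by (subst has_derivative_componentwise_within) simp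
  have f: "(f has_derivative frechet_derivative f (at x)) (at x)" for x
    by (rule C_k_Suc_has_derivative[OF Suc.prems(1)])
  have lin: "frechet_derivative f (at y) (?D x v)
      = (\<Sum>b\<in>Basis. frechet_derivative (\<lambda>y. g y \<bullet> b) (at x) v * frechet_derivative f (at y) b)" for x y v
  proof -
    interpret linear "frechet_derivative f (at y)"
      by (rule has_derivative_linear[OF f])
    show ?thesis by (simp add: sum scale)
  qed
  show ?case
  proof (rule C_k_SucI[OF has_derivative_compose[OF g f]])
    fix v
    have "C_k k (\<lambda>x. frechet_derivative f (at (g x)) b)" for b
    proof (rule Suc.IH)
      show "C_k k (\<lambda>x. frechet_derivative f (at x) b)" using Suc.prems(1) by simp
      show "C_k k (\<lambda>x. g x \<bullet> b)" if "b \<in> Basis" for b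
        by (rule C_k_SucD) (rule Suc.prems(2)[OF that])
    qed
    moreover have "C_k k (\<lambda>x. frechet_derivative (\<lambda>y. g y \<bullet> b) (at x) v)" if "b \<in> Basis" for b
      using Suc.prems(2)[OF that] by simp
    ultimately show "C_k k (\<lambda>x. frechet_derivative f (at (g x)) (?D x v))"
      unfolding lin by (intro C_k_sum C_k_mult)
  qed
qed

lemma C_k_exp: "C_k k f \<Longrightarrow> C_k k (\<lambda>x. exp (f x))"
proof (induction k arbitrary: f)
  case 0
  then show ?case by (simp add: continuous_on_exp)
next
  case (Suc k)
  have d: "((\<lambda>x. exp (f x)) has_derivative (\<lambda>v. exp (f x) * frechet_derivative f (at x) v)) (at x)" for x
    by (rule DERIV_compose_FDERIV[OF DERIV_exp C_k_Suc_has_derivative[OF Suc.prems], simplified mult.commute])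
  have "C_k k f" using Suc.prems by (rule C_k_SucD)
  then show ?case
    by (intro C_k_SucI[OF d] C_k_mult Suc.IH) (use Suc in auto)
qed

lemma C_k_inverse: "C_k k f \<Longrightarrow> (\<And>x. f x \<noteq> 0) \<Longrightarrow> C_k k (\<lambda>x. inverse (f x))"
proof (induction k arbitrary: f)
  case 0
  then show ?case by (simp add: continuous_on_inverse)
next
  case (Suc k)
  have d: "((\<lambda>x. inverse (f x)) has_derivative
      (\<lambda>v. (-1 * (inverse (f x) * inverse (f x))) * frechet_derivative f (at x) v)) (at x)" for x
    using Deriv.has_derivative_inverse[OF Suc.prems(2) C_k_Suc_has_derivative[OF Suc.prems(1)]]
    by (simp add: mult_ac)
  have "C_k k f" using Suc.prems(1) by (rule C_k_SucD)
  then show ?case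
    by (intro C_k_SucI[OF d] C_k_mult C_k_const Suc.IH) (use Suc in auto)
qed

lemma C_k_ln: "C_k k f \<Longrightarrow> (\<And>x. f x > 0) \<Longrightarrow> C_k k (\<lambda>x. ln (f x))"
proof (cases k)
  case 0
  assume "C_k k f" "\<And>x. f x > 0"
  then show ?thesis using 0 by (auto intro!: continuous_on_ln simp: less_imp_neq[THEN not_sym])
next
  case (Suc n)
  assume f: "C_k k f" "\<And>x. f x > 0"
  have d: "((\<lambda>x. ln (f x)) has_derivative (\<lambda>v. inverse (f x) * frechet_derivative f (at x) v)) (at x)" for x
    using DERIV_compose_FDERIV[OF DERIV_ln[OF f(2)] C_k_Suc_has_derivative[OF f(1)[unfolded Suc]]]
    by (simp add: mult.commute)
  have "C_k n f" using f(1) C_k_SucD unfolding Suc by blast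
  then show ?thesis unfolding Suc
    by (intro C_k_SucI[OF d] C_k_mult C_k_inverse) (use Suc f less_imp_neq in \<open>auto simp: less_imp_neq[THEN not_sym]\<close>)
qed

lemma smooth_C_k: "smooth f \<Longrightarrow> C_k k f" by (simp add: smooth_def)

lemma smooth_has_derivative:
  "smooth f \<Longrightarrow> (f has_derivative frechet_derivative f (at x)) (at x)"
  using C_k_Suc_has_derivative[OF smooth_C_k[of f 1, simplified One_nat_def]] by simp

lemma smooth_derivative: "smooth f \<Longrightarrow> smooth (\<lambda>x. frechet_derivative f (at x) v)"
  unfolding smooth_def by (metis C_k.simps(2))

lemma smooth_continuous: "smooth f \<Longrightarrow> continuous_on A f"
  using smooth_C_k[of f 0] continuous_on_subset by force

lemma smooth_compose:
  fixes g :: "'a::real_normed_vector \<Rightarrow> 'b::euclidean_space"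
  assumes "smooth f" "\<And>b. b \<in> Basis \<Longrightarrow> smooth (\<lambda>x. g x \<bullet> b)"
  shows "smooth (\<lambda>x. f (g x))"
  using assms unfolding smooth_def by (blast intro: C_k_compose)

lemma smooth_const: "smooth (\<lambda>x. c)"
  and smooth_bounded_linear: "bounded_linear h \<Longrightarrow> smooth h"
  and smooth_add: "smooth f \<Longrightarrow> smooth g \<Longrightarrow> smooth (\<lambda>x. f x + g x)"
  and smooth_mult: "smooth f \<Longrightarrow> smooth g \<Longrightarrow> smooth (\<lambda>x. f x * g x)"
  and smooth_sum: "(\<And>i. i \<in> A \<Longrightarrow> smooth (F i)) \<Longrightarrow> smooth (\<lambda>x. \<Sum>i\<in>A. F i x)"
  and smooth_exp: "smooth f \<Longrightarrow> smooth (\<lambda>x. exp (f x))"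
  and smooth_ln: "smooth f \<Longrightarrow> (\<And>x. f x > 0) \<Longrightarrow> smooth (\<lambda>x. ln (f x))"
  and smooth_inverse: "smooth f \<Longrightarrow> (\<And>x. f x \<noteq> 0) \<Longrightarrow> smooth (\<lambda>x. inverse (f x))"
  unfolding smooth_def
  by (simp_all add: C_k_const C_k_bounded_linear C_k_add C_k_mult C_k_sum C_k_exp C_k_ln C_k_inverse)

lemma smooth_minus: "smooth f \<Longrightarrow> smooth g \<Longrightarrow> smooth (\<lambda>x. f x - g x)"
  using smooth_add[of f "\<lambda>x. (-1) * g x"] smooth_mult[OF smooth_const, of g "-1"] by simp

text \<open>The family of all \<open>flat m\<close> is closed under differentiation up to linear combinations.\<close>

definition flat :: "nat \<Rightarrow> real \<Rightarrow> real" where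
  "flat m t = (if t > 0 then inverse t ^ m * exp (- inverse t) else 0)"

text \<open>With s = 1/t this is the decay of s^m / exp s at infinity; on the left the function is
  0.\<close>

lemma flat_tendsto_0: "(flat m \<longlongrightarrow> 0) (at 0)"
proof -
  have "((\<lambda>s::real. s ^ m / exp s) \<longlongrightarrow> 0) at_top" by (rule tendsto_power_div_exp_0)
  then have "((\<lambda>t::real. inverse t ^ m / exp (inverse t)) \<longlongrightarrow> 0) (at_right 0)"
    by (rule filterlim_compose[OF _ filterlim_inverse_at_top_right])
  then have r: "(flat m \<longlongrightarrow> 0) (at_right 0)"
    by (rule Lim_transform_eventually)
      (auto simp: eventually_at_right_less flat_def exp_minus field_simps
        intro!: eventually_mono[OF eventually_at_right_less[of 0]])
  have l: "(flat m \<longlongrightarrow> 0) (at_left 0)"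
    by (rule tendsto_eventually) (auto simp: eventually_at_filter flat_def)
  show ?thesis using l r by (simp add: filterlim_split_at)
qed

lemma flat_has_derivative:
  "(flat m has_real_derivative (flat (m + 2) t - real m * flat (m + 1) t)) (at t)"
proof -
  consider "t > 0" | "t < 0" | "t = 0" by linarith
  then show ?thesis
  proof cases
    case 1
    have i: "(inverse has_real_derivative - (inverse t * inverse t)) (at t)"
      using 1 DERIV_inverse[of t UNIV] by (simp add: power2_eq_square)
    have e: "((\<lambda>t. exp (- inverse t)) has_real_derivative
        exp (- inverse t) * - (- (inverse t * inverse t))) (at t)"
      by (rule DERIV_fun_exp[OF DERIV_minus[OF i]])
    have "real m * (- (inverse t * inverse t) * inverse t ^ (m - Suc 0)) * exp (- inverse t)
        + exp (- inverse t) * - (- (inverse t * inverse t)) * inverse t ^ m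
        = flat (m + 2) t - real m * flat (m + 1) t"
      using 1 by (cases m) (simp_all add: flat_def algebra_simps)
    then have "((\<lambda>t. inverse t ^ m * exp (- inverse t)) has_real_derivative
        (flat (m + 2) t - real m * flat (m + 1) t)) (at t)"
      using DERIV_mult[OF DERIV_power[OF i, of m] e] by simp
    then show ?thesis
      by (rule has_field_derivative_transform_within_open[of _ _ _ "{0<..}"])
        (use 1 in \<open>auto simp: flat_def\<close>)
  next
    case 2
    have "((\<lambda>t. 0) has_real_derivative (flat (m + 2) t - real m * flat (m + 1) t)) (at t)"
      using 2 by (simp add: flat_def)
    then show ?thesis
      by (rule has_field_derivative_transform_within_open[of _ _ _ "{..<0}"])
        (use 2 in \<open>auto simp: flat_def\<close>)
  next
    case 3
    \<comment> \<open>The difference quotient of \<open>flat m\<close> at 0 is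
      \<open>flat (m + 1)\<close>, so the limit already known serves again.\<close>
    have "((\<lambda>h. (flat m (0 + h) - flat m 0) / h) \<longlongrightarrow> 0) (at 0)"
      by (rule Lim_transform_eventually[OF flat_tendsto_0[of "m + 1"]])
        (auto simp: flat_def eventually_at_filter field_simps)
    then show ?thesis unfolding 3 DERIV_def by (simp add: flat_def)
  qed
qed

lemma smooth_flat: "smooth (flat m)"
proof -
  have "C_k k (flat m)" for k
  proof (induction k arbitrary: m)
    case 0
    show ?case using flat_has_derivative
      by (auto intro!: DERIV_isCont continuous_at_imp_continuous_on)
  next
    case (Suc k)
    show ?case
    proof (rule C_k_SucI[OF flat_has_derivative[unfolded has_field_derivative_def]])
      show "C_k k (\<lambda>x. (flat (m + 2) x - real m * flat (m + 1) x) * v)" for v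
        using C_k_mult[OF C_k_add[OF Suc[of "m + 2"] C_k_mult[OF C_k_const[of _ "- real m"] Suc[of "m + 1"]]] C_k_const[of _ v]]
        by simp
    qed
  qed
  then show ?thesis by (simp add: smooth_def)
qed

subsection \<open>Mollification\<close>

lemma lborel_reflect: "lborel = distr lborel borel (\<lambda>y::'a::euclidean_space. x - y)"
  using lborel_affine[of "-1" x] by (simp add: density_1)

lemma nn_integral_reflect:
  fixes x :: "'a::euclidean_space"
  assumes [measurable]: "f \<in> borel_measurable borel"
  shows "(\<integral>\<^sup>+y. f (x - y) \<partial>lborel) = (\<integral>\<^sup>+y. f y \<partial>lborel)"
proof -
  have "(\<integral>\<^sup>+y. f y \<partial>lborel) = (\<integral>\<^sup>+y. f y \<partial>distr lborel borel (\<lambda>y. x - y))"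
    using lborel_reflect[of x] by simp
  then show ?thesis by (simp add: nn_integral_distr)
qed

lemma integral_reflect_lborel:
  fixes x :: "'a::euclidean_space" and f :: "'a \<Rightarrow> real"
  assumes [measurable]: "f \<in> borel_measurable borel"
  shows "(\<integral>y. f (x - y) \<partial>lborel) = (\<integral>y. f y \<partial>lborel)"
proof -
  have "(\<integral>y. f y \<partial>lborel) = (\<integral>y. f y \<partial>distr lborel borel (\<lambda>y. x - y))"
    using lborel_reflect[of x] by simp
  then show ?thesis by (simp add: integral_distr)
qed

lemma nn_integral_shift:
  fixes x :: "'a::euclidean_space"
  assumes [measurable]: "f \<in> borel_measurable borel"
  shows "(\<integral>\<^sup>+y. f (y - x) \<partial>lborel) = (\<integral>\<^sup>+y. f y \<partial>lborel)"
proof -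
  have "(\<integral>\<^sup>+y. f y \<partial>lborel) = (\<integral>\<^sup>+y. f y \<partial>distr lborel borel ((+) (- x)))"
    using lborel_distr_plus[of "- x"] by simp
  then show ?thesis by (simp add: nn_integral_distr)
qed

lemma integrable_continuous_supp:
  fixes f :: "'a::euclidean_space \<Rightarrow> real"
  assumes "continuous_on UNIV f" "\<And>x. R < norm x \<Longrightarrow> f x = 0"
  shows "integrable lborel f"
proof -
  have "integrable lborel (\<lambda>x. indicator (cball 0 R) x *\<^sub>R f x)"
    by (rule borel_integrable_compact) (use assms in \<open>auto intro: continuous_on_subset\<close>)
  moreover have "(\<lambda>x. indicator (cball 0 R) x *\<^sub>R f x) = f"
    using assms(2) by (fastforce simp: indicator_def not_le)
  ultimately show ?thesis by simp
qed

definition mollifier :: "real \<Rightarrow> ('a::euclidean_space \<Rightarrow> real) \<Rightarrow> bool" where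
  "mollifier d \<eta> \<longleftrightarrow> smooth \<eta> \<and> (\<forall>x. 0 \<le> \<eta> x) \<and> (\<forall>x. d < norm x \<longrightarrow> \<eta> x = 0) \<and>
     integral\<^sup>L lborel \<eta> = 1"

text \<open>The bump is exp (-1/(d^2 - |x|^2)) inside the ball. The squared norm is written as a sum
  of squared coordinates, so that smoothness of the argument of \<open>flat 0\<close> is that of a
  polynomial.\<close>

lemma mollifier_exists:
  assumes "d > 0"
  shows "\<exists>\<eta>::'a::euclidean_space \<Rightarrow> real. mollifier d \<eta>"
proof -
  define h :: "'a \<Rightarrow> real" where "h x = flat 0 (d\<^sup>2 - (\<Sum>b\<in>Basis. (x \<bullet> b) * (x \<bullet> b)))" for x
  have h_eq: "h x = flat 0 (d\<^sup>2 - (norm x)\<^sup>2)" for x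
    unfolding h_def by (simp add: power2_norm_eq_inner euclidean_inner[of x x])
  have sm: "smooth h" unfolding h_def
    by (rule smooth_compose[OF smooth_flat], simp)
      (intro smooth_minus smooth_const smooth_sum smooth_mult smooth_bounded_linear bounded_linear_inner_left)
  have nn: "h x \<ge> 0" for x by (simp add: h_def flat_def)
  have supp: "h x = 0" if "d < norm x" for x
    using that \<open>d > 0\<close> by (auto simp: h_eq flat_def not_less intro!: power_mono)
  have pos: "h x > 0" if "norm x < d" for x
    using that \<open>d > 0\<close> by (auto simp: h_eq flat_def intro!: power_strict_mono)
  have int: "integrable lborel h"
    by (rule integrable_continuous_supp[OF smooth_continuous[OF sm] supp])
  have "integral\<^sup>L lborel h \<noteq> 0"
  proof
    assume "integral\<^sup>L lborel h = 0"
    then have "AE x in lborel. h x = 0"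
      using integral_nonneg_eq_0_iff_AE[OF int] nn by simp
    then have "AE x in lborel. x \<notin> ball (0::'a) d"
      by (rule AE_mp) (use pos in \<open>auto intro!: AE_I2 simp: less_le\<close>)
    then have "ball (0::'a) d \<in> null_sets lborel"
      using AE_iff_null_sets[of "ball (0::'a) d" lborel] by simp
    then have "negligible (ball (0::'a) d)"
      unfolding negligible_iff_null_sets by (rule null_sets_completionI)
    then show False
      using \<open>d > 0\<close> open_not_negligible[OF open_ball, of "0::'a" d] by simp
  qed
  moreover have "integral\<^sup>L lborel h \<ge> 0" using nn by simp
  ultimately have c: "integral\<^sup>L lborel h > 0" by simp
  have "mollifier d (\<lambda>x. inverse (integral\<^sup>L lborel h) * h x)"
    unfolding mollifier_def using c nn supp by (auto intro!: smooth_mult smooth_const sm)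
  then show ?thesis by blast
qed

lemma mollifier_integrable: "mollifier d \<eta> \<Longrightarrow> integrable lborel \<eta>"
  by (rule integrable_continuous_supp[of \<eta> d]) (auto simp: mollifier_def smooth_continuous)

lemma mollifier_nn_integral:
  assumes "mollifier d \<eta>" shows "(\<integral>\<^sup>+x. ennreal (\<eta> x) \<partial>lborel) = 1"
  using nn_integral_eq_integral[OF mollifier_integrable[OF assms]] assms by (simp add: mollifier_def)

section \<open>Convolution with a smooth kernel of compact support\<close>

definition loc_int :: "('a::euclidean_space \<Rightarrow> real) \<Rightarrow> bool" where
  "loc_int f \<longleftrightarrow> f \<in> borel_measurable borel \<and>
     (\<forall>R. integrable lborel (\<lambda>y. indicator (ball 0 R) y * f y))"

definition conv :: "('a::euclidean_space \<Rightarrow> real) \<Rightarrow> ('a \<Rightarrow> real) \<Rightarrow> 'a \<Rightarrow> real" where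
  "conv f \<eta> x = (\<integral>y. f y * \<eta> (x - y) \<partial>lborel)"

lemma bounded_continuous_supp:
  fixes f :: "'a::euclidean_space \<Rightarrow> real"
  assumes "continuous_on UNIV f" "\<And>x. R < norm x \<Longrightarrow> f x = 0"
  obtains B where "B \<ge> 0" "\<And>x. \<bar>f x\<bar> \<le> B"
proof -
  have "compact (f ` cball 0 R)"
    by (rule compact_continuous_image) (use assms(1) in \<open>auto intro: continuous_on_subset\<close>)
  then obtain B where B: "\<And>x. x \<in> cball 0 R \<Longrightarrow> \<bar>f x\<bar> \<le> B"
    by (force dest: compact_imp_bounded simp: bounded_iff)
  have "\<bar>f x\<bar> \<le> max B 0" for x
    using B[of x] assms(2)[of x] by (cases "norm x \<le> R") auto
  then show ?thesis by (intro that[of "max B 0"]) auto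
qed

lemma conv_integrable:
  assumes f: "loc_int f" and \<psi>: "continuous_on UNIV \<psi>" "\<And>x. d < norm x \<Longrightarrow> \<psi> x = 0"
  shows "integrable lborel (\<lambda>y. f y * \<psi> (x - y))"
proof -
  obtain B where B: "B \<ge> 0" "\<And>x. \<bar>\<psi> x\<bar> \<le> B" using bounded_continuous_supp[OF \<psi>] by blast
  define R where "R = norm x + d + 1"
  have [measurable]: "f \<in> borel_measurable borel" using f by (simp add: loc_int_def)
  have [measurable]: "\<psi> \<in> borel_measurable borel" by (rule borel_measurable_continuous_onI[OF \<psi>(1)])
  have "integrable lborel (\<lambda>y. B * (indicator (ball 0 R) y * f y))"
    using f by (simp add: loc_int_def)
  then show ?thesis
  proof (rule Bochner_Integration.integrable_bound, simp, intro AE_I2)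
    fix y
    show "norm (f y * \<psi> (x - y)) \<le> norm (B * (indicator (ball 0 R) y * f y))"
    proof (cases "norm y < R")
      case True
      then show ?thesis using B mult_left_mono[OF B(2), of "\<bar>f y\<bar>" "x - y"]
        by (simp add: abs_mult mult.commute)
    next
      case False
      then have "d < norm (x - y)" using norm_triangle_ineq2[of y x]
        by (simp add: R_def norm_minus_commute)
      then show ?thesis using \<psi>(2) by simp
    qed
  qed
qed

lemma derivative_supp:
  assumes "\<And>x. d < norm x \<Longrightarrow> \<eta> x = 0" "d < norm (x::'a::euclidean_space)"
  shows "frechet_derivative \<eta> (at x) v = (0::real)"
proof -
  have "(\<eta> has_derivative (\<lambda>v. 0)) (at x)"
    by (rule has_derivative_transform_within_open[of "\<lambda>x. 0" _ _ _ "{x. d < norm x}"])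
      (use assms in \<open>auto intro!: open_Collect_less continuous_intros\<close>)
  then show ?thesis by (metis frechet_derivative_at)
qed

lemma derivative_componentwise:
  fixes \<eta> :: "'a::euclidean_space \<Rightarrow> real"
  assumes "smooth \<eta>"
  shows "frechet_derivative \<eta> (at x) v = (\<Sum>b\<in>Basis. (v \<bullet> b) * frechet_derivative \<eta> (at x) b)"
proof -
  interpret linear "frechet_derivative \<eta> (at x)"
    by (rule has_derivative_linear[OF smooth_has_derivative[OF assms]])
  have "frechet_derivative \<eta> (at x) v = frechet_derivative \<eta> (at x) (\<Sum>b\<in>Basis. (v \<bullet> b) *\<^sub>R b)"
    by (simp add: euclidean_representation)
  then show ?thesis by (simp add: sum scale)
qed

lemma uniformly_continuous_supp:
  fixes f :: "'a::euclidean_space \<Rightarrow> real"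
  assumes c: "continuous_on UNIV f" and s: "\<And>x. R < norm x \<Longrightarrow> f x = 0" and "e > 0"
  shows "\<exists>s>0. \<forall>x y :: 'a. norm (x - y) < s \<longrightarrow> \<bar>f x - f y\<bar> < e"
proof -
  have "uniformly_continuous_on (cball 0 (R + 2)) f"
    by (rule compact_uniformly_continuous) (use c in \<open>auto intro: continuous_on_subset\<close>)
  then obtain s where s': "s > 0"
    "\<And>x y. x \<in> cball 0 (R + 2) \<Longrightarrow> y \<in> cball 0 (R + 2) \<Longrightarrow> dist y x < s \<Longrightarrow> dist (f y) (f x) < e"
    using \<open>e > 0\<close> unfolding uniformly_continuous_on_def by meson
  show ?thesis
  proof (intro exI[of _ "min s 1"] conjI allI impI)
    fix x y :: 'a assume xy: "norm (x - y) < min s 1"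
    show "\<bar>f x - f y\<bar> < e"
    proof (cases "norm x \<le> R + 1")
      case True
      then have "norm y \<le> R + 2" using norm_triangle_ineq2[of y x] xy by (simp add: norm_minus_commute)
      then show ?thesis using s'(2)[of y x] xy True by (simp add: dist_norm)
    next
      case False
      then have "norm y > R" using norm_triangle_ineq2[of x y] xy by simp
      then show ?thesis using s[of x] s[of y] False \<open>e > 0\<close> by simp
    qed
  qed (use s' in auto)
qed

text \<open>The derivative has compact support and is therefore uniformly continuous, so the
  linearisation error is o(|h|) uniformly in the base point. This uniformity lets the error be
  integrated against \<open>f\<close> in \<open>conv_has_derivative\<close>.\<close>

lemma uniform_linearization:
  fixes \<eta> :: "'a::euclidean_space \<Rightarrow> real"
  assumes "smooth \<eta>" and s: "\<And>x. d < norm x \<Longrightarrow> \<eta> x = 0" and "e > 0"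
  shows "\<exists>s>0. \<forall>z h. norm h < s \<longrightarrow>
    \<bar>\<eta> (z + h) - \<eta> z - frechet_derivative \<eta> (at z) h\<bar> \<le> e * norm h"
proof -
  \<comment> \<open>Each basis direction may contribute this much to the operator norm.\<close>
  define e' where "e' = e / DIM('a)"
  have "e' > 0" using \<open>e > 0\<close> by (simp add: e'_def)
  have "\<exists>s>0. \<forall>x y. norm (x - y) < s \<longrightarrow>
      \<bar>frechet_derivative \<eta> (at x) b - frechet_derivative \<eta> (at y) b\<bar> < e'" for b :: 'a
    by (rule uniformly_continuous_supp[of _ d])
      (use assms(1) \<open>e' > 0\<close> derivative_supp[OF s] in \<open>auto intro: smooth_continuous smooth_derivative\<close>)
  then obtain \<sigma> where \<sigma>: "\<And>b::'a. \<sigma> b > 0" "\<And>b x y. norm (x - y) < \<sigma> b \<Longrightarrow>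
      \<bar>frechet_derivative \<eta> (at x) b - frechet_derivative \<eta> (at y) b\<bar> < e'" by metis
  define s where "s = Min (\<sigma> ` Basis)"
  have "s > 0" using \<sigma>(1) by (simp add: s_def)
  have on: "onorm (\<lambda>v. frechet_derivative \<eta> (at x) v - frechet_derivative \<eta> (at z) v) \<le> e"
    if "x \<in> ball z s" for x z
  proof (rule onorm_le)
    fix v
    have "norm (frechet_derivative \<eta> (at x) v - frechet_derivative \<eta> (at z) v)
      = \<bar>\<Sum>b\<in>Basis. (v \<bullet> b) * (frechet_derivative \<eta> (at x) b - frechet_derivative \<eta> (at z) b)\<bar>"
      unfolding derivative_componentwise[OF assms(1), of _ v]
      by (simp add: sum_subtractf right_diff_distrib)
    also have "\<dots> \<le> (\<Sum>b\<in>(Basis::'a set). norm v * e')"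
    proof (intro sum_abs[THEN order_trans] sum_mono)
      fix b :: 'a assume "b \<in> Basis"
      then have "norm (x - z) < \<sigma> b"
        using that Min_le[of "\<sigma> ` Basis" "\<sigma> b"] unfolding s_def
        by (simp add: dist_norm norm_minus_commute)
      then show "\<bar>(v \<bullet> b) * (frechet_derivative \<eta> (at x) b - frechet_derivative \<eta> (at z) b)\<bar> \<le> norm v * e'"
        unfolding abs_mult using Basis_le_norm[OF \<open>b \<in> Basis\<close>, of v] \<sigma>(2)[of x z b]
        by (intro mult_mono) auto
    qed
    also have "\<dots> = e * norm v" by (simp add: e'_def)
    finally show "norm (frechet_derivative \<eta> (at x) v - frechet_derivative \<eta> (at z) v) \<le> e * norm v" .
  qed
  show ?thesis
  proof (intro exI[of _ s] conjI allI impI \<open>s > 0\<close>)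
    fix z h :: 'a assume h: "norm h < s"
    have "norm (\<eta> (z + h) - \<eta> z - frechet_derivative \<eta> (at z) (z + h - z)) \<le> norm (z + h - z) * e"
    proof (rule differentiable_bound_linearization[of z "z + h" "ball z s" \<eta> "\<lambda>x. frechet_derivative \<eta> (at x)"])
      show "z + t *\<^sub>R (z + h - z) \<in> ball z s" if "t \<in> {0..1}" for t
        using that h mult_right_mono[of "\<bar>t\<bar>" 1 "norm h"] by (auto simp: dist_norm)
      show "(\<eta> has_derivative frechet_derivative \<eta> (at x)) (at x within ball z s)" for x
        using smooth_has_derivative[OF assms(1)] has_derivative_at_withinI by blast
      show "onorm (frechet_derivative \<eta> (at x) - frechet_derivative \<eta> (at z)) \<le> e" if "x \<in> ball z s" for x
        using on[OF that] by (simp add: fun_diff_def)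
    qed (use \<open>s > 0\<close> in auto)
    then show "\<bar>\<eta> (z + h) - \<eta> z - frechet_derivative \<eta> (at z) h\<bar> \<le> e * norm h"
      by (simp add: mult.commute)
  qed
qed

text \<open>The remainder of the convolution is the integral of \<open>f\<close> against the
  remainder of the kernel. The latter is small relative to |h|, uniformly, and lives on a ball where
  \<open>f\<close> is integrable.\<close>

lemma conv_has_derivative:
  fixes f \<eta> :: "'a::euclidean_space \<Rightarrow> real"
  assumes f: "loc_int f" and \<eta>: "smooth \<eta>" and s: "\<And>x. d < norm x \<Longrightarrow> \<eta> x = 0"
  shows "(conv f \<eta> has_derivative (\<lambda>v. conv f (\<lambda>z. frechet_derivative \<eta> (at z) v) x)) (at x)"
proof -
  let ?D = "\<lambda>v z. frechet_derivative \<eta> (at z) v"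
  have int\<eta>: "integrable lborel (\<lambda>y. f y * \<eta> (x - y))" for x
    by (rule conv_integrable[OF f smooth_continuous[OF \<eta>] s])
  have intD: "integrable lborel (\<lambda>y. f y * ?D v (x - y))" for x v
    by (rule conv_integrable[OF f smooth_continuous[OF smooth_derivative[OF \<eta>]] derivative_supp[OF s]])
  have "linear (\<lambda>v. conv f (?D v) x)"
  proof (rule linearI)
    fix v w :: 'a and c :: real
    have lin: "linear (frechet_derivative \<eta> (at z))" for z
      by (rule has_derivative_linear[OF smooth_has_derivative[OF \<eta>]])
    show "conv f (?D (v + w)) x = conv f (?D v) x + conv f (?D w) x"
      unfolding conv_def linear_add[OF lin] distrib_left
      by (rule Bochner_Integration.integral_add[OF intD intD])
    show "conv f (?D (c *\<^sub>R v)) x = c *\<^sub>R conv f (?D v) x"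
      unfolding conv_def linear_scale[OF lin] by (simp add: mult.left_commute)
  qed
  then have bl: "bounded_linear (\<lambda>v. conv f (?D v) x)" by (rule linear_conv_bounded_linear[THEN iffD1])
  \<comment> \<open>For |h| < 1 the kernels centred at \<open>x\<close> and at \<open>x + h\<close>,
    and the derivative of the first one, all vanish outside the ball of this radius.\<close>
  define R where "R = norm x + d + 2"
  define M where "M = (\<integral>y. \<bar>indicator (ball 0 R) y * f y\<bar> \<partial>lborel)"
  have "M \<ge> 0" by (simp add: M_def)
  have intM: "integrable lborel (\<lambda>y. \<bar>indicator (ball 0 R) y * f y\<bar>)"
    using f by (simp add: loc_int_def)
  show ?thesis
    unfolding has_derivative_at_alt
  proof (intro conjI bl allI impI)
    fix e :: real assume "e > 0"
    define e' where "e' = e / (M + 1)"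
    have e': "e' > 0" "e' * M \<le> e" using \<open>e > 0\<close> \<open>M \<ge> 0\<close> by (auto simp: e'_def field_simps)
    obtain \<sigma> where \<sigma>: "\<sigma> > 0" "\<And>z h. norm h < \<sigma> \<Longrightarrow> \<bar>\<eta> (z + h) - \<eta> z - ?D h z\<bar> \<le> e' * norm h"
      using uniform_linearization[OF \<eta> s e'(1)] by blast
    show "\<exists>t>0. \<forall>y. norm (y - x) < t \<longrightarrow>
        norm (conv f \<eta> y - conv f \<eta> x - conv f (?D (y - x)) x) \<le> e * norm (y - x)"
    proof (intro exI[of _ "min \<sigma> 1"] conjI allI impI)
      fix y assume y: "norm (y - x) < min \<sigma> 1"
      define h where "h = y - x"
      have y_eq: "y = x + h" and h: "norm h < \<sigma>" "norm h < 1" using y by (auto simp: h_def)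
      let ?r = "\<lambda>w::'a. \<eta> (y - w) - \<eta> (x - w) - ?D h (x - w)"
      have eq: "conv f \<eta> y - conv f \<eta> x - conv f (?D h) x = (\<integral>w. f w * ?r w \<partial>lborel)"
        unfolding conv_def right_diff_distrib
        by (simp add: Bochner_Integration.integral_diff int\<eta> intD)
      have "norm (\<integral>w. f w * ?r w \<partial>lborel) \<le> (\<integral>w. (e' * norm h) * \<bar>indicator (ball 0 R) w * f w\<bar> \<partial>lborel)"
      proof (rule Bochner_Integration.integral_norm_bound_integral)
        show "integrable lborel (\<lambda>w. f w * ?r w)"
          unfolding right_diff_distrib by (intro Bochner_Integration.integrable_diff int\<eta> intD)
        show "integrable lborel (\<lambda>w. (e' * norm h) * \<bar>indicator (ball 0 R) w * f w\<bar>)"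
          using intM by simp
        fix w :: 'a
        show "norm (f w * ?r w) \<le> (e' * norm h) * \<bar>indicator (ball 0 R) w * f w\<bar>"
        proof (cases "norm w < R")
          case True
          have "\<bar>?r w\<bar> \<le> e' * norm h" using \<sigma>(2)[OF h(1), of "x - w"] by (simp add: y_eq algebra_simps)
          from mult_left_mono[OF this, of "\<bar>f w\<bar>"] show ?thesis
            using True by (simp add: abs_mult mult.commute)
        next
          case False
          then have n: "norm (x - w) > d + 1" using norm_triangle_ineq2[of w x]
            by (simp add: R_def norm_minus_commute)
          moreover have "norm (y - w) > d"
            using norm_triangle_ineq2[of "x - w" "- h"] n h by (simp add: y_eq algebra_simps)
          ultimately have "?r w = 0" using s derivative_supp[OF s, where x = "x - w"] by simp
          then show ?thesis using e' by simp
        qed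
      qed
      also have "\<dots> = e' * M * norm h" by (simp add: M_def)
      also have "\<dots> \<le> e * norm h" using e'(2) by (intro mult_right_mono) auto
      finally show "norm (conv f \<eta> y - conv f \<eta> x - conv f (?D (y - x)) x) \<le> e * norm (y - x)"
        using eq by (simp add: h_def)
    qed (use \<sigma> in auto)
  qed
qed

text \<open>Every derivative falls on the kernel and keeps the support radius, hence the induction
  over all kernels at once.\<close>

lemma smooth_conv:
  assumes f: "loc_int f" and \<eta>: "smooth \<eta>" and s: "\<And>x. d < norm x \<Longrightarrow> \<eta> x = 0"
  shows "smooth (conv f \<eta>)"
proof -
  have "C_k k (conv f \<eta>)" if "smooth \<eta>" "\<And>x. d < norm x \<Longrightarrow> \<eta> x = 0" for k \<eta>
    using that
  proof (induction k arbitrary: \<eta>)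
    case 0
    have "isCont (conv f \<eta>) x" for x
      using has_derivative_continuous[OF conv_has_derivative[OF f 0]] .
    then show ?case by (simp add: continuous_at_imp_continuous_on)
  next
    case (Suc k)
    show ?case
      by (rule C_k_SucI[OF conv_has_derivative[OF f Suc.prems]], assumption)
        (rule Suc.IH[OF smooth_derivative[OF Suc.prems(1)] derivative_supp[OF Suc.prems(2)]])
  qed
  then show ?thesis using \<eta> s by (simp add: smooth_def)
qed

lemma ball_borel [measurable]: "ball (x::'a::metric_space) r \<in> sets borel"
  by simp

section \<open>Mollification in local L^p\<close>

lemma ennreal_le_mult_add:
  assumes "a \<le> k * (b + c)" "b \<ge> 0" "c \<ge> 0" "k \<ge> 0"
  shows "ennreal a \<le> ennreal k * (ennreal b + ennreal c)"
proof -
  have "ennreal a \<le> ennreal (k * (b + c))" using assms(1) by (rule ennreal_leI)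
  also have "\<dots> = ennreal k * (ennreal b + ennreal c)" using assms by (simp add: ennreal_mult)
  finally show ?thesis .
qed

text \<open>Two exponents occur below: 1 in the fundamental lemma on test functions, 2 in the
  approximation of H^1 functions.\<close>

lemma power_sum_le:
  fixes a b :: real
  assumes "p = 1 \<or> p = 2" "a \<ge> 0" "b \<ge> 0"
  shows "(a + b) ^ p \<le> 2 * (a ^ p + b ^ p)"
proof -
  have "(a + b)\<^sup>2 \<le> 2 * (a\<^sup>2 + b\<^sup>2)"
    using sum_squares_bound[of a b] by (simp add: power2_sum)
  then show ?thesis using assms by auto
qed

lemma Lp_imp_loc_int:
  fixes f :: "'a::euclidean_space \<Rightarrow> real"
  assumes p: "p = 1 \<or> p = 2" and [measurable]: "f \<in> borel_measurable borel"
    and fin: "\<And>R. (\<integral>\<^sup>+x\<in>ball 0 R. ennreal (\<bar>f x\<bar> ^ p) \<partial>lborel) < \<infinity>"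
  shows "loc_int f"
  unfolding loc_int_def
proof (intro conjI allI)
  fix R
  show "integrable lborel (\<lambda>y. indicator (ball 0 R) y * f y)"
  proof (rule integrableI_bounded)
    have "(\<integral>\<^sup>+x. ennreal (norm (indicator (ball 0 R) x * f x)) \<partial>lborel)
        \<le> (\<integral>\<^sup>+x. indicator (ball 0 R) x + ennreal (\<bar>f x\<bar> ^ p) * indicator (ball 0 R) x \<partial>lborel)"
    proof (intro nn_integral_mono)
      fix x
      have "\<bar>f x\<bar> \<le> 1 + \<bar>f x\<bar> ^ p"
        using p self_le_power[of "\<bar>f x\<bar>" p]
        by (cases "\<bar>f x\<bar> \<le> 1") (auto intro: order_trans[of _ 1])
      then have "ennreal \<bar>f x\<bar> \<le> ennreal 1 + ennreal (\<bar>f x\<bar> ^ p)"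
        using ennreal_le_mult_add[of "\<bar>f x\<bar>" 1 1 "\<bar>f x\<bar> ^ p"] by simp
      then show "ennreal (norm (indicator (ball 0 R) x * f x))
          \<le> indicator (ball 0 R) x + ennreal (\<bar>f x\<bar> ^ p) * indicator (ball 0 R) x"
        by (simp add: indicator_def)
    qed
    also have "\<dots> = emeasure lborel (ball (0::'a) R) + (\<integral>\<^sup>+x\<in>ball 0 R. ennreal (\<bar>f x\<bar> ^ p) \<partial>lborel)"
      by (subst nn_integral_add) auto
    also have "\<dots> < \<infinity>"
      using fin[of R] emeasure_bounded_finite[of "ball (0::'a) R"] by simp
    finally show "(\<integral>\<^sup>+x. ennreal (norm (indicator (ball 0 R) x * f x)) \<partial>lborel) < \<infinity>" .
  qed simp
qed fact

text \<open>Jensen's inequality for the probability density \<open>\<eta>\<close>. For the exponent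
  2 it is Cauchy-Schwarz after splitting \<open>\<eta>\<close> into two square roots.\<close>

lemma conv_power_le:
  fixes h \<eta> :: "'a::euclidean_space \<Rightarrow> real"
  assumes p: "p = 1 \<or> p = 2" and [measurable]: "h \<in> borel_measurable borel" and \<eta>: "mollifier d \<eta>"
  shows "ennreal (\<bar>conv h \<eta> x\<bar> ^ p) \<le> (\<integral>\<^sup>+y. ennreal (\<bar>h y\<bar> ^ p) * ennreal (\<eta> (x - y)) \<partial>lborel)"
proof -
  have [measurable]: "\<eta> \<in> borel_measurable borel"
    using \<eta> by (intro borel_measurable_continuous_onI smooth_continuous) (simp add: mollifier_def)
  have nn: "\<eta> z \<ge> 0" for z using \<eta> by (simp add: mollifier_def)
  have 1: "ennreal \<bar>conv h \<eta> x\<bar> \<le> (\<integral>\<^sup>+y. ennreal \<bar>h y\<bar> * ennreal (\<eta> (x - y)) \<partial>lborel)"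
  proof (cases "integrable lborel (\<lambda>y. h y * \<eta> (x - y))")
    case True
    then show ?thesis using integral_norm_bound_ennreal[OF True] nn
      by (simp add: conv_def abs_mult ennreal_mult)
  next
    case False
    \<comment> \<open>The Bochner integral of a non-integrable function is 0 by convention, so the
      bound is trivial.\<close>
    then show ?thesis by (simp add: conv_def not_integrable_integral_eq)
  qed
  show ?thesis
  proof (cases "p = 1")
    case False
    then have "p = 2" using p by simp
    have sq: "ennreal (\<eta> z) = ennreal (sqrt (\<eta> z)) * ennreal (sqrt (\<eta> z))" for z
      using nn[of z] by (simp flip: ennreal_mult)
    have "ennreal (\<bar>conv h \<eta> x\<bar> ^ 2) \<le> (\<integral>\<^sup>+y. ennreal \<bar>h y\<bar> * ennreal (\<eta> (x - y)) \<partial>lborel)\<^sup>2"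
      using power_mono[OF 1, of 2] by (simp add: ennreal_power)
    also have "\<dots> = (\<integral>\<^sup>+y. (ennreal \<bar>h y\<bar> * ennreal (sqrt (\<eta> (x - y)))) * ennreal (sqrt (\<eta> (x - y))) \<partial>lborel)\<^sup>2"
      by (simp only: sq mult.assoc)
    also have "\<dots> \<le> (\<integral>\<^sup>+y. (ennreal \<bar>h y\<bar> * ennreal (sqrt (\<eta> (x - y))))\<^sup>2 \<partial>lborel)
        * (\<integral>\<^sup>+y. (ennreal (sqrt (\<eta> (x - y))))\<^sup>2 \<partial>lborel)"
      by (rule Cauchy_Schwarz_nn_integral) measurable
    also have "(\<integral>\<^sup>+y. (ennreal (sqrt (\<eta> (x - y))))\<^sup>2 \<partial>lborel) = (\<integral>\<^sup>+y. ennreal (\<eta> (x - y)) \<partial>lborel)"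
      using nn by (simp add: ennreal_power)
    also have "\<dots> = 1"
      using nn_integral_reflect[of "\<lambda>y. ennreal (\<eta> y)" x] mollifier_nn_integral[OF \<eta>] by simp
    also have "(\<integral>\<^sup>+y. (ennreal \<bar>h y\<bar> * ennreal (sqrt (\<eta> (x - y))))\<^sup>2 \<partial>lborel)
        = (\<integral>\<^sup>+y. ennreal (\<bar>h y\<bar> ^ 2) * ennreal (\<eta> (x - y)) \<partial>lborel)"
      using nn by (simp add: power_mult_distrib ennreal_power)
    finally show ?thesis using \<open>p = 2\<close> by simp
  qed (use 1 in simp)
qed

text \<open>Jensen's bound is integrated and the integrals are exchanged: the kernel has mass 1 in
  \<open>x\<close>, and a point \<open>y\<close> that is felt inside \<open>ball 0 r\<close> lies in
  \<open>ball 0 (r + d)\<close>.\<close>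

lemma conv_Lp_contraction:
  fixes h \<eta> :: "'a::euclidean_space \<Rightarrow> real"
  assumes p: "p = 1 \<or> p = 2" and [measurable]: "h \<in> borel_measurable borel" and \<eta>: "mollifier d \<eta>"
  shows "(\<integral>\<^sup>+x\<in>ball 0 r. ennreal (\<bar>conv h \<eta> x\<bar> ^ p) \<partial>lborel)
    \<le> (\<integral>\<^sup>+x\<in>ball 0 (r + d). ennreal (\<bar>h x\<bar> ^ p) \<partial>lborel)"
proof -
  have [measurable]: "\<eta> \<in> borel_measurable borel"
    using \<eta> by (intro borel_measurable_continuous_onI smooth_continuous) (simp add: mollifier_def)
  let ?F = "\<lambda>x y. ennreal (\<bar>h y\<bar> ^ p) * ennreal (\<eta> (x - y)) * indicator (ball 0 r) x"
  have "(\<integral>\<^sup>+x\<in>ball 0 r. ennreal (\<bar>conv h \<eta> x\<bar> ^ p) \<partial>lborel) \<le> (\<integral>\<^sup>+x. \<integral>\<^sup>+y. ?F x y \<partial>lborel \<partial>lborel)"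
    using conv_power_le[OF p assms(2) \<eta>]
    by (intro nn_integral_mono) (auto simp: indicator_def)
  also have "\<dots> = (\<integral>\<^sup>+y. \<integral>\<^sup>+x. ?F x y \<partial>lborel \<partial>lborel)"
    by (rule lborel_pair.Fubini'[symmetric]) measurable
  also have "\<dots> \<le> (\<integral>\<^sup>+y. ennreal (\<bar>h y\<bar> ^ p) * indicator (ball 0 (r + d)) y \<partial>lborel)"
  proof (rule nn_integral_mono)
    fix y :: 'a
    have "(\<integral>\<^sup>+x. ?F x y \<partial>lborel) \<le> (\<integral>\<^sup>+x. (ennreal (\<bar>h y\<bar> ^ p) * indicator (ball 0 (r + d)) y) * ennreal (\<eta> (x - y)) \<partial>lborel)"
    proof (rule nn_integral_mono)
      fix x :: 'a
      show "?F x y \<le> (ennreal (\<bar>h y\<bar> ^ p) * indicator (ball 0 (r + d)) y) * ennreal (\<eta> (x - y))"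
      proof (cases "norm x < r \<and> norm (x - y) \<le> d")
        case True
        then have "norm y < r + d" using norm_triangle_ineq2[of y x] by (simp add: norm_minus_commute)
        then show ?thesis by (simp add: indicator_def)
      next
        case False
        then have "norm x \<ge> r \<or> \<eta> (x - y) = 0" using \<eta> by (auto simp: mollifier_def)
        then show ?thesis by auto
      qed
    qed
    also have "\<dots> = (ennreal (\<bar>h y\<bar> ^ p) * indicator (ball 0 (r + d)) y) * (\<integral>\<^sup>+x. ennreal (\<eta> (x - y)) \<partial>lborel)"
      by (rule nn_integral_cmult) measurable
    also have "(\<integral>\<^sup>+x. ennreal (\<eta> (x - y)) \<partial>lborel) = 1"
      using nn_integral_shift[of "\<lambda>x. ennreal (\<eta> x)" y] mollifier_nn_integral[OF \<eta>] by simp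
    finally show "(\<integral>\<^sup>+x. ?F x y \<partial>lborel) \<le> ennreal (\<bar>h y\<bar> ^ p) * indicator (ball 0 (r + d)) y" by simp
  qed
  finally show ?thesis .
qed

lemma Lp_dominated_zero:
  fixes u :: "nat \<Rightarrow> 'a::euclidean_space \<Rightarrow> real"
  assumes [measurable]: "\<And>n. u n \<in> borel_measurable borel" "w \<in> borel_measurable borel"
    and b: "\<And>n x. \<bar>u n x\<bar> \<le> w x"
    and w: "(\<integral>\<^sup>+x\<in>ball 0 R. ennreal (w x ^ p) \<partial>lborel) < \<infinity>"
    and l: "AE x in lborel. (\<lambda>n. u n x) \<longlonglongrightarrow> 0" and "p > 0"
  shows "(\<lambda>n. \<integral>\<^sup>+x\<in>ball 0 R. ennreal (\<bar>u n x\<bar> ^ p) \<partial>lborel) \<longlonglongrightarrow> 0"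
proof -
  have "(\<lambda>n. \<integral>\<^sup>+x\<in>ball 0 R. ennreal (\<bar>u n x\<bar> ^ p) \<partial>lborel) \<longlonglongrightarrow> (\<integral>\<^sup>+x. 0 \<partial>(lborel :: 'a measure))"
  proof (rule nn_integral_dominated_convergence[OF _ _ _ _ w])
    show "AE x in lborel. ennreal (\<bar>u j x\<bar> ^ p) * indicator (ball 0 R) x
        \<le> ennreal (w x ^ p) * indicator (ball 0 R) x" for j
      by (intro AE_I2 mult_right_mono ennreal_leI power_mono b) auto
    show "AE x in lborel. (\<lambda>n. ennreal (\<bar>u n x\<bar> ^ p) * indicator (ball 0 R) x) \<longlonglongrightarrow> 0"
      using l
    proof (eventually_elim)
      case (elim x)
      have "(\<lambda>n. ennreal (\<bar>u n x\<bar> ^ p)) \<longlonglongrightarrow> ennreal (\<bar>0\<bar> ^ p)"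
        by (intro tendsto_ennrealI tendsto_intros elim)
      then have "(\<lambda>n. ennreal (\<bar>u n x\<bar> ^ p)) \<longlonglongrightarrow> 0"
        using \<open>p > 0\<close> by (simp add: zero_power)
      then show ?case by (cases "x \<in> ball 0 R") auto
    qed
  qed measurable
  then show ?thesis by simp
qed

text \<open>Measurability provides continuous functions converging almost everywhere, but without a
  dominating function. Truncating \<open>f\<close> at a large height n, and then the approximants at
  the same height, supplies the bound \<open>2 * real n\<close> on the ball. Two errors below e/4
  suffice because \<open>power_sum_le\<close> costs a factor 2.\<close>

lemma Lp_approx_continuous:
  fixes f :: "'a::euclidean_space \<Rightarrow> real"
  assumes p: "p = 1 \<or> p = 2" and [measurable]: "f \<in> borel_measurable borel"
    and fin: "(\<integral>\<^sup>+x\<in>ball 0 R. ennreal (\<bar>f x\<bar> ^ p) \<partial>lborel) < \<infinity>" and "e > 0"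
  shows "\<exists>g. continuous_on UNIV g \<and> (\<integral>\<^sup>+x\<in>ball 0 R. ennreal (\<bar>f x - g x\<bar> ^ p) \<partial>lborel) < ennreal e"
proof -
  define T :: "real \<Rightarrow> real \<Rightarrow> real" where "T M v = max (- M) (min M v)" for M v
  have p0: "p > 0" using p by auto
  have [measurable]: "T M \<in> borel_measurable borel" for M unfolding T_def by measurable
  have e4: "(0::ennreal) < ennreal (e / 4)" using \<open>e > 0\<close> by simp
  have "(\<lambda>n. \<integral>\<^sup>+x\<in>ball 0 R. ennreal (\<bar>f x - T (real n) (f x)\<bar> ^ p) \<partial>lborel) \<longlonglongrightarrow> 0"
  proof (rule Lp_dominated_zero[OF _ _ _ fin])
    show "\<bar>f x - T (real n) (f x)\<bar> \<le> \<bar>f x\<bar>" for n x by (auto simp: T_def)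
    have "(\<lambda>n. f x - T (real n) (f x)) \<longlonglongrightarrow> 0" for x
    proof (rule tendsto_eventually)
      obtain N where N: "\<bar>f x\<bar> \<le> real N" using real_arch_simple by blast
      show "\<forall>\<^sub>F n in sequentially. f x - T (real n) (f x) = 0"
        using eventually_ge_at_top[of N] by eventually_elim (use N in \<open>auto simp: T_def\<close>)
    qed
    then show "AE x in lborel. (\<lambda>n. f x - T (real n) (f x)) \<longlonglongrightarrow> 0" by simp
  qed (use p0 in measurable)
  from order_tendstoD(2)[OF this e4] obtain n where n:
    "(\<integral>\<^sup>+x\<in>ball 0 R. ennreal (\<bar>f x - T (real n) (f x)\<bar> ^ p) \<partial>lborel) < ennreal (e / 4)"
    by (auto simp: eventually_sequentially)
  have "f measurable_on UNIV"
    by (intro lebesgue_measurable_imp_measurable_on_real measurable_completion) auto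
  then obtain N g where N: "negligible N" and g: "\<And>k. continuous_on UNIV (g k)"
    and lim: "\<And>x. x \<notin> N \<Longrightarrow> (\<lambda>k. g k x) \<longlonglongrightarrow> f x"
    unfolding measurable_on_def by auto
  have contT: "continuous_on UNIV (\<lambda>x. T (real n) (g k x))" for k
    unfolding T_def by (intro continuous_intros g)
  have [measurable]: "g k \<in> borel_measurable borel" for k
    by (rule borel_measurable_continuous_onI[OF g])
  have "(\<lambda>k. \<integral>\<^sup>+x\<in>ball 0 R. ennreal (\<bar>T (real n) (f x) - T (real n) (g k x)\<bar> ^ p) \<partial>lborel) \<longlonglongrightarrow> 0"
  proof (rule Lp_dominated_zero)
    show "\<bar>T (real n) (f x) - T (real n) (g k x)\<bar> \<le> 2 * real n" for k x by (auto simp: T_def)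
    show "(\<integral>\<^sup>+x\<in>ball (0::'a) R. ennreal ((2 * real n) ^ p) \<partial>lborel) < \<infinity>"
      using emeasure_bounded_finite[of "ball (0::'a) R"]
      by (subst nn_integral_cmult_indicator) (auto simp: ennreal_mult_less_top)
    have "AE x in lebesgue. x \<notin> N" using N by (simp add: AE_not_in negligible_iff_null_sets)
    then have "AE x in lborel. x \<notin> N" by (simp add: AE_completion_iff)
    then show "AE x in lborel. (\<lambda>k. T (real n) (f x) - T (real n) (g k x)) \<longlonglongrightarrow> 0"
    proof eventually_elim
      case (elim x)
      have "(\<lambda>k. T (real n) (f x) - T (real n) (g k x)) \<longlonglongrightarrow> T (real n) (f x) - T (real n) (f x)"
        unfolding T_def by (intro tendsto_intros lim elim)
      then show ?case by simp
    qed
  qed (use p0 in measurable)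
  from order_tendstoD(2)[OF this e4] obtain k where k:
    "(\<integral>\<^sup>+x\<in>ball 0 R. ennreal (\<bar>T (real n) (f x) - T (real n) (g k x)\<bar> ^ p) \<partial>lborel) < ennreal (e / 4)"
    by (auto simp: eventually_sequentially)
  have "(\<integral>\<^sup>+x\<in>ball 0 R. ennreal (\<bar>f x - T (real n) (g k x)\<bar> ^ p) \<partial>lborel)
    \<le> (\<integral>\<^sup>+x. 2 * (ennreal (\<bar>f x - T (real n) (f x)\<bar> ^ p) * indicator (ball 0 R) x
        + ennreal (\<bar>T (real n) (f x) - T (real n) (g k x)\<bar> ^ p) * indicator (ball 0 R) x) \<partial>lborel)"
  proof (rule nn_integral_mono)
    fix x
    let ?a = "\<bar>f x - T (real n) (f x)\<bar>" and ?b = "\<bar>T (real n) (f x) - T (real n) (g k x)\<bar>"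
    have "\<bar>f x - T (real n) (g k x)\<bar> ^ p \<le> (?a + ?b) ^ p" by (intro power_mono) auto
    also have "\<dots> \<le> 2 * (?a ^ p + ?b ^ p)" by (rule power_sum_le[OF p]) auto
    finally have "ennreal (\<bar>f x - T (real n) (g k x)\<bar> ^ p) \<le> ennreal 2 * (ennreal (?a ^ p) + ennreal (?b ^ p))"
      by (rule ennreal_le_mult_add) auto
    then show "ennreal (\<bar>f x - T (real n) (g k x)\<bar> ^ p) * indicator (ball 0 R) x
      \<le> 2 * (ennreal (?a ^ p) * indicator (ball 0 R) x + ennreal (?b ^ p) * indicator (ball 0 R) x)"
      by (simp add: indicator_def)
  qed
  also have "\<dots> = 2 * ((\<integral>\<^sup>+x\<in>ball 0 R. ennreal (\<bar>f x - T (real n) (f x)\<bar> ^ p) \<partial>lborel)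
      + (\<integral>\<^sup>+x\<in>ball 0 R. ennreal (\<bar>T (real n) (f x) - T (real n) (g k x)\<bar> ^ p) \<partial>lborel))"
    by (subst nn_integral_cmult, measurable, subst nn_integral_add) measurable
  also have "\<dots> < 2 * (ennreal (e / 4) + ennreal (e / 4))"
    using n k by (intro ennreal_mult_strict_left_mono add_strict_mono) auto
  also have "\<dots> = ennreal e"
    using \<open>e > 0\<close> by (simp flip: ennreal_plus ennreal_numeral ennreal_mult)
  finally show ?thesis using contT by blast
qed

lemma conv_diff:
  assumes "loc_int f" "loc_int g" "mollifier d \<eta>"
  shows "conv (\<lambda>y. f y - g y) \<eta> x = conv f \<eta> x - conv g \<eta> x"
proof -
  have \<eta>: "continuous_on UNIV \<eta>" "\<And>x. d < norm x \<Longrightarrow> \<eta> x = 0"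
    using assms(3) by (auto simp: mollifier_def intro: smooth_continuous)
  show ?thesis
    unfolding conv_def left_diff_distrib
    by (intro Bochner_Integration.integral_diff conv_integrable[OF _ \<eta>] assms)
qed

lemma conv_const: 
  assumes "mollifier d \<eta>" shows "conv (\<lambda>y. c) \<eta> x = c"
proof -
  have [measurable]: "\<eta> \<in> borel_measurable borel"
    using assms by (intro borel_measurable_continuous_onI smooth_continuous) (simp add: mollifier_def)
  show ?thesis using assms integral_reflect_lborel[of \<eta> x] by (simp add: conv_def mollifier_def)
qed

lemma loc_int_continuous:
  fixes g :: "'a::euclidean_space \<Rightarrow> real"
  assumes "continuous_on UNIV g"
  shows "loc_int g"
  unfolding loc_int_def
proof (intro conjI allI)
  show [measurable]: "g \<in> borel_measurable borel" by (rule borel_measurable_continuous_onI[OF assms])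
  fix R
  have "integrable lborel (\<lambda>y. indicator (cball 0 R) y *\<^sub>R g y)"
    by (rule borel_integrable_compact) (use assms in \<open>auto intro: continuous_on_subset\<close>)
  then show "integrable lborel (\<lambda>y. indicator (ball 0 R) y * g y)"
    by (rule Bochner_Integration.integrable_bound) (auto simp: indicator_def)
qed

lemma conv_continuous_approx:
  fixes g :: "'a::euclidean_space \<Rightarrow> real"
  assumes g: "continuous_on UNIV g" and "e > 0"
  shows "\<exists>s>0. \<forall>d \<eta> (x::'a). d \<le> s \<and> mollifier d \<eta> \<and> norm x < r \<longrightarrow> \<bar>conv g \<eta> x - g x\<bar> \<le> e"
proof -
  have "uniformly_continuous_on (cball 0 (r + 1)) g"
    by (rule compact_uniformly_continuous) (use g in \<open>auto intro: continuous_on_subset\<close>)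
  then obtain s where s: "s > 0"
    "\<And>x y. x \<in> cball 0 (r + 1) \<Longrightarrow> y \<in> cball 0 (r + 1) \<Longrightarrow> dist y x < s \<Longrightarrow> dist (g y) (g x) < e"
    using \<open>e > 0\<close> unfolding uniformly_continuous_on_def by meson
  show ?thesis
  proof (intro exI[of _ "min (s / 2) 1"] conjI allI impI; (elim conjE)?)
    fix d and \<eta> :: "'a \<Rightarrow> real" and x :: 'a assume d: "d \<le> min (s / 2) 1" and m: "mollifier d \<eta>" and x: "norm x < r"
    have c: "continuous_on UNIV \<eta>" "\<And>x. d < norm x \<Longrightarrow> \<eta> x = 0"
      using m by (auto simp: mollifier_def intro: smooth_continuous)
    have "conv g \<eta> x - g x = conv (\<lambda>y. g y - g x) \<eta> x"
      by (simp add: conv_diff[OF loc_int_continuous[OF g] loc_int_continuous m] conv_const[OF m])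
    also have "\<bar>\<dots>\<bar> \<le> conv (\<lambda>y. e) \<eta> x"
      unfolding conv_def real_norm_def[symmetric]
    proof (rule Bochner_Integration.integral_norm_bound_integral)
      show "integrable lborel (\<lambda>y. (g y - g x) * \<eta> (x - y))"
        by (intro conv_integrable[OF _ c] loc_int_continuous continuous_intros g)
      show "integrable lborel (\<lambda>y. e * \<eta> (x - y))"
        by (rule conv_integrable[OF loc_int_continuous[OF continuous_on_const] c])
      fix y
      show "norm ((g y - g x) * \<eta> (x - y)) \<le> e * \<eta> (x - y)"
      proof (cases "norm (x - y) \<le> d")
        case True
        have "norm y \<le> r + 1" using norm_triangle_ineq2[of y x] True d x by (simp add: norm_minus_commute)
        moreover have "dist y x < s" using True d s(1) by (simp add: dist_norm norm_minus_commute)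
        ultimately have "\<bar>g y - g x\<bar> < e" using s(2)[of x y] x by (simp add: dist_norm)
        then show ?thesis using m by (auto simp: mollifier_def abs_mult intro!: mult_right_mono)
      next
        case False
        then show ?thesis using c by simp
      qed
    qed
    also have "\<dots> = e" by (rule conv_const[OF m])
    finally show "\<bar>conv g \<eta> x - g x\<bar> \<le> e" .
  qed (use s in auto)
qed

text \<open>A continuous \<open>g\<close> near \<open>f\<close> is inserted: the contraction
  estimate carries the error \<open>f - g\<close> through the convolution, and uniform continuity
  settles \<open>g\<close> itself. The threshold \<open>s\<close> serves all kernels, so that one
  kernel can later smooth a function together with every component of its gradient.\<close>

lemma mollify_Lp:
  fixes f :: "'a::euclidean_space \<Rightarrow> real"
  assumes p: "p = 1 \<or> p = 2" and f[measurable]: "f \<in> borel_measurable borel"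
    and fin: "\<And>R. (\<integral>\<^sup>+x\<in>ball 0 R. ennreal (\<bar>f x\<bar> ^ p) \<partial>lborel) < \<infinity>" and "e > 0"
  shows "\<exists>s>0. \<forall>d \<eta>. d \<le> s \<and> mollifier d \<eta> \<longrightarrow>
    (\<integral>\<^sup>+x\<in>ball 0 r. ennreal (\<bar>conv f \<eta> x - f x\<bar> ^ p) \<partial>lborel) \<le> ennreal e"
proof -
  let ?L = "\<lambda>R h. (\<integral>\<^sup>+x\<in>ball (0::'a) R. ennreal (\<bar>h x\<bar> ^ p) \<partial>lborel)"
  have li: "loc_int f" by (rule Lp_imp_loc_int[OF p f fin])
  \<comment> \<open>Splitting into three errors uses \<open>power_sum_le\<close> twice and costs at
    most a factor 4, so each error may be e/12.\<close>
  obtain g where g: "continuous_on UNIV g" and fg: "?L (r + 1) (\<lambda>x. f x - g x) < ennreal (e / 12)"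
    using Lp_approx_continuous[OF p f fin, of "e / 12" "r + 1"] \<open>e > 0\<close> by auto
  have [measurable]: "g \<in> borel_measurable borel" by (rule borel_measurable_continuous_onI[OF g])
  have lg: "loc_int g" by (rule loc_int_continuous[OF g])
  define V where "V = measure lborel (ball (0::'a) r)"
  have V: "emeasure lborel (ball (0::'a) r) = ennreal V" "V \<ge> 0"
    using emeasure_bounded_finite[of "ball (0::'a) r"] by (auto simp: V_def emeasure_eq_ennreal_measure)
  \<comment> \<open>The minimum with 1 ensures \<open>e1 ^ p \<le> e1\<close> for both
    exponents.\<close>
  define e1 where "e1 = min 1 (e / (12 * (V + 1)))"
  have e1: "e1 > 0" "e1 ^ p * V \<le> e / 12"
  proof -
    show "e1 > 0" using \<open>e > 0\<close> V(2) by (simp add: e1_def)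
    moreover have "e1 \<le> 1" by (simp add: e1_def)
    ultimately have "e1 ^ p \<le> e1" using p by (auto simp: power2_eq_square mult_left_le)
    then have "e1 ^ p * V \<le> e / (12 * (V + 1)) * V"
      using V(2) by (intro mult_right_mono) (auto simp: e1_def)
    also have "\<dots> \<le> e / 12" using \<open>e > 0\<close> V(2) by (simp add: field_simps)
    finally show "e1 ^ p * V \<le> e / 12" .
  qed
  obtain s where s: "s > 0" "\<And>d \<eta> x. d \<le> s \<Longrightarrow> mollifier d \<eta> \<Longrightarrow> norm x < r \<Longrightarrow> \<bar>conv g \<eta> x - g x\<bar> \<le> e1"
    using conv_continuous_approx[OF g e1(1), of r] by blast
  show ?thesis
  proof (intro exI[of _ "min s 1"] conjI allI impI; (elim conjE)?)
    fix d \<eta> assume d: "d \<le> min s 1" and m: "mollifier d (\<eta> :: 'a \<Rightarrow> real)"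
    have sup: "\<And>x. d < norm x \<Longrightarrow> \<eta> x = 0" and sm: "smooth \<eta>" using m by (auto simp: mollifier_def)
    have [measurable]: "conv f \<eta> \<in> borel_measurable borel" "conv g \<eta> \<in> borel_measurable borel"
      by (intro borel_measurable_continuous_onI smooth_continuous smooth_conv[OF _ sm sup] li lg; assumption)+
    have "?L r (\<lambda>x. conv f \<eta> x - conv g \<eta> x) = ?L r (conv (\<lambda>y. f y - g y) \<eta>)"
      by (simp add: conv_diff[OF li lg m])
    also have "\<dots> \<le> ?L (r + d) (\<lambda>y. f y - g y)"
      by (rule conv_Lp_contraction[OF p _ m]) measurable
    also have "\<dots> \<le> ?L (r + 1) (\<lambda>y. f y - g y)"
      using d by (intro nn_integral_mono mult_left_mono) (auto simp: indicator_def)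
    finally have 1: "?L r (\<lambda>x. conv f \<eta> x - conv g \<eta> x) \<le> ennreal (e / 12)" using fg by simp
    have "?L r (\<lambda>x. conv g \<eta> x - g x) \<le> (\<integral>\<^sup>+x\<in>ball (0::'a) r. ennreal (e1 ^ p) \<partial>lborel)"
      using d s(2)[OF _ m] by (intro nn_integral_mono) (auto simp: indicator_def intro!: ennreal_leI power_mono)
    also have "\<dots> = ennreal (e1 ^ p * V)"
      using e1 V by (subst nn_integral_cmult_indicator) (auto simp: ennreal_mult)
    finally have 2: "?L r (\<lambda>x. conv g \<eta> x - g x) \<le> ennreal (e / 12)"
      using e1(2) by (meson ennreal_leI order_trans)
    have "?L r (\<lambda>x. f x - g x) \<le> ?L (r + 1) (\<lambda>x. f x - g x)"
      by (intro nn_integral_mono mult_left_mono) (auto simp: indicator_def)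
    then have 3: "?L r (\<lambda>x. f x - g x) \<le> ennreal (e / 12)" using fg by simp
    have "?L r (\<lambda>x. conv f \<eta> x - f x) \<le> (\<integral>\<^sup>+x. 4 * (ennreal (\<bar>conv f \<eta> x - conv g \<eta> x\<bar> ^ p) * indicator (ball 0 r) x
      + (ennreal (\<bar>conv g \<eta> x - g x\<bar> ^ p) * indicator (ball 0 r) x + ennreal (\<bar>f x - g x\<bar> ^ p) * indicator (ball 0 r) x)) \<partial>lborel)"
    proof (rule nn_integral_mono)
      fix x
      let ?a = "\<bar>conv f \<eta> x - conv g \<eta> x\<bar>" and ?b = "\<bar>conv g \<eta> x - g x\<bar>" and ?c = "\<bar>f x - g x\<bar>"
      have "\<bar>conv f \<eta> x - f x\<bar> ^ p \<le> (?a + (?b + ?c)) ^ p" by (intro power_mono) auto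
      also have "\<dots> \<le> 2 * (?a ^ p + (?b + ?c) ^ p)" by (rule power_sum_le[OF p]) auto
      also have "\<dots> \<le> 2 * (?a ^ p + 2 * (?b ^ p + ?c ^ p))"
        by (intro mult_left_mono add_left_mono power_sum_le[OF p]) auto
      also have "\<dots> \<le> 4 * (?a ^ p + (?b ^ p + ?c ^ p))" by simp
      finally have "ennreal (\<bar>conv f \<eta> x - f x\<bar> ^ p) \<le> ennreal 4 * (ennreal (?a ^ p) + (ennreal (?b ^ p) + ennreal (?c ^ p)))"
        using ennreal_le_mult_add[of _ 4 "?a ^ p" "?b ^ p + ?c ^ p"] by simp
      then show "ennreal (\<bar>conv f \<eta> x - f x\<bar> ^ p) * indicator (ball 0 r) x \<le> 4 * (ennreal (?a ^ p) * indicator (ball 0 r) x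
        + (ennreal (?b ^ p) * indicator (ball 0 r) x + ennreal (?c ^ p) * indicator (ball 0 r) x))"
        by (simp add: indicator_def)
    qed
    also have "\<dots> = 4 * (?L r (\<lambda>x. conv f \<eta> x - conv g \<eta> x) + (?L r (\<lambda>x. conv g \<eta> x - g x) + ?L r (\<lambda>x. f x - g x)))"
      by (subst nn_integral_cmult, measurable, subst nn_integral_add, measurable, subst nn_integral_add) measurable
    also have "\<dots> \<le> 4 * (ennreal (e / 12) + (ennreal (e / 12) + ennreal (e / 12)))"
      by (intro mult_left_mono add_mono 1 2 3) auto
    also have "\<dots> = ennreal e"
      using \<open>e > 0\<close> by (simp flip: ennreal_plus ennreal_numeral ennreal_mult)
    finally show "?L r (\<lambda>x. conv f \<eta> x - f x) \<le> ennreal e" .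
  qed (use s in auto)
qed

subsection \<open>Weak gradients\<close>

text \<open>Convolving \<open>w\<close> with the constant 1 gives a constant function, whose
  derivative is 0. By \<open>conv_has_derivative\<close> that derivative is also the convolution of
  1 with the derivative of \<open>w\<close>, that is, the integral in question.\<close>

lemma integral_derivative_eq_0:
  fixes w :: "'a::euclidean_space \<Rightarrow> real"
  assumes w: "smooth w" and s: "\<And>x. d < norm x \<Longrightarrow> w x = 0"
  shows "(\<integral>x. frechet_derivative w (at x) v \<partial>lborel) = 0"
proof -
  let ?D = "\<lambda>z. frechet_derivative w (at z) v"
  have [measurable]: "w \<in> borel_measurable borel" "?D \<in> borel_measurable borel"
    by (intro borel_measurable_continuous_onI smooth_continuous smooth_derivative w)+
  have c: "conv (\<lambda>_. 1) w = (\<lambda>x. integral\<^sup>L lborel w)"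
    using integral_reflect_lborel[of w] by (simp add: conv_def fun_eq_iff)
  have "((\<lambda>x. integral\<^sup>L lborel w) has_derivative (\<lambda>v. conv (\<lambda>_. 1) (\<lambda>z. frechet_derivative w (at z) v) 0)) (at 0)"
    using conv_has_derivative[OF loc_int_continuous[OF continuous_on_const, of 1] w s, where x = 0] by (simp add: c)
  then have "(\<lambda>v. conv (\<lambda>_. 1) (\<lambda>z. frechet_derivative w (at z) v) 0) = (\<lambda>v. 0)"
    using has_derivative_unique has_derivative_const by blast
  then have "conv (\<lambda>_. 1) ?D 0 = 0" by metis
  then show ?thesis using integral_reflect_lborel[of ?D 0] by (simp add: conv_def)
qed

definition supported_in :: "('a::euclidean_space \<Rightarrow> real) \<Rightarrow> 'a set \<Rightarrow> real \<Rightarrow> bool" where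
  "supported_in \<phi> K R \<longleftrightarrow> smooth \<phi> \<and> compact K \<and> (\<forall>x. x \<notin> K \<longrightarrow> \<phi> x = 0) \<and>
    (\<forall>x v. x \<notin> K \<longrightarrow> frechet_derivative \<phi> (at x) v = 0) \<and> (\<forall>x. R < norm x \<longrightarrow> x \<notin> K)"

lemma supported_inD:
  assumes "supported_in \<phi> K R"
  shows "smooth \<phi>" "compact K" "x \<notin> K \<Longrightarrow> \<phi> x = 0"
    "x \<notin> K \<Longrightarrow> frechet_derivative \<phi> (at x) v = 0" "R < norm x \<Longrightarrow> x \<notin> K"
  using assms unfolding supported_in_def by blast+

lemma test_functionD:
  fixes \<phi> :: "'a::euclidean_space \<Rightarrow> real"
  assumes "\<phi> \<in> test_functions \<Omega>"
  shows "\<exists>K R. K \<subseteq> \<Omega> \<and> supported_in \<phi> K R"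
proof -
  define K where "K = closure {x. \<phi> x \<noteq> 0}"
  have s: "smooth \<phi>" and K: "compact K" "K \<subseteq> \<Omega>" using assms by (auto simp: test_functions_def K_def)
  have z: "\<phi> x = 0" if "x \<notin> K" for x
    using that closure_subset[of "{x. \<phi> x \<noteq> 0}"] unfolding K_def by blast
  have d: "frechet_derivative \<phi> (at x) v = 0" if "x \<notin> K" for x v
  proof -
    have "(\<phi> has_derivative (\<lambda>v. 0)) (at x)"
    proof (rule has_derivative_transform_within_open[of "\<lambda>x. 0" _ _ _ "- K"])
      show "open (- K)" by (simp add: K_def open_Compl)
    qed (use that z in auto)
    then show ?thesis by (metis frechet_derivative_at)
  qed
  obtain R where R: "\<forall>x\<in>K. norm x \<le> R"
    using compact_imp_bounded[OF K(1)] unfolding bounded_iff by blast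
  then have "x \<notin> K" if "R < norm x" for x using that by (meson not_le)
  then have "supported_in \<phi> K R" unfolding supported_in_def using s K z d by blast
  then show ?thesis using K(2) by blast
qed

text \<open>Evaluating a convolution at \<open>x\<close> means testing against the reflected kernel,
  which is admissible as soon as the closed ball of radius \<open>d\<close> about \<open>x\<close>
  stays in \<open>\<Omega>\<close>. The sign in the second claim comes from the reflection.\<close>

lemma test_function_kernel:
  fixes \<eta> :: "'a::euclidean_space \<Rightarrow> real"
  assumes \<eta>: "smooth \<eta>" "\<And>x. d < norm x \<Longrightarrow> \<eta> x = 0" and "cball x d \<subseteq> \<Omega>"
  shows "(\<lambda>y. \<eta> (x - y)) \<in> test_functions \<Omega>"
    and "frechet_derivative (\<lambda>y. \<eta> (x - y)) (at y) v = - frechet_derivative \<eta> (at (x - y)) v"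
proof -
  have "smooth (\<lambda>y. \<eta> (x - y))"
    by (rule smooth_compose[OF \<eta>(1)], unfold inner_diff_left)
      (intro smooth_minus smooth_const smooth_bounded_linear bounded_linear_inner_left)
  moreover have sub: "closure {y. \<eta> (x - y) \<noteq> 0} \<subseteq> cball x d"
    by (rule closure_minimal) (use \<eta>(2) in \<open>force simp: dist_norm\<close>, simp)
  moreover have "compact (closure {y. \<eta> (x - y) \<noteq> 0})"
    using sub bounded_subset[OF bounded_cball] by (simp add: compact_eq_bounded_closed)
  ultimately show "(\<lambda>y. \<eta> (x - y)) \<in> test_functions \<Omega>"
    using assms(3) by (auto simp: test_functions_def)
  interpret linear "frechet_derivative \<eta> (at (x - y))"
    by (rule has_derivative_linear[OF smooth_has_derivative[OF \<eta>(1)]])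
  have "((\<lambda>y. \<eta> (x - y)) has_derivative (\<lambda>v. frechet_derivative \<eta> (at (x - y)) (- v))) (at y)"
    by (rule has_derivative_compose[OF _ smooth_has_derivative[OF \<eta>(1)]])
      (auto intro!: derivative_eq_intros)
  then show "frechet_derivative (\<lambda>y. \<eta> (x - y)) (at y) v = - frechet_derivative \<eta> (at (x - y)) v"
    using frechet_derivative_at[of "\<lambda>y. \<eta> (x - y)"] neg by metis
qed

lemma integrable_mult_compact:
  fixes f g :: "'a::euclidean_space \<Rightarrow> real"
  assumes f: "locally_integrable \<Omega> f" and g: "continuous_on UNIV g"
    and K: "compact K" "K \<subseteq> \<Omega>" "\<And>x. x \<notin> K \<Longrightarrow> g x = 0"
  shows "integrable lebesgue (\<lambda>x. f x * g x)"
proof -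
  have fK: "integrable lebesgue (\<lambda>x. indicator K x * f x)"
    using f K by (simp add: locally_integrable_def set_integrable_def)
  have "compact (g ` K)" by (rule compact_continuous_image) (use g K in \<open>auto intro: continuous_on_subset\<close>)
  then have "bounded (g ` K)" by (rule compact_imp_bounded)
  then obtain B where "\<forall>y\<in>g ` K. norm y \<le> B" unfolding bounded_iff by blast
  then have B: "\<bar>g x\<bar> \<le> B" if "x \<in> K" for x using that by simp
  have eq: "(\<lambda>x. f x * g x) = (\<lambda>x. (indicator K x * f x) * g x)"
  proof
    show "f x * g x = (indicator K x * f x) * g x" for x
      using K(3)[of x] by (cases "x \<in> K") auto
  qed
  have [measurable]: "g \<in> borel_measurable lebesgue" 
    by (intro measurable_completion) (simp add: borel_measurable_continuous_onI[OF g])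
  have [measurable]: "(\<lambda>x. indicator K x * f x) \<in> borel_measurable lebesgue" using fK by blast
  show ?thesis unfolding eq
  proof (rule Bochner_Integration.integrable_bound)
    show "integrable lebesgue (\<lambda>x. B * (indicator K x * f x))" using fK by simp
    show "AE x in lebesgue. norm ((indicator K x * f x) * g x) \<le> norm (B * (indicator K x * f x))"
    proof (intro AE_I2)
      fix x
      show "norm ((indicator K x * f x) * g x) \<le> norm (B * (indicator K x * f x))"
        using B[of x] mult_right_mono[of "\<bar>g x\<bar>" "\<bar>B\<bar>" "\<bar>f x\<bar>"]
        by (cases "x \<in> K") (auto simp: abs_mult mult.commute)
    qed
  qed measurable
qed

lemma set_integral_compact:
  fixes h :: "'a::euclidean_space \<Rightarrow> real"
  assumes "K \<subseteq> \<Omega>" "\<And>x. x \<notin> K \<Longrightarrow> h x = 0"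
  shows "(LINT x:\<Omega>|lebesgue. h x) = (\<integral>x. h x \<partial>lebesgue)"
  unfolding set_lebesgue_integral_def
proof (rule Bochner_Integration.integral_cong[OF refl])
  show "indicator \<Omega> x *\<^sub>R h x = h x" for x
    using assms(1) assms(2)[of x] by (cases "x \<in> K") auto
qed

text \<open>It suffices that the bad set is null near each of its points. There \<open>f\<close> is
  cut off to an integrable Borel function. Its mollification at a small radius tests
  \<open>f\<close> itself and so vanishes, while by \<open>mollify_Lp\<close> it is close to the
  cut-off in L^1.\<close>

lemma fundamental_lemma:
  fixes f :: "'a::euclidean_space \<Rightarrow> real"
  assumes "open \<Omega>" and f: "locally_integrable \<Omega> f"
    and z: "\<And>\<phi>. \<phi> \<in> test_functions \<Omega> \<Longrightarrow> (\<integral>x. f x * \<phi> x \<partial>lebesgue) = 0"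
  shows "AE x in lebesgue. x \<in> \<Omega> \<longrightarrow> f x = 0"
proof -
  define N where "N = {x \<in> \<Omega>. f x \<noteq> 0}"
  have "\<exists>U. openin (top_of_set N) U \<and> x \<in> U \<and> negligible U" if "x \<in> N" for x
  proof -
    obtain \<rho>' where \<rho>': "\<rho>' > 0" "cball x \<rho>' \<subseteq> \<Omega>"
      using \<open>open \<Omega>\<close> \<open>x \<in> N\<close> by (auto simp: N_def open_contains_cball)
    \<comment> \<open>Halving leaves room: kernels of radius at most \<open>\<rho>\<close> centred
      in \<open>ball x \<rho>\<close> stay in \<open>cball x (2 * \<rho>)\<close>, where the cut-off
      agrees with \<open>f\<close>.\<close>
    define \<rho> where "\<rho> = \<rho>' / 2"
    have \<rho>: "\<rho> > 0" "cball x (2 * \<rho>) \<subseteq> \<Omega>" using \<rho>' by (auto simp: \<rho>_def)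
    let ?K = "cball x (2 * \<rho>)"
    have fK: "integrable lebesgue (\<lambda>y. indicator ?K y * f y)"
      using f \<rho> by (simp add: locally_integrable_def set_integrable_def)
    then have "(\<lambda>y. indicator ?K y * f y) \<in> borel_measurable lebesgue" by blast
    from completion_ex_borel_measurable_real[OF this]
    obtain f' where f'm[measurable]: "f' \<in> borel_measurable lborel"
      and f'eq: "AE y in lborel. indicator ?K y * f y = f' y" by blast
    have f'eq': "AE y in lebesgue. indicator ?K y * f y = f' y" using f'eq by (rule AE_completion)
    have "f' \<in> borel_measurable lebesgue" using f'm by (rule measurable_completion)
    then have "integrable lebesgue f'"
      using f'eq' by (intro integrable_cong_AE_imp[OF fK])
    then have f'i: "integrable lborel f'" using integrable_completion[of f' lborel] f'm by blast
    have fin: "(\<integral>\<^sup>+y\<in>ball 0 R. ennreal (\<bar>f' y\<bar> ^ 1) \<partial>lborel) < \<infinity>" for R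
    proof -
      have "(\<integral>\<^sup>+y\<in>ball 0 R. ennreal (\<bar>f' y\<bar> ^ 1) \<partial>lborel) \<le> (\<integral>\<^sup>+y. ennreal (norm (f' y)) \<partial>lborel)"
        by (intro nn_integral_mono) (simp add: indicator_def)
      also have "\<dots> < \<infinity>" using f'i by (simp add: integrable_iff_bounded)
      finally show ?thesis .
    qed
    define R where "R = norm x + \<rho>"
    have "(\<integral>\<^sup>+y\<in>ball x \<rho>. ennreal \<bar>f' y\<bar> \<partial>lborel) \<le> ennreal e" if "e > 0" for e
    proof -
      obtain s where s: "s > 0" "\<And>d \<eta>. d \<le> s \<Longrightarrow> mollifier d \<eta> \<Longrightarrow>
          (\<integral>\<^sup>+y\<in>ball 0 R. ennreal (\<bar>conv f' \<eta> y - f' y\<bar> ^ 1) \<partial>lborel) \<le> ennreal e"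
        using mollify_Lp[of 1 f' e R] fin \<open>e > 0\<close> f'm by auto
      define d where "d = min s \<rho>"
      have d: "d > 0" "d \<le> s" "d \<le> \<rho>" using s \<rho> by (auto simp: d_def)
      obtain \<eta> :: "'a \<Rightarrow> real" where m: "mollifier d \<eta>" using mollifier_exists[OF d(1)] by blast
      have sm: "smooth \<eta>" and sup: "\<And>x. d < norm x \<Longrightarrow> \<eta> x = 0" using m by (auto simp: mollifier_def)
      have [measurable]: "\<eta> \<in> borel_measurable borel"
        by (intro borel_measurable_continuous_onI smooth_continuous sm)
      have c0: "conv f' \<eta> y = 0" if "y \<in> ball x \<rho>" for y
      proof -
        have sub: "cball y d \<subseteq> ?K"
        proof
          fix z assume "z \<in> cball y d"
          then show "z \<in> ?K" using that d(3) dist_triangle[of x z y] by auto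
        qed
        have "conv f' \<eta> y = (\<integral>z. f' z * \<eta> (y - z) \<partial>lebesgue)"
          unfolding conv_def by (rule integral_completion[symmetric]) measurable
        also have "\<dots> = (\<integral>z. f z * \<eta> (y - z) \<partial>lebesgue)"
        proof (rule Bochner_Integration.integral_cong_AE)
          have [measurable]: "(\<lambda>z. \<eta> (y - z)) \<in> borel_measurable lebesgue"
            by (intro measurable_completion) measurable
          have [measurable]: "f' \<in> borel_measurable lebesgue" by fact
          show "(\<lambda>z. f' z * \<eta> (y - z)) \<in> borel_measurable lebesgue" by measurable
          show "(\<lambda>z. f z * \<eta> (y - z)) \<in> borel_measurable lebesgue"
          proof (rule borel_measurable_integrable, rule integrable_mult_compact[OF f])
            show "continuous_on UNIV (\<lambda>z. \<eta> (y - z))"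
              by (rule continuous_on_compose2[OF smooth_continuous[OF sm, of UNIV]])
                (auto intro: continuous_intros)
            show "\<eta> (y - z) = 0" if "z \<notin> ?K" for z
            proof -
              have "z \<notin> cball y d" using that sub by blast
              then show ?thesis using sup by (simp add: dist_norm)
            qed
          qed (use \<rho> in auto)
          show "AE z in lebesgue. f' z * \<eta> (y - z) = f z * \<eta> (y - z)"
            using f'eq'
          proof eventually_elim
            case (elim z)
            show ?case
            proof (cases "z \<in> ?K")
              case True
              then show ?thesis using elim by simp
            next
              case False
              then have "z \<notin> cball y d" using sub by blast
              then have "\<eta> (y - z) = 0" using sup by (simp add: dist_norm)
              then show ?thesis by simp
            qed
          qed
        qed
        also have "\<dots> = 0"
          using sub \<rho>(2) by (intro z test_function_kernel(1)[OF sm sup]) auto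
        finally show ?thesis .
      qed
      have "(\<integral>\<^sup>+y\<in>ball x \<rho>. ennreal \<bar>f' y\<bar> \<partial>lborel)
          \<le> (\<integral>\<^sup>+y\<in>ball 0 R. ennreal (\<bar>conv f' \<eta> y - f' y\<bar> ^ 1) \<partial>lborel)"
      proof (rule nn_integral_mono)
        fix y
        have "y \<in> ball 0 R" if "y \<in> ball x \<rho>"
          using that norm_triangle_ineq2[of y x] by (simp add: R_def dist_norm norm_minus_commute)
        then show "ennreal \<bar>f' y\<bar> * indicator (ball x \<rho>) y
            \<le> ennreal (\<bar>conv f' \<eta> y - f' y\<bar> ^ 1) * indicator (ball 0 R) y"
          using c0[of y] by (cases "y \<in> ball x \<rho>") auto
      qed
      also have "\<dots> \<le> ennreal e" by (rule s(2)[OF d(2) m])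
      finally show ?thesis .
    qed
    note eps = this
    have "(\<integral>\<^sup>+y\<in>ball x \<rho>. ennreal \<bar>f' y\<bar> \<partial>lborel) \<le> 0"
    proof (rule ennreal_le_epsilon)
      fix e :: real assume "e > 0"
      from eps[OF this] show "(\<integral>\<^sup>+y\<in>ball x \<rho>. ennreal \<bar>f' y\<bar> \<partial>lborel) \<le> 0 + ennreal e" by simp
    qed
    then have "(\<integral>\<^sup>+y\<in>ball x \<rho>. ennreal \<bar>f' y\<bar> \<partial>lborel) = 0" by simp
    then have "AE y in lborel. ennreal \<bar>f' y\<bar> * indicator (ball x \<rho>) y = 0"
      by (subst (asm) nn_integral_0_iff_AE) measurable
    then have "AE y in lborel. y \<notin> N \<inter> ball x \<rho>"
      using f'eq
    proof eventually_elim
      case (elim y)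
      have "indicator ?K y = (1::real)" if "y \<in> ball x \<rho>" using that \<rho> by auto
      then show ?case using elim by (auto simp: N_def)
    qed
    then have "AE y in lebesgue. y \<notin> N \<inter> ball x \<rho>" by (rule AE_completion)
    then have "{y \<in> space lebesgue. \<not> y \<notin> N \<inter> ball x \<rho>} \<in> null_sets lebesgue"
      by (rule completion.AE_iff_null_sets[THEN iffD1])
    moreover have "{y \<in> space lebesgue. \<not> y \<notin> N \<inter> ball x \<rho>} = N \<inter> ball x \<rho>" by auto
    ultimately have "negligible (N \<inter> ball x \<rho>)" by (simp add: negligible_iff_null_sets)
    then show ?thesis using \<open>x \<in> N\<close> \<rho>(1) by (intro exI[of _ "N \<inter> ball x \<rho>"]) (auto intro: openin_open_Int)
  qed
  then have "negligible N" using locally_negligible_alt[of N] by blast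
  then have "AE x in lebesgue. x \<notin> N" by (simp add: AE_not_in negligible_iff_null_sets)
  then show ?thesis by eventually_elim (auto simp: N_def)
qed

section \<open>Calculus of weak gradients\<close>

definition gradc :: "('a::euclidean_space \<Rightarrow> real) \<Rightarrow> 'a \<Rightarrow> 'a" where
  "gradc \<phi> x = (\<Sum>b\<in>Basis. frechet_derivative \<phi> (at x) b *\<^sub>R b)"

lemma gradc_inner: "b \<in> Basis \<Longrightarrow> gradc \<phi> x \<bullet> b = frechet_derivative \<phi> (at x) b"
  by (simp add: gradc_def inner_sum_left_Basis)

lemma gradc_continuous: "smooth \<phi> \<Longrightarrow> continuous_on UNIV (gradc \<phi>)"
  unfolding gradc_def
  by (intro continuous_intros smooth_continuous smooth_derivative)

lemma locally_integrable_continuous: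
  fixes f :: "'a::euclidean_space \<Rightarrow> 'b::euclidean_space"
  assumes "continuous_on UNIV f" shows "locally_integrable \<Omega> f"
  unfolding locally_integrable_def set_integrable_def
proof (intro allI impI)
  fix K :: "'a set" assume "compact K \<and> K \<subseteq> \<Omega>"
  then have "integrable lborel (\<lambda>x. indicator K x *\<^sub>R f x)"
    by (intro borel_integrable_compact) (use assms in \<open>auto intro: continuous_on_subset\<close>)
  then show "integrable lebesgue (\<lambda>x. indicator K x *\<^sub>R f x)"
    using integrable_completion borel_measurable_integrable by blast
qed

lemma locally_integrable_inner:
  assumes "locally_integrable \<Omega> G" shows "locally_integrable \<Omega> (\<lambda>x. G x \<bullet> b)"
  unfolding locally_integrable_def set_integrable_def
proof (intro allI impI)
  fix K assume "compact K \<and> K \<subseteq> \<Omega>"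
  then have "integrable lebesgue (\<lambda>x. (indicator K x *\<^sub>R G x) \<bullet> b)"
    using assms by (intro integrable_inner_left) (auto simp: locally_integrable_def set_integrable_def)
  then show "integrable lebesgue (\<lambda>x. indicator K x *\<^sub>R (G x \<bullet> b))" by simp
qed

lemma locally_integrable_diff:
  assumes "locally_integrable \<Omega> f" "locally_integrable \<Omega> g"
  shows "locally_integrable \<Omega> (\<lambda>x. f x - g x)"
  using assms by (auto simp: locally_integrable_def intro: set_integral_diff)

lemma locally_integrable_subset: "locally_integrable \<Omega> f \<Longrightarrow> \<Omega>' \<subseteq> \<Omega> \<Longrightarrow> locally_integrable \<Omega>' f"
  by (auto simp: locally_integrable_def)

lemma locally_integrable_cong_AE:
  fixes f g :: "'a::euclidean_space \<Rightarrow> 'b::euclidean_space"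
  assumes f: "locally_integrable \<Omega> f" and "AE x in lebesgue. x \<in> \<Omega> \<longrightarrow> f x = g x" "g \<in> borel_measurable borel"
  shows "locally_integrable \<Omega> g"
  unfolding locally_integrable_def set_integrable_def
proof (intro allI impI)
  fix K assume K: "compact K \<and> K \<subseteq> \<Omega>"
  have [measurable]: "g \<in> borel_measurable lebesgue" "K \<in> sets lebesgue"
    using assms(3) K by (auto intro: measurable_completion simp: borel_compact)
  show "integrable lebesgue (\<lambda>x. indicator K x *\<^sub>R g x)"
  proof (rule integrable_cong_AE_imp)
    show "integrable lebesgue (\<lambda>x. indicator K x *\<^sub>R f x)"
      using f K by (simp add: locally_integrable_def set_integrable_def)
    show "AE x in lebesgue. indicator K x *\<^sub>R f x = indicator K x *\<^sub>R g x"
      using assms(2) by eventually_elim (use K in \<open>auto simp: indicator_def\<close>)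
  qed measurable
qed

text \<open>A test function vanishes off a compact subset of \<open>\<Omega>\<close>, so the set
  integrals in the definition become integrals over the whole space.
  \<open>is_weak_gradientI\<close> is the way back.\<close>

lemma is_weak_gradientD:
  fixes u :: "'a::euclidean_space \<Rightarrow> real"
  assumes "is_weak_gradient \<Omega> u G" "\<phi> \<in> test_functions \<Omega>" "b \<in> Basis"
  shows "(\<integral>x. u x * frechet_derivative \<phi> (at x) b \<partial>lebesgue) = - (\<integral>x. (G x \<bullet> b) * \<phi> x \<partial>lebesgue)"
proof -
  obtain K R where KO: "K \<subseteq> \<Omega>" and K: "supported_in \<phi> K R"
    using test_functionD[OF assms(2)] by blast
  have "(LINT x:\<Omega>|lebesgue. u x * frechet_derivative \<phi> (at x) b) = - (LINT x:\<Omega>|lebesgue. (G x \<bullet> b) * \<phi> x)"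
    using assms by (simp add: is_weak_gradient_def)
  then show ?thesis using supported_inD(3,4)[OF K] by (simp add: set_integral_compact[OF KO])
qed

lemma is_weak_gradientI:
  fixes u :: "'a::euclidean_space \<Rightarrow> real"
  assumes "locally_integrable \<Omega> u" "locally_integrable \<Omega> G"
    and e: "\<And>\<phi> b. \<phi> \<in> test_functions \<Omega> \<Longrightarrow> b \<in> Basis \<Longrightarrow>
      (\<integral>x. u x * frechet_derivative \<phi> (at x) b \<partial>lebesgue) = - (\<integral>x. (G x \<bullet> b) * \<phi> x \<partial>lebesgue)"
  shows "is_weak_gradient \<Omega> u G"
  unfolding is_weak_gradient_def
proof (intro conjI ballI assms(1,2))
  fix \<phi> and b :: 'a assume t: "\<phi> \<in> test_functions \<Omega>" and b: "b \<in> Basis"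
  obtain K R where KO: "K \<subseteq> \<Omega>" and K: "supported_in \<phi> K R"
    using test_functionD[OF t] by blast
  show "(LINT x:\<Omega>|lebesgue. u x * frechet_derivative \<phi> (at x) b) = - (LINT x:\<Omega>|lebesgue. (G x \<bullet> b) * \<phi> x)"
    using e[OF t b] supported_inD(3,4)[OF K] by (simp add: set_integral_compact[OF KO])
qed

lemma test_integrable:
  fixes f :: "'a::euclidean_space \<Rightarrow> real"
  assumes "locally_integrable \<Omega> f" "\<phi> \<in> test_functions \<Omega>"
  shows "integrable lebesgue (\<lambda>x. f x * \<phi> x)" "integrable lebesgue (\<lambda>x. f x * frechet_derivative \<phi> (at x) b)"
proof -
  obtain K R where KO: "K \<subseteq> \<Omega>" and K: "supported_in \<phi> K R"
    using test_functionD[OF assms(2)] by blast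
  show "integrable lebesgue (\<lambda>x. f x * \<phi> x)"
    by (rule integrable_mult_compact[OF assms(1) smooth_continuous[OF supported_inD(1)[OF K]] supported_inD(2)[OF K] KO supported_inD(3)[OF K]])
  show "integrable lebesgue (\<lambda>x. f x * frechet_derivative \<phi> (at x) b)"
    by (rule integrable_mult_compact[OF assms(1) smooth_continuous[OF smooth_derivative[OF supported_inD(1)[OF K]]] supported_inD(2)[OF K] KO supported_inD(4)[OF K]])
qed

lemma is_weak_gradient_unique:
  fixes u :: "'a::euclidean_space \<Rightarrow> real"
  assumes "open \<Omega>" and G: "is_weak_gradient \<Omega> u G" and H: "is_weak_gradient \<Omega> u H"
  shows "AE x in lebesgue. x \<in> \<Omega> \<longrightarrow> G x = H x"
proof -
  have li: "locally_integrable \<Omega> (\<lambda>x. G x \<bullet> b)" "locally_integrable \<Omega> (\<lambda>x. H x \<bullet> b)" for b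
    using G H by (auto simp: is_weak_gradient_def intro: locally_integrable_inner)
  have "AE x in lebesgue. x \<in> \<Omega> \<longrightarrow> G x \<bullet> b - H x \<bullet> b = 0" if b: "b \<in> Basis" for b
  proof (rule fundamental_lemma[OF \<open>open \<Omega>\<close> locally_integrable_diff[OF li]])
    fix \<phi> assume t: "\<phi> \<in> test_functions \<Omega>"
    show "(\<integral>x. (G x \<bullet> b - H x \<bullet> b) * \<phi> x \<partial>lebesgue) = 0"
      using is_weak_gradientD[OF G t b] is_weak_gradientD[OF H t b]
      by (simp add: left_diff_distrib Bochner_Integration.integral_diff test_integrable(1)[OF li(1) t] test_integrable(1)[OF li(2) t])
  qed
  then have "AE x in lebesgue. \<forall>b\<in>Basis. x \<in> \<Omega> \<longrightarrow> G x \<bullet> b - H x \<bullet> b = 0"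
    by (intro AE_finite_allI) auto
  then show ?thesis by eventually_elim (auto intro: euclidean_eqI)
qed

text \<open>Integration by parts is the vanishing of the integral of a derivative of the compactly
  supported product of \<open>\<psi>\<close> and the test function.\<close>

lemma is_weak_gradient_smooth:
  fixes \<psi> :: "'a::euclidean_space \<Rightarrow> real"
  assumes \<psi>: "smooth \<psi>"
  shows "is_weak_gradient \<Omega> \<psi> (gradc \<psi>)"
proof (rule is_weak_gradientI)
  show li: "locally_integrable \<Omega> \<psi>" "locally_integrable \<Omega> (gradc \<psi>)"
    by (intro locally_integrable_continuous smooth_continuous gradc_continuous \<psi>)+
  fix \<phi> and b :: 'a assume t: "\<phi> \<in> test_functions \<Omega>" and b: "b \<in> Basis"
  obtain K R where KO: "K \<subseteq> \<Omega>" and K: "supported_in \<phi> K R"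
    using test_functionD[OF t] by blast
  note K1 = supported_inD(1)[OF K]
  have D: "frechet_derivative (\<lambda>x. \<psi> x * \<phi> x) (at x) b
      = \<psi> x * frechet_derivative \<phi> (at x) b + frechet_derivative \<psi> (at x) b * \<phi> x" for x
    by (subst frechet_derivative_at[OF has_derivative_mult[OF smooth_has_derivative[OF \<psi>]
        smooth_has_derivative[OF K1]], symmetric]) simp
  have "(\<integral>x. frechet_derivative (\<lambda>x. \<psi> x * \<phi> x) (at x) b \<partial>lborel) = 0"
    by (rule integral_derivative_eq_0[OF smooth_mult[OF \<psi> K1]]) (use supported_inD(3,5)[OF K] in auto)
  moreover have "(\<integral>x. frechet_derivative (\<lambda>x. \<psi> x * \<phi> x) (at x) b \<partial>lebesgue)
      = (\<integral>x. frechet_derivative (\<lambda>x. \<psi> x * \<phi> x) (at x) b \<partial>lborel)"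
    by (rule integral_completion)
      (simp add: borel_measurable_continuous_onI smooth_continuous smooth_derivative smooth_mult \<psi> K1)
  ultimately have "(\<integral>x. \<psi> x * frechet_derivative \<phi> (at x) b + frechet_derivative \<psi> (at x) b * \<phi> x \<partial>lebesgue) = 0"
    by (simp add: D)
  then have "(\<integral>x. \<psi> x * frechet_derivative \<phi> (at x) b \<partial>lebesgue) + (\<integral>x. frechet_derivative \<psi> (at x) b * \<phi> x \<partial>lebesgue) = 0"
    using test_integrable(1)[OF locally_integrable_inner[OF li(2), of b] t]
    by (simp add: Bochner_Integration.integral_add test_integrable(2)[OF li(1) t] gradc_inner[OF b])
  then show "(\<integral>x. \<psi> x * frechet_derivative \<phi> (at x) b \<partial>lebesgue) = - (\<integral>x. (gradc \<psi> x \<bullet> b) * \<phi> x \<partial>lebesgue)"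
    by (simp add: gradc_inner[OF b])
qed

lemma is_weak_gradient_diff:
  fixes u v :: "'a::euclidean_space \<Rightarrow> real"
  assumes u: "is_weak_gradient \<Omega> u G" and v: "is_weak_gradient \<Omega> v H"
  shows "is_weak_gradient \<Omega> (\<lambda>x. u x - v x) (\<lambda>x. G x - H x)"
proof (rule is_weak_gradientI)
  have li: "locally_integrable \<Omega> u" "locally_integrable \<Omega> G" "locally_integrable \<Omega> v" "locally_integrable \<Omega> H"
    using u v by (auto simp: is_weak_gradient_def)
  show "locally_integrable \<Omega> (\<lambda>x. u x - v x)" "locally_integrable \<Omega> (\<lambda>x. G x - H x)"
    by (intro locally_integrable_diff li)+
  fix \<phi> and b :: 'a assume t: "\<phi> \<in> test_functions \<Omega>" and b: "b \<in> Basis"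
  show "(\<integral>x. (u x - v x) * frechet_derivative \<phi> (at x) b \<partial>lebesgue) = - (\<integral>x. ((G x - H x) \<bullet> b) * \<phi> x \<partial>lebesgue)"
    using is_weak_gradientD[OF u t b] is_weak_gradientD[OF v t b]
    by (simp add: left_diff_distrib inner_diff_left Bochner_Integration.integral_diff test_integrable[OF li(1) t]
        test_integrable[OF li(3) t] test_integrable(1)[OF locally_integrable_inner[OF li(2)] t]
        test_integrable(1)[OF locally_integrable_inner[OF li(4)] t])
qed

lemma test_functions_mono: "\<Omega>' \<subseteq> \<Omega> \<Longrightarrow> test_functions \<Omega>' \<subseteq> test_functions \<Omega>"
  by (auto simp: test_functions_def)

lemma is_weak_gradient_subset:
  fixes u :: "'a::euclidean_space \<Rightarrow> real"
  assumes u: "is_weak_gradient \<Omega> u G" and s: "\<Omega>' \<subseteq> \<Omega>"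
  shows "is_weak_gradient \<Omega>' u G"
  using u s is_weak_gradientD[OF u] test_functions_mono[OF s]
  by (intro is_weak_gradientI) (auto simp: is_weak_gradient_def intro: locally_integrable_subset)

lemma is_weak_gradient_cong_AE:
  fixes u v :: "'a::euclidean_space \<Rightarrow> real"
  assumes u: "is_weak_gradient \<Omega> u G"
    and v: "AE x in lebesgue. x \<in> \<Omega> \<longrightarrow> u x = v x" and liv: "locally_integrable \<Omega> v"
    and H: "AE x in lebesgue. x \<in> \<Omega> \<longrightarrow> G x = H x" and liH: "locally_integrable \<Omega> H"
  shows "is_weak_gradient \<Omega> v H"
proof (rule is_weak_gradientI[OF liv liH])
  have li: "locally_integrable \<Omega> u" "locally_integrable \<Omega> G"
    using u by (auto simp: is_weak_gradient_def)
  fix \<phi> and b :: 'a assume t: "\<phi> \<in> test_functions \<Omega>" and b: "b \<in> Basis"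
  obtain K R where KO: "K \<subseteq> \<Omega>" and K: "supported_in \<phi> K R"
    using test_functionD[OF t] by blast
  have "(\<integral>x. u x * frechet_derivative \<phi> (at x) b \<partial>lebesgue) = (\<integral>x. v x * frechet_derivative \<phi> (at x) b \<partial>lebesgue)"
  proof (rule Bochner_Integration.integral_cong_AE)
    show "AE x in lebesgue. u x * frechet_derivative \<phi> (at x) b = v x * frechet_derivative \<phi> (at x) b"
      using v
    proof eventually_elim
      case (elim x)
      then show ?case using KO supported_inD(4)[OF K, of x] by (cases "x \<in> K") auto
    qed
  qed (intro borel_measurable_integrable test_integrable(2)[OF _ t] li liv)+
  moreover have "(\<integral>x. (G x \<bullet> b) * \<phi> x \<partial>lebesgue) = (\<integral>x. (H x \<bullet> b) * \<phi> x \<partial>lebesgue)"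
  proof (rule Bochner_Integration.integral_cong_AE)
    show "AE x in lebesgue. (G x \<bullet> b) * \<phi> x = (H x \<bullet> b) * \<phi> x"
      using H
    proof eventually_elim
      case (elim x)
      then show ?case using KO supported_inD(3)[OF K, of x] by (cases "x \<in> K") auto
    qed
  qed (intro borel_measurable_integrable test_integrable(1)[OF _ t] locally_integrable_inner li liH)+
  ultimately show "(\<integral>x. v x * frechet_derivative \<phi> (at x) b \<partial>lebesgue) = - (\<integral>x. (H x \<bullet> b) * \<phi> x \<partial>lebesgue)"
    using is_weak_gradientD[OF u t b] by simp
qed

text \<open>Cauchy-Schwarz against the fixed function \<open>g\<close>, whose square has a finite
  integral.\<close>

lemma L2_pairing_tendsto:
  fixes f :: "'a::euclidean_space \<Rightarrow> real"
  assumes fk: "\<And>k. locally_integrable \<Omega> (F k)" and f: "locally_integrable \<Omega> f"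
    and l: "(\<lambda>k. L2_normsq \<Omega> (\<lambda>x. F k x - f x)) \<longlonglongrightarrow> 0"
    and g: "continuous_on UNIV g" and K: "compact K" "K \<subseteq> \<Omega>" "\<And>x. x \<notin> K \<Longrightarrow> g x = 0"
  shows "(\<lambda>k. \<integral>x. F k x * g x \<partial>lebesgue) \<longlonglongrightarrow> (\<integral>x. f x * g x \<partial>lebesgue)"
proof -
  define C where "C = (\<integral>\<^sup>+x. (ennreal \<bar>g x\<bar>)\<^sup>2 \<partial>lebesgue)"
  have "integrable lebesgue (\<lambda>x. g x * g x)"
    by (rule integrable_mult_compact[OF locally_integrable_continuous[OF g] g K])
  moreover have "(ennreal \<bar>g x\<bar>)\<^sup>2 = ennreal (norm (g x * g x))" for x
    by (subst ennreal_power) (simp_all add: power2_eq_square)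
  ultimately have C: "C < \<infinity>" unfolding C_def integrable_iff_bounded by simp
  have gm[measurable]: "g \<in> borel_measurable lebesgue"
    by (intro measurable_completion) (simp add: borel_measurable_continuous_onI[OF g])
  have Km[measurable]: "K \<in> sets lebesgue" using K(1) by (simp add: borel_compact)
  define d where "d k = (\<integral>x. F k x * g x \<partial>lebesgue) - (\<integral>x. f x * g x \<partial>lebesgue)" for k
  have "ennreal (\<bar>d k\<bar>\<^sup>2) \<le> L2_normsq \<Omega> (\<lambda>x. F k x - f x) * C" for k
  proof -
    have li: "locally_integrable \<Omega> (\<lambda>x. F k x - f x)" by (rule locally_integrable_diff[OF fk f])
    then have [measurable]: "(\<lambda>x. indicator K x *\<^sub>R (F k x - f x)) \<in> borel_measurable lebesgue"
      using K by (auto simp: locally_integrable_def set_integrable_def)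
    have i: "integrable lebesgue (\<lambda>x. (F k x - f x) * g x)" by (rule integrable_mult_compact[OF li g K])
    have "d k = (\<integral>x. (F k x - f x) * g x \<partial>lebesgue)"
      unfolding d_def left_diff_distrib
      using Bochner_Integration.integral_diff[OF integrable_mult_compact[OF fk g K, of k] integrable_mult_compact[OF f g K]]
      by simp
    then have "ennreal \<bar>d k\<bar> \<le> (\<integral>\<^sup>+x. ennreal \<bar>(F k x - f x) * g x\<bar> \<partial>lebesgue)"
      using integral_norm_bound_ennreal[OF i] by simp
    \<comment> \<open>Measurability of \<open>F k - f\<close> is available on compact sets, so the
      difference is cut off to \<open>K\<close>; nothing changes because \<open>g\<close> vanishes
      elsewhere.\<close>
    also have "\<dots> = (\<integral>\<^sup>+x. ennreal \<bar>indicator K x *\<^sub>R (F k x - f x)\<bar> * ennreal \<bar>g x\<bar> \<partial>lebesgue)"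
    proof (rule nn_integral_cong)
      show "ennreal \<bar>(F k x - f x) * g x\<bar> = ennreal \<bar>indicator K x *\<^sub>R (F k x - f x)\<bar> * ennreal \<bar>g x\<bar>" for x
        using K(3)[of x] by (cases "x \<in> K") (auto simp: abs_mult ennreal_mult)
    qed
    finally have "ennreal (\<bar>d k\<bar>\<^sup>2) \<le> (\<integral>\<^sup>+x. ennreal \<bar>indicator K x *\<^sub>R (F k x - f x)\<bar> * ennreal \<bar>g x\<bar> \<partial>lebesgue)\<^sup>2"
      by (subst ennreal_power[symmetric]) (auto intro: power_mono)
    also have "\<dots> \<le> (\<integral>\<^sup>+x. (ennreal \<bar>indicator K x *\<^sub>R (F k x - f x)\<bar>)\<^sup>2 \<partial>lebesgue) * C"
      unfolding C_def by (rule Cauchy_Schwarz_nn_integral) measurable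
    also have "\<dots> \<le> L2_normsq \<Omega> (\<lambda>x. F k x - f x) * C"
      unfolding L2_normsq_def
      by (intro mult_right_mono nn_integral_mono) (use K(2) in \<open>auto simp: indicator_def ennreal_power\<close>)
    finally show ?thesis .
  qed
  moreover have "(\<lambda>k. L2_normsq \<Omega> (\<lambda>x. F k x - f x) * C) \<longlonglongrightarrow> 0"
    using ennreal_tendsto_cmult[OF _ l, of C] C by (simp add: mult.commute)
  ultimately have "(\<lambda>k. ennreal (\<bar>d k\<bar>\<^sup>2)) \<longlonglongrightarrow> 0"
    by (intro tendsto_sandwich[OF _ _ tendsto_const, of 0 "\<lambda>k. ennreal (\<bar>d k\<bar>\<^sup>2)" _ "\<lambda>k. L2_normsq \<Omega> (\<lambda>x. F k x - f x) * C"]) auto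
  then have "(\<lambda>k. \<bar>d k\<bar>\<^sup>2) \<longlonglongrightarrow> 0" by (subst (asm) tendsto_ennreal_iff[of _ _ 0, simplified]) auto
  then have "(\<lambda>k. sqrt (\<bar>d k\<bar>\<^sup>2)) \<longlonglongrightarrow> sqrt 0" by (rule tendsto_real_sqrt)
  then have "d \<longlonglongrightarrow> 0" by (simp add: tendsto_rabs_zero_iff)
  then show ?thesis unfolding d_def by (rule LIM_zero_cancel)
qed

section \<open>Square integrals over a set\<close>

lemma L2_normsq_restrict:
  assumes "\<Omega> \<in> sets lebesgue"
  shows "L2_normsq \<Omega> f = (\<integral>\<^sup>+x. ennreal ((norm (f x))\<^sup>2) \<partial>lebesgue_on \<Omega>)"
  using assms by (simp add: L2_normsq_def nn_integral_restrict_space)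

lemma Lp2_iff:
  assumes "\<Omega> \<in> sets lebesgue"
  shows "f \<in> Lp 2 \<Omega> \<longleftrightarrow> f \<in> borel_measurable (lebesgue_on \<Omega>) \<and> L2_normsq \<Omega> f < \<infinity>"
proof -
  have "integrable (lebesgue_on \<Omega>) (\<lambda>x. norm (f x) powr 2) \<longleftrightarrow> L2_normsq \<Omega> f < \<infinity>"
    if [measurable]: "f \<in> borel_measurable (lebesgue_on \<Omega>)"
    by (simp add: integrable_iff_bounded L2_normsq_restrict[OF assms])
  then show ?thesis by (auto simp: Lp_def)
qed

lemma L2_normsq_mono_set: "\<Omega>' \<subseteq> \<Omega> \<Longrightarrow> L2_normsq \<Omega>' f \<le> L2_normsq \<Omega> f"
  unfolding L2_normsq_def by (intro nn_integral_mono) (auto simp: indicator_def)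

lemma L2_normsq_mono:
  assumes "\<And>x. x \<in> \<Omega> \<Longrightarrow> norm (f x) \<le> norm (g x)"
  shows "L2_normsq \<Omega> f \<le> L2_normsq \<Omega> g"
  unfolding L2_normsq_def
  by (intro nn_integral_mono) (use assms in \<open>auto simp: indicator_def intro!: ennreal_leI power_mono\<close>)

lemma L2_normsq_cong_AE:
  assumes "AE x in lebesgue. x \<in> \<Omega> \<longrightarrow> norm (f x) = norm (g x)"
  shows "L2_normsq \<Omega> f = L2_normsq \<Omega> g"
  unfolding L2_normsq_def
  by (intro nn_integral_cong_AE) (use assms in eventually_elim, auto simp: indicator_def)

lemma Lp2_locally_integrable:
  fixes f :: "'a::euclidean_space \<Rightarrow> 'b::euclidean_space"
  assumes \<Omega>: "\<Omega> \<in> sets lebesgue" and f: "f \<in> Lp 2 \<Omega>"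
  shows "locally_integrable \<Omega> f"
  unfolding locally_integrable_def set_integrable_def
proof (intro allI impI)
  fix K assume K: "compact K \<and> K \<subseteq> \<Omega>"
  have "(\<lambda>x. indicator \<Omega> x *\<^sub>R f x) \<in> borel_measurable lebesgue"
    using f \<Omega> by (simp add: Lp_def borel_measurable_restrict_space_iff)
  moreover have Km[measurable]: "K \<in> sets lebesgue" using K by (simp add: borel_compact)
  ultimately have "(\<lambda>x. indicator K x *\<^sub>R (indicator \<Omega> x *\<^sub>R f x)) \<in> borel_measurable lebesgue"
    by measurable
  moreover have "indicator K x *\<^sub>R (indicator \<Omega> x *\<^sub>R f x) = indicator K x *\<^sub>R f x" for x
    using K by (auto simp: indicator_def)
  ultimately have m: "(\<lambda>x. indicator K x *\<^sub>R f x) \<in> borel_measurable lebesgue" by (simp only:)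
  show "integrable lebesgue (\<lambda>x. indicator K x *\<^sub>R f x)"
  proof (rule integrableI_bounded[OF m])
    have "(\<integral>\<^sup>+x. ennreal (norm (indicator K x *\<^sub>R f x)) \<partial>lebesgue)
      \<le> (\<integral>\<^sup>+x. indicator K x + ennreal ((norm (indicator K x *\<^sub>R f x))\<^sup>2) \<partial>lebesgue)"
    proof (rule nn_integral_mono)
      fix x
      have "norm (f x) \<le> 1 * (1 + (norm (f x))\<^sup>2)"
        using sum_squares_bound[of 1 "norm (f x)"] norm_ge_zero[of "f x"] by (simp only: mult_1 one_power2 mult_1_right)
      from ennreal_le_mult_add[OF this] show "ennreal (norm (indicator K x *\<^sub>R f x))
        \<le> indicator K x + ennreal ((norm (indicator K x *\<^sub>R f x))\<^sup>2)"
        by (simp add: indicator_def)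
    qed
    also have "\<dots> = emeasure lebesgue K + (\<integral>\<^sup>+x. ennreal ((norm (indicator K x *\<^sub>R f x))\<^sup>2) \<partial>lebesgue)"
    proof (subst nn_integral_add)
      show "(\<lambda>x. ennreal ((norm (indicator K x *\<^sub>R f x))\<^sup>2)) \<in> borel_measurable lebesgue"
        using m by measurable
    qed auto
    also have "(\<integral>\<^sup>+x. ennreal ((norm (indicator K x *\<^sub>R f x))\<^sup>2) \<partial>lebesgue) \<le> L2_normsq \<Omega> f"
      unfolding L2_normsq_def by (intro nn_integral_mono) (use K in \<open>auto simp: indicator_def\<close>)
    also have "emeasure lebesgue K + L2_normsq \<Omega> f < \<infinity>"
      using K f \<Omega> emeasure_bounded_finite[OF compact_imp_bounded, of K] by (simp add: Lp2_iff borel_compact)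
    finally show "(\<integral>\<^sup>+x. ennreal (norm (indicator K x *\<^sub>R f x)) \<partial>lebesgue) < \<infinity>" by simp
  qed
qed

lemma L2_normsq_add_le:
  fixes f g h :: "'a::euclidean_space \<Rightarrow> 'b::euclidean_space"
  assumes "f \<in> borel_measurable lebesgue" "g \<in> borel_measurable lebesgue" "\<Omega> \<in> sets lebesgue"
    and b: "\<And>x. x \<in> \<Omega> \<Longrightarrow> norm (h x) \<le> norm (f x) + norm (g x)"
  shows "L2_normsq \<Omega> h \<le> 2 * (L2_normsq \<Omega> f + L2_normsq \<Omega> g)"
proof -
  note [measurable] = assms(1,2,3)
  have "L2_normsq \<Omega> h \<le> (\<integral>\<^sup>+x. 2 * (ennreal ((norm (f x))\<^sup>2) * indicator \<Omega> x + ennreal ((norm (g x))\<^sup>2) * indicator \<Omega> x) \<partial>lebesgue)"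
    unfolding L2_normsq_def
  proof (rule nn_integral_mono)
    fix x
    show "ennreal ((norm (h x))\<^sup>2) * indicator \<Omega> x
      \<le> 2 * (ennreal ((norm (f x))\<^sup>2) * indicator \<Omega> x + ennreal ((norm (g x))\<^sup>2) * indicator \<Omega> x)"
    proof (cases "x \<in> \<Omega>")
      case True
      have "(norm (h x))\<^sup>2 \<le> (norm (f x) + norm (g x))\<^sup>2" using b[OF True] by (intro power_mono) auto
      also have "\<dots> \<le> 2 * ((norm (f x))\<^sup>2 + (norm (g x))\<^sup>2)" by (rule power_sum_le) auto
      finally show ?thesis using True ennreal_le_mult_add[of _ 2] by simp
    qed simp
  qed
  also have "\<dots> = 2 * (L2_normsq \<Omega> f + L2_normsq \<Omega> g)"
    unfolding L2_normsq_def by (subst nn_integral_cmult, measurable, subst nn_integral_add) measurable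
  finally show ?thesis .
qed

lemma borel_measurable_lebesgueI: "f \<in> borel_measurable borel \<Longrightarrow> f \<in> borel_measurable lebesgue"
  by (rule measurable_completion) simp

lemma L2_normsq_continuous_finite:
  fixes f :: "'a::euclidean_space \<Rightarrow> 'b::euclidean_space"
  assumes f: "continuous_on UNIV f" and "bounded \<Omega>" "\<Omega> \<in> sets lebesgue"
  shows "L2_normsq \<Omega> f < \<infinity>"
proof -
  have "compact (f ` closure \<Omega>)"
    by (rule compact_continuous_image) (use f assms(2) in \<open>auto intro: continuous_on_subset\<close>)
  then have "bounded (f ` closure \<Omega>)" by (rule compact_imp_bounded)
  then obtain B where "\<forall>y\<in>f ` closure \<Omega>. norm y \<le> B" unfolding bounded_iff by blast
  then have B: "norm (f x) \<le> B" if "x \<in> \<Omega>" for x using that closure_subset[of \<Omega>] by auto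
  have "L2_normsq \<Omega> f \<le> (\<integral>\<^sup>+x\<in>\<Omega>. ennreal (B\<^sup>2) \<partial>lebesgue)"
    unfolding L2_normsq_def
    by (intro nn_integral_mono) (auto simp: indicator_def intro!: ennreal_leI power_mono B)
  also have "\<dots> = ennreal (B\<^sup>2) * emeasure lebesgue \<Omega>"
    using assms(3) by (rule nn_integral_cmult_indicator)
  also have "\<dots> < \<infinity>"
    using fmeasurableD2[OF bounded_set_imp_lmeasurable[OF assms(2,3)]]
    by (auto simp: ennreal_mult_less_top less_top simp del: emeasure_completion)
  finally show ?thesis .
qed

section \<open>Space-time cylinders and limits of weak gradients\<close>

lemma open_Q_plus: "open (Q_plus r)"
  by (simp add: Q_plus_def open_Times)

lemma Q_plus_lebesgue [measurable]: "Q_plus r \<in> sets lebesgue"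
  by (intro sets_completionI_sets) (simp add: borel_open open_Q_plus)

lemma bounded_Q_plus: "bounded (Q_plus r)"
  unfolding Q_plus_def
  by (intro bounded_Times bounded_ball bounded_subset[OF bounded_closed_interval[of 0 "r\<^sup>2"]]) auto

lemma open_spacetime: "open spacetime"
  by (simp add: spacetime_def open_Times)

lemma Q_plus_mono: "0 \<le> r \<Longrightarrow> r \<le> s \<Longrightarrow> Q_plus r \<subseteq> Q_plus s"
  unfolding Q_plus_def by (intro Sigma_mono subset_ball) (auto dest: power_mono[of r s 2])

text \<open>The cylinder starts at time 0 and has height \<open>r\<^sup>2\<close>, so any r \<ge> 1
  beyond the norms of the points will do: positivity of the times is given, and r \<ge> 1 makes the
  height exceed them as well.\<close>

lemma compact_subset_Q_plus:
  assumes "compact K" "K \<subseteq> spacetime"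
  obtains r where "r > 0" "K \<subseteq> Q_plus r"
proof -
  obtain R where R: "\<forall>z\<in>K. norm z \<le> R"
    using compact_imp_bounded[OF assms(1)] unfolding bounded_iff by blast
  define r where "r = \<bar>R\<bar> + 1"
  have "r > 0" by (simp add: r_def)
  have "R < r\<^sup>2"
  proof -
    have "r \<le> r\<^sup>2" by (rule self_le_power) (auto simp: r_def)
    then show ?thesis by (simp add: r_def)
  qed
  have "(x, t) \<in> Q_plus r" if "(x, t) \<in> K" for x t
  proof -
    have "norm x \<le> R" "\<bar>t\<bar> \<le> R"
      using bspec[OF R that] norm_fst_le[of x t] norm_snd_le[of t x] by auto
    moreover have "t > 0" using that assms(2) by (auto simp: spacetime_def)
    ultimately show ?thesis using \<open>R < r\<^sup>2\<close> by (auto simp: Q_plus_def r_def)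
  qed
  then show ?thesis using that \<open>r > 0\<close> by (meson subrelI)
qed

lemma locally_integrable_spacetimeI:
  fixes f :: "'a::euclidean_space \<times> real \<Rightarrow> 'b::euclidean_space"
  assumes "\<And>r. r > 0 \<Longrightarrow> locally_integrable (Q_plus r) f"
  shows "locally_integrable spacetime f"
  unfolding locally_integrable_def
proof (intro allI impI)
  fix K :: "('a \<times> real) set" assume "compact K \<and> K \<subseteq> spacetime"
  moreover from this obtain r where "r > 0" "K \<subseteq> Q_plus r" using compact_subset_Q_plus by blast
  ultimately show "f absolutely_integrable_on K"
    using assms[of r] by (simp add: locally_integrable_def)
qed

text \<open>The support of a test function is compact, so every test function on space-time already
  belongs to a single cylinder.\<close>

lemma is_weak_gradient_spacetimeI:
  fixes u :: "'a::euclidean_space \<times> real \<Rightarrow> real"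
  assumes "\<And>r. r > 0 \<Longrightarrow> is_weak_gradient (Q_plus r) u G"
  shows "is_weak_gradient spacetime u G"
proof (rule is_weak_gradientI)
  show "locally_integrable spacetime u" "locally_integrable spacetime G"
    by (rule locally_integrable_spacetimeI, use assms in \<open>simp add: is_weak_gradient_def\<close>)+
  fix \<phi> :: "'a \<times> real \<Rightarrow> real" and b :: "'a \<times> real" assume t: "\<phi> \<in> test_functions spacetime" and b: "b \<in> Basis"
  have "compact (closure {x. \<phi> x \<noteq> 0})" "closure {x. \<phi> x \<noteq> 0} \<subseteq> spacetime" and s: "smooth \<phi>"
    using t by (auto simp: test_functions_def)
  then obtain r where r: "r > 0" "closure {x. \<phi> x \<noteq> 0} \<subseteq> Q_plus r"
    using compact_subset_Q_plus by blast
  then have "\<phi> \<in> test_functions (Q_plus r)" using t by (simp add: test_functions_def)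
  then show "(\<integral>x. u x * frechet_derivative \<phi> (at x) b \<partial>lebesgue) = - (\<integral>x. (G x \<bullet> b) * \<phi> x \<partial>lebesgue)"
    by (rule is_weak_gradientD[OF assms[OF r(1)] _ b])
qed

text \<open>Both sides of the defining identity are pairings with a fixed compactly supported
  function, hence pass to L^2 limits. This turns the gradients of smooth approximants into a weak
  gradient of the limit.\<close>

lemma is_weak_gradient_limit:
  fixes u :: "'a::euclidean_space \<Rightarrow> real"
  assumes k: "\<And>k. is_weak_gradient \<Omega> (U k) (H k)"
    and u: "locally_integrable \<Omega> u" "(\<lambda>k. L2_normsq \<Omega> (\<lambda>x. U k x - u x)) \<longlonglongrightarrow> 0"
    and G: "locally_integrable \<Omega> G" "(\<lambda>k. L2_normsq \<Omega> (\<lambda>x. H k x - G x)) \<longlonglongrightarrow> 0"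
  shows "is_weak_gradient \<Omega> u G"
proof (rule is_weak_gradientI[OF u(1) G(1)])
  fix \<phi> and b :: 'a assume t: "\<phi> \<in> test_functions \<Omega>" and b: "b \<in> Basis"
  obtain K R where KO: "K \<subseteq> \<Omega>" and K: "supported_in \<phi> K R"
    using test_functionD[OF t] by blast
  note s = supported_inD[OF K]
  have "L2_normsq \<Omega> (\<lambda>x. H k x \<bullet> b - G x \<bullet> b) \<le> L2_normsq \<Omega> (\<lambda>x. H k x - G x)" for k
  proof (rule L2_normsq_mono)
    show "norm (H k x \<bullet> b - G x \<bullet> b) \<le> norm (H k x - G x)" for x
      using Basis_le_norm[OF b, of "H k x - G x"] by (simp add: inner_diff_left)
  qed
  then have lG: "(\<lambda>k. L2_normsq \<Omega> (\<lambda>x. H k x \<bullet> b - G x \<bullet> b)) \<longlonglongrightarrow> 0"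
    by (intro tendsto_sandwich[OF _ _ tendsto_const G(2)]) auto
  have li: "locally_integrable \<Omega> (U k)" "locally_integrable \<Omega> (H k)" for k
    using k by (auto simp: is_weak_gradient_def)
  have "(\<lambda>k. \<integral>x. U k x * frechet_derivative \<phi> (at x) b \<partial>lebesgue) \<longlonglongrightarrow> (\<integral>x. u x * frechet_derivative \<phi> (at x) b \<partial>lebesgue)"
    by (rule L2_pairing_tendsto[OF li(1) u smooth_continuous[OF smooth_derivative[OF s(1)]] s(2) KO s(4)])
  moreover have "(\<lambda>k. - (\<integral>x. (H k x \<bullet> b) * \<phi> x \<partial>lebesgue)) \<longlonglongrightarrow> - (\<integral>x. (G x \<bullet> b) * \<phi> x \<partial>lebesgue)"
    by (intro tendsto_minus L2_pairing_tendsto[OF locally_integrable_inner[OF li(2)]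
          locally_integrable_inner[OF G(1)] lG smooth_continuous[OF s(1)] s(2) KO s(3)])
  ultimately show "(\<integral>x. u x * frechet_derivative \<phi> (at x) b \<partial>lebesgue) = - (\<integral>x. (G x \<bullet> b) * \<phi> x \<partial>lebesgue)"
    unfolding is_weak_gradientD[OF k t b] by (rule LIMSEQ_unique)
qed

lemma weak_grad_AE:
  assumes "open \<Omega>" "is_weak_gradient \<Omega> u G"
  shows "AE x in lebesgue. x \<in> \<Omega> \<longrightarrow> weak_grad \<Omega> u x = G x"
proof -
  have "is_weak_gradient \<Omega> u (weak_grad \<Omega> u)"
    unfolding weak_grad_def by (rule someI[of "is_weak_gradient \<Omega> u", OF assms(2)])
  then show ?thesis by (rule is_weak_gradient_unique[OF assms(1) _ assms(2)])
qed

text \<open>Replaces the arbitrary choice inside \<open>weak_grad\<close> by any weak gradient at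
  hand.\<close>

lemma H1_normsq_eq:
  assumes "open \<Omega>" "is_weak_gradient \<Omega> u G"
  shows "H1_normsq \<Omega> u = L2_normsq \<Omega> u + L2_normsq \<Omega> G"
  unfolding H1_normsq_def
  by (subst L2_normsq_cong_AE[of \<Omega> "weak_grad \<Omega> u" G]) (use weak_grad_AE[OF assms] in auto)

text \<open>\<open>w\<close> and \<open>G\<close> are Borel representatives of an element of \<open>\<U>\<^sub>0\<close> and of its space-time
  gradient. The smooth approximations that witness the trace already encode the weak gradient,
  so that membership in \<open>\<U>\<^sub>0\<close> can be transported without touching test functions.\<close>

definition smoothly_approximable ::
  "('a::euclidean_space \<times> real \<Rightarrow> real) \<Rightarrow> ('a \<times> real \<Rightarrow> 'a \<times> real) \<Rightarrow> ('a \<Rightarrow> real) \<Rightarrow> bool" where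
  "smoothly_approximable w G u0 \<longleftrightarrow> w \<in> borel_measurable borel \<and> G \<in> borel_measurable borel \<and>
     (\<forall>r>0. \<exists>\<phi>. (\<forall>k::nat. smooth (\<phi> k)) \<and>
       (\<lambda>k. L2_normsq (Q_plus r) (\<lambda>z. \<phi> k z - w z)) \<longlonglongrightarrow> 0 \<and>
       (\<lambda>k. L2_normsq (Q_plus r) (\<lambda>z. gradc (\<phi> k) z - G z)) \<longlonglongrightarrow> 0 \<and>
       (\<lambda>k. L2_normsq (ball 0 r) (\<lambda>x. \<phi> k (x, 0) - u0 x)) \<longlonglongrightarrow> 0)"

text \<open>Some approximant is at finite L^2 distance from \<open>f\<close>, and it is square
  integrable itself, being continuous on the closure of a bounded set.\<close>

lemma Lp2_limit:
  fixes f :: "'a::euclidean_space \<Rightarrow> 'b::euclidean_space"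
  assumes f: "f \<in> borel_measurable borel" and F: "\<And>k. continuous_on UNIV (F k)"
    and l: "(\<lambda>k. L2_normsq \<Omega> (\<lambda>x. F k x - f x)) \<longlonglongrightarrow> 0" and \<Omega>: "bounded \<Omega>" "\<Omega> \<in> sets lebesgue"
  shows "f \<in> Lp 2 \<Omega>"
proof -
  have fl: "f \<in> borel_measurable lebesgue" by (rule borel_measurable_lebesgueI[OF f])
  have Fl: "F k \<in> borel_measurable lebesgue" for k
    by (intro borel_measurable_lebesgueI borel_measurable_continuous_onI F)
  have "\<forall>\<^sub>F k in sequentially. L2_normsq \<Omega> (\<lambda>x. F k x - f x) < 1"
    using order_tendstoD(2)[OF l, of 1] by simp
  then obtain k where k: "L2_normsq \<Omega> (\<lambda>x. F k x - f x) < 1" by (auto simp: eventually_sequentially)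
  have "L2_normsq \<Omega> f \<le> 2 * (L2_normsq \<Omega> (F k) + L2_normsq \<Omega> (\<lambda>x. F k x - f x))"
  proof (rule L2_normsq_add_le[OF Fl _ \<Omega>(2)])
    show "(\<lambda>x. F k x - f x) \<in> borel_measurable lebesgue" using Fl fl by measurable
    show "norm (f x) \<le> norm (F k x) + norm (F k x - f x)" for x
      using norm_triangle_ineq4[of "F k x" "F k x - f x"] by simp
  qed
  also have "\<dots> < \<infinity>"
    using k L2_normsq_continuous_finite[OF F \<Omega>, of k] by (auto simp: ennreal_mult_less_top less_top intro: less_trans)
  finally show ?thesis
    using fl \<Omega>(2) by (simp add: Lp2_iff measurable_restrict_space1)
qed

text \<open>The gradients of the approximants converge to \<open>G\<close>, so \<open>G\<close> is a
  weak gradient of \<open>w\<close>. The H^1 distance in the definition of the trace is then the sum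
  of the two L^2 distances that are assumed to vanish in the limit.\<close>

lemma smoothly_approximable_U0:
  assumes a: "smoothly_approximable w G u0"
  shows "w \<in> U0_space u0" "is_weak_gradient spacetime w G"
proof -
  have w: "w \<in> borel_measurable borel" and G: "G \<in> borel_measurable borel"
    using a by (auto simp: smoothly_approximable_def)
  have Q: "w \<in> H1 (Q_plus r) \<and> is_weak_gradient (Q_plus r) w G \<and>
     (\<exists>\<phi>. (\<forall>k::nat. smooth (\<phi> k)) \<and> (\<lambda>k. H1_normsq (Q_plus r) (\<lambda>z. \<phi> k z - w z)) \<longlonglongrightarrow> 0 \<and>
      (\<lambda>k. L2_normsq (ball 0 r) (\<lambda>x. \<phi> k (x, 0) - u0 x)) \<longlonglongrightarrow> 0)" if r: "r > 0" for r
  proof -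
    obtain \<phi> where s: "\<And>k::nat. smooth (\<phi> k)"
      and lw: "(\<lambda>k. L2_normsq (Q_plus r) (\<lambda>z. \<phi> k z - w z)) \<longlonglongrightarrow> 0"
      and lG: "(\<lambda>k. L2_normsq (Q_plus r) (\<lambda>z. gradc (\<phi> k) z - G z)) \<longlonglongrightarrow> 0"
      and l0: "(\<lambda>k. L2_normsq (ball 0 r) (\<lambda>x. \<phi> k (x, 0) - u0 x)) \<longlonglongrightarrow> 0"
      using a r unfolding smoothly_approximable_def by meson
    have w2: "w \<in> Lp 2 (Q_plus r)"
      by (rule Lp2_limit[OF w smooth_continuous[OF s] lw bounded_Q_plus Q_plus_lebesgue])
    have G2: "G \<in> Lp 2 (Q_plus r)"
      by (rule Lp2_limit[OF G gradc_continuous[OF s] lG bounded_Q_plus Q_plus_lebesgue])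
    have wg: "is_weak_gradient (Q_plus r) w G"
      by (rule is_weak_gradient_limit[OF is_weak_gradient_smooth[OF s]
            Lp2_locally_integrable[OF Q_plus_lebesgue w2] lw Lp2_locally_integrable[OF Q_plus_lebesgue G2] lG])
    have "H1_normsq (Q_plus r) (\<lambda>z. \<phi> k z - w z)
        = L2_normsq (Q_plus r) (\<lambda>z. \<phi> k z - w z) + L2_normsq (Q_plus r) (\<lambda>z. gradc (\<phi> k) z - G z)" for k
      by (rule H1_normsq_eq[OF open_Q_plus is_weak_gradient_diff[OF is_weak_gradient_smooth[OF s] wg]])
    then have "(\<lambda>k. H1_normsq (Q_plus r) (\<lambda>z. \<phi> k z - w z)) \<longlonglongrightarrow> 0"
      using tendsto_add[OF lw lG] by simp
    then show ?thesis using w2 G2 wg s l0 unfolding H1_def by blast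
  qed
  show "w \<in> U0_space u0"
    unfolding U0_space_def U_space_def has_initial_trace_def using Q by blast
  show "is_weak_gradient spacetime w G"
    by (rule is_weak_gradient_spacetimeI) (use Q in blast)
qed

subsection \<open>The energy in terms of time slices\<close>

text \<open>Lebesgue measure on a product is only the completion of the product measure, so the
  exchange of integrals is carried out for Borel representatives over \<open>lborel\<close>.\<close>

lemma borel_version:
  fixes f :: "'a::euclidean_space \<Rightarrow> 'b::euclidean_space"
  assumes f: "f \<in> borel_measurable lebesgue"
  shows "\<exists>g\<in>borel_measurable borel. AE x in lebesgue. f x = g x"
proof -
  have "\<exists>h. h \<in> borel_measurable borel \<and> (AE x in lebesgue. f x \<bullet> b = h x)" for b
  proof -
    have "(\<lambda>x. f x \<bullet> b) \<in> borel_measurable lebesgue" using f by measurable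
    from completion_ex_borel_measurable_real[OF this]
    obtain h where "h \<in> borel_measurable lborel" "AE x in lborel. f x \<bullet> b = h x" by blast
    then show ?thesis using AE_completion[of "\<lambda>x. f x \<bullet> b = h x" lborel] by auto
  qed
  then have "\<forall>b. \<exists>h. h \<in> borel_measurable borel \<and> (AE x in lebesgue. f x \<bullet> b = h x)" by blast
  from choice[OF this] obtain h where h: "\<And>b. h b \<in> borel_measurable borel"
    "\<And>b. AE x in lebesgue. f x \<bullet> b = h b x" by blast
  show ?thesis
  proof (rule bexI)
    have "AE x in lebesgue. \<forall>b\<in>(Basis :: 'b set). f x \<bullet> b = h b x"
      by (intro AE_finite_allI h(2)) auto
    then show "AE x in lebesgue. f x = (\<Sum>b\<in>Basis. h b x *\<^sub>R b)"
    proof eventually_elim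
      case (elim x)
      have "f x = (\<Sum>b\<in>Basis. (f x \<bullet> b) *\<^sub>R b)" by (simp add: euclidean_representation)
      then show ?case using elim by simp
    qed
    show "(\<lambda>x. \<Sum>b\<in>Basis. h b x *\<^sub>R b) \<in> borel_measurable borel"
      using h(1) by measurable
  qed
qed

text \<open>The gradients found on growing cylinders agree only almost everywhere, so they cannot
  simply be united. For almost every point of \<open>A m\<close> the local values are constant from
  index m on, and \<open>lim\<close> of Borel functions is Borel even where the sequence
  diverges.\<close>

lemma glue_measurable:
  fixes F :: "nat \<Rightarrow> 'a::euclidean_space \<Rightarrow> 'b::euclidean_space"
  assumes A: "\<And>n. A n \<in> sets lebesgue" "\<And>m n. m \<le> n \<Longrightarrow> A m \<subseteq> A n"
    and F: "\<And>n. F n \<in> borel_measurable (lebesgue_on (A n))"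
    and c: "\<And>m n. m \<le> n \<Longrightarrow> AE z in lebesgue. z \<in> A m \<longrightarrow> F n z = F m z"
  shows "\<exists>H\<in>borel_measurable borel. \<forall>n. AE z in lebesgue. z \<in> A n \<longrightarrow> H z = F n z"
proof -
  have "\<exists>B. B \<in> borel_measurable borel \<and> (AE z in lebesgue. indicator (A n) z *\<^sub>R F n z = B z)" for n
  proof -
    have "(\<lambda>z. indicator (A n) z *\<^sub>R F n z) \<in> borel_measurable lebesgue"
      using F[of n] A(1)[of n] by (simp add: borel_measurable_restrict_space_iff)
    from borel_version[OF this] show ?thesis by blast
  qed
  then have "\<forall>n. \<exists>B. B \<in> borel_measurable borel \<and> (AE z in lebesgue. indicator (A n) z *\<^sub>R F n z = B z)" by blast
  from choice[OF this] obtain B where B: "\<And>n. B n \<in> borel_measurable borel"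
    "\<And>n. AE z in lebesgue. indicator (A n) z *\<^sub>R F n z = B n z" by blast
  show ?thesis
  proof (intro bexI allI)
    show "(\<lambda>z. lim (\<lambda>n. B n z)) \<in> borel_measurable borel"
      by (rule borel_measurable_lim_metric) (rule B)
    fix m
    have "AE z in lebesgue. \<forall>n. indicator (A n) z *\<^sub>R F n z = B n z"
      using B(2) by (simp add: AE_all_countable)
    moreover have "AE z in lebesgue. \<forall>n. m \<le> n \<longrightarrow> z \<in> A m \<longrightarrow> F n z = F m z"
      using c by (auto simp: AE_all_countable)
    ultimately show "AE z in lebesgue. z \<in> A m \<longrightarrow> lim (\<lambda>n. B n z) = F m z"
    proof eventually_elim
      case (elim z)
      show ?case
      proof
        assume z: "z \<in> A m"
        have "B n z = F m z" if "m \<le> n" for n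
        proof -
          have "z \<in> A n" using A(2)[OF that] z by blast
          then have "B n z = F n z" using spec[OF elim(1), of n] by simp
          also have "F n z = F m z" using elim(2) that z by blast
          finally show ?thesis .
        qed
        then have "\<forall>\<^sub>F n in sequentially. B n z = F m z"
          unfolding eventually_sequentially by blast
        then show "lim (\<lambda>n. B n z) = F m z"
          by (intro limI tendsto_eventually)
      qed
    qed
  qed
qed

lemma AE_spacetime_iff:
  assumes "\<And>n::nat. AE z in lebesgue. z \<in> Q_plus (real n + 1) \<longrightarrow> P z"
  shows "AE z in lebesgue. z \<in> spacetime \<longrightarrow> P z"
proof -
  have "AE z in lebesgue. \<forall>n::nat. z \<in> Q_plus (real n + 1) \<longrightarrow> P z"
    unfolding AE_all_countable using assms by blast
  then show ?thesis
  proof eventually_elim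
    case (elim z)
    show ?case
    proof
      assume "z \<in> spacetime"
      then obtain r where r: "r > 0" "{z} \<subseteq> Q_plus r" using compact_subset_Q_plus[of "{z}"] by auto
      obtain n where "r \<le> real n" using real_arch_simple by blast
      then have "Q_plus r \<subseteq> (Q_plus (real n + 1) :: ('a \<times> real) set)" using r by (intro Q_plus_mono) auto
      then show "P z" using elim r(2) by blast
    qed
  qed
qed

text \<open>\<open>U_space\<close> provides one gradient per cylinder. Uniqueness makes them
  compatible, and the glued field is the gradient on space-time. The H^1 convergence behind the
  trace then splits into convergence of the functions and convergence of their gradients.\<close>

lemma U0_space_representative:
  assumes u: "u \<in> U0_space u0"
  shows "\<exists>w G. smoothly_approximable w G u0 \<and>
    (AE z in lebesgue. z \<in> spacetime \<longrightarrow> u z = w z) \<and>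
    (AE z in lebesgue. z \<in> spacetime \<longrightarrow> weak_grad spacetime u z = G z)"
proof -
  have tr: "has_initial_trace u u0" and H1: "\<And>r. r > 0 \<Longrightarrow> u \<in> H1 (Q_plus r)"
    using u by (auto simp: U0_space_def U_space_def)
  define A :: "nat \<Rightarrow> ('a \<times> real) set" where "A n = Q_plus (real n + 1)" for n
  have A: "open (A n)" "A n \<in> sets lebesgue" for n
    unfolding A_def by (rule open_Q_plus, rule Q_plus_lebesgue)
  have Amono: "A m \<subseteq> A n" if "m \<le> n" for m n
    unfolding A_def by (rule Q_plus_mono) (use that in auto)
  have "\<forall>n. \<exists>G. G \<in> Lp 2 (A n) \<and> is_weak_gradient (A n) u G"
  proof
    fix n
    show "\<exists>G. G \<in> Lp 2 (A n) \<and> is_weak_gradient (A n) u G"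
      using H1[of "real n + 1"] unfolding A_def H1_def by auto
  qed
  from choice[OF this] obtain F where F: "\<And>n. F n \<in> Lp 2 (A n)" "\<And>n. is_weak_gradient (A n) u (F n)" by blast
  have "\<exists>H\<in>borel_measurable borel. \<forall>n. AE z in lebesgue. z \<in> A n \<longrightarrow> H z = F n z"
  proof (rule glue_measurable[OF A(2) Amono])
    show "F n \<in> borel_measurable (lebesgue_on (A n))" for n using F(1)[of n] by (simp add: Lp_def)
    show "AE z in lebesgue. z \<in> A m \<longrightarrow> F n z = F m z" if "m \<le> n" for m n
      by (rule is_weak_gradient_unique[OF A(1) is_weak_gradient_subset[OF F(2) Amono[OF that]] F(2)])
  qed
  then obtain H where H: "H \<in> borel_measurable borel" "\<And>n. AE z in lebesgue. z \<in> A n \<longrightarrow> H z = F n z" by blast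
  have "\<exists>w\<in>borel_measurable borel. \<forall>n::nat. AE z in lebesgue. z \<in> A n \<longrightarrow> w z = u z"
  proof (rule glue_measurable[OF A(2) Amono])
    show "u \<in> borel_measurable (lebesgue_on (A n))" for n
      using H1[of "real n + 1"] by (simp add: A_def H1_def Lp_def)
  qed auto
  then obtain w where w: "w \<in> borel_measurable borel" "\<And>n::nat. AE z in lebesgue. z \<in> A n \<longrightarrow> w z = u z" by blast
  have wgA: "is_weak_gradient (A n) u H" for n
  proof (rule is_weak_gradient_cong_AE[OF F(2)[of n]])
    show "AE x in lebesgue. x \<in> A n \<longrightarrow> F n x = H x" using H(2)[of n] by eventually_elim auto
    then show "locally_integrable (A n) H"
      by (rule locally_integrable_cong_AE[rotated]) (use F(2)[of n] H(1) in \<open>auto simp: is_weak_gradient_def\<close>)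
    show "locally_integrable (A n) u" using F(2)[of n] by (simp add: is_weak_gradient_def)
  qed auto
  have sub: "\<exists>n. Q_plus r \<subseteq> A n" if "r > 0" for r
  proof -
    obtain n where "r \<le> real n" using real_arch_simple by blast
    then show ?thesis using that unfolding A_def by (intro exI[of _ n] Q_plus_mono) auto
  qed
  have wg: "is_weak_gradient (Q_plus r) u H" if "r > 0" for r
    using sub[OF that] is_weak_gradient_subset[OF wgA] by blast
  have uw: "AE z in lebesgue. z \<in> Q_plus r \<longrightarrow> w z = u z" if r: "r > 0" for r
  proof -
    obtain n where n: "Q_plus r \<subseteq> A n" using sub[OF r] by blast
    show ?thesis using w(2)[of n] by eventually_elim (use n in blast)
  qed
  have "smoothly_approximable w H u0"
    unfolding smoothly_approximable_def
  proof (intro conjI w(1) H(1) allI impI)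
    fix r :: real assume r: "r > 0"
    obtain \<phi> where \<phi>: "\<And>k::nat. smooth (\<phi> k)"
      "(\<lambda>k. H1_normsq (Q_plus r) (\<lambda>z. \<phi> k z - u z)) \<longlonglongrightarrow> 0"
      "(\<lambda>k. L2_normsq (ball 0 r) (\<lambda>x. \<phi> k (x, 0) - u0 x)) \<longlonglongrightarrow> 0"
      using tr r unfolding has_initial_trace_def by blast
    have eq: "H1_normsq (Q_plus r) (\<lambda>z. \<phi> k z - u z)
        = L2_normsq (Q_plus r) (\<lambda>z. \<phi> k z - u z) + L2_normsq (Q_plus r) (\<lambda>z. gradc (\<phi> k) z - H z)" for k
      by (rule H1_normsq_eq[OF open_Q_plus is_weak_gradient_diff[OF is_weak_gradient_smooth[OF \<phi>(1)] wg[OF r]]])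
    have "(\<lambda>k. L2_normsq (Q_plus r) (\<lambda>z. \<phi> k z - u z)) \<longlonglongrightarrow> 0"
      by (rule tendsto_sandwich[OF _ _ tendsto_const \<phi>(2)]) (auto simp: eq)
    moreover have "L2_normsq (Q_plus r) (\<lambda>z. \<phi> k z - u z) = L2_normsq (Q_plus r) (\<lambda>z. \<phi> k z - w z)" for k
      by (rule L2_normsq_cong_AE) (use uw[OF r] in \<open>eventually_elim, auto\<close>)
    ultimately have 1: "(\<lambda>k. L2_normsq (Q_plus r) (\<lambda>z. \<phi> k z - w z)) \<longlonglongrightarrow> 0" by simp
    have 2: "(\<lambda>k. L2_normsq (Q_plus r) (\<lambda>z. gradc (\<phi> k) z - H z)) \<longlonglongrightarrow> 0"
      by (rule tendsto_sandwich[OF _ _ tendsto_const \<phi>(2)]) (auto simp: eq)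
    show "\<exists>\<phi>. (\<forall>k::nat. smooth (\<phi> k)) \<and>
       (\<lambda>k. L2_normsq (Q_plus r) (\<lambda>z. \<phi> k z - w z)) \<longlonglongrightarrow> 0 \<and>
       (\<lambda>k. L2_normsq (Q_plus r) (\<lambda>z. gradc (\<phi> k) z - H z)) \<longlonglongrightarrow> 0 \<and>
       (\<lambda>k. L2_normsq (ball 0 r) (\<lambda>x. \<phi> k (x, 0) - u0 x)) \<longlonglongrightarrow> 0"
      using \<phi>(1,3) 1 2 by blast
  qed
  moreover have "AE z in lebesgue. z \<in> spacetime \<longrightarrow> u z = w z"
  proof (rule AE_spacetime_iff)
    fix n :: nat
    have "real n + 1 > 0" by simp
    from uw[OF this] show "AE z in lebesgue. z \<in> Q_plus (real n + 1) \<longrightarrow> u z = w z"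
      by eventually_elim auto
  qed
  moreover have "AE z in lebesgue. z \<in> spacetime \<longrightarrow> weak_grad spacetime u z = H z"
    by (rule weak_grad_AE[OF open_spacetime is_weak_gradient_spacetimeI[OF wg]])
  ultimately show ?thesis by blast
qed

section \<open>Time slices and the two energy profiles\<close>

lemma AE_slices:
  fixes P :: "'a::euclidean_space \<times> real \<Rightarrow> bool"
  assumes "AE z in lebesgue. P z"
  shows "AE t in lebesgue. AE x in lebesgue. P (x, t)"
proof -
  have "AE z in lborel. P z" using assms by (simp add: AE_completion_iff)
  \<comment> \<open>The exceptional set is enlarged to a Borel null set, to which Tonelli applies:
    almost all its sections are null.\<close>
  then obtain N where N: "N \<in> null_sets lborel" "{z. \<not> P z} \<subseteq> N"
    unfolding eventually_ae_filter by auto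
  have Nm[measurable]: "N \<in> sets (lborel \<Otimes>\<^sub>M lborel)" by (subst lborel_prod) (rule null_setsD2[OF N(1)])
  have "(\<integral>\<^sup>+t. \<integral>\<^sup>+x. indicator N (x, t) \<partial>lborel \<partial>lborel) = (\<integral>\<^sup>+z. indicator N z \<partial>(lborel \<Otimes>\<^sub>M lborel))"
    by (rule lborel_pair.nn_integral_snd) measurable
  also have "\<dots> = 0" unfolding lborel_prod using N(1) by (subst nn_integral_indicator) auto
  finally have "AE t in lborel. (\<integral>\<^sup>+x. indicator N (x, t) \<partial>lborel) = 0"
    by (subst (asm) nn_integral_0_iff_AE) auto
  then have "AE t in lborel. AE x in lborel. P (x, t)"
  proof eventually_elim
    case (elim t)
    then have "AE x in lborel. indicator N (x, t) = (0::ennreal)"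
      by (subst (asm) nn_integral_0_iff_AE) auto
    then show ?case by eventually_elim (use N(2) in \<open>auto simp: indicator_def split: if_splits\<close>)
  qed
  then show ?thesis by (simp add: AE_completion_iff)
qed

text \<open>The factor \<open>\<epsilon>\<close> stays outside: the I of the overview is
  \<open>ennreal \<epsilon> * kinetic G t\<close>, and its R is
  \<open>potential \<gamma> w G t\<close>.\<close>

definition kinetic :: "('a::euclidean_space \<times> real \<Rightarrow> 'a \<times> real) \<Rightarrow> real \<Rightarrow> ennreal" where
  "kinetic G t = (\<integral>\<^sup>+x. ennreal (\<bar>snd (G (x, t))\<bar>\<^sup>2) \<partial>lborel)"

definition potential ::
  "real \<Rightarrow> ('a::euclidean_space \<times> real \<Rightarrow> real) \<Rightarrow> ('a \<times> real \<Rightarrow> 'a \<times> real) \<Rightarrow> real \<Rightarrow> ennreal" where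
  "potential \<gamma> w G t = (\<integral>\<^sup>+x. ennreal ((norm (fst (G (x, t))))\<^sup>2 + 2 * max (w (x, t)) 0 powr \<gamma>) \<partial>lborel)"

lemma measurable_slices:
  fixes F :: "'a::euclidean_space \<times> real \<Rightarrow> ennreal"
  assumes "F \<in> borel_measurable borel"
  shows "(\<lambda>t. \<integral>\<^sup>+x. F (x, t) \<partial>lborel) \<in> borel_measurable borel" "(\<lambda>x. F (x, t)) \<in> borel_measurable borel"
proof -
  have F[measurable]: "F \<in> borel_measurable (borel \<Otimes>\<^sub>M borel)" using assms by (simp add: borel_prod)
  have "(\<lambda>(t, x). F (x, t)) \<in> borel_measurable (borel \<Otimes>\<^sub>M lborel)" by measurable
  then show "(\<lambda>t. \<integral>\<^sup>+x. F (x, t) \<partial>lborel) \<in> borel_measurable borel"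
    by (rule lborel.borel_measurable_nn_integral)
  show "(\<lambda>x. F (x, t)) \<in> borel_measurable borel" by measurable
qed

lemma kinetic_integrand:
  fixes G :: "'a::euclidean_space \<times> real \<Rightarrow> 'a \<times> real"
  assumes G: "G \<in> borel_measurable borel"
  shows "(\<lambda>z. ennreal (\<bar>snd (G z)\<bar>\<^sup>2)) \<in> borel_measurable borel"
proof -
  have [measurable]: "(\<lambda>z. snd (G z)) \<in> borel_measurable borel"
    by (rule measurable_compose[OF G], rule borel_measurable_continuous_onI,
        rule continuous_on_snd[OF continuous_on_id])
  show ?thesis by measurable
qed

lemma kinetic_measurable: "G \<in> borel_measurable borel \<Longrightarrow> kinetic G \<in> borel_measurable borel"
  unfolding kinetic_def[abs_def] by (rule measurable_slices(1)[OF kinetic_integrand])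

context
  fixes w :: "'a::euclidean_space \<times> real \<Rightarrow> real" and G :: "'a \<times> real \<Rightarrow> 'a \<times> real"
  assumes w: "w \<in> borel_measurable borel" and G: "G \<in> borel_measurable borel"
begin

lemma potential_integrand: "(\<lambda>z. ennreal ((norm (fst (G z)))\<^sup>2 + 2 * max (w z) 0 powr \<gamma>)) \<in> borel_measurable borel"
proof -
  have [measurable]: "(\<lambda>z. fst (G z)) \<in> borel_measurable borel"
    by (rule measurable_compose[OF G], rule borel_measurable_continuous_onI,
        rule continuous_on_fst[OF continuous_on_id])
  note [measurable] = w
  show ?thesis by measurable
qed

lemma potential_measurable: "potential \<gamma> w G \<in> borel_measurable borel"
  unfolding potential_def[abs_def] by (rule measurable_slices(1)[OF potential_integrand])

text \<open>Equality almost everywhere in space-time gives, at almost every time, equality almost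
  everywhere in space. The three identities share one exceptional set of times; the last one serves
  the energy, the other two serve the quantities to be estimated.\<close>

lemma slice_integrals:
  assumes u: "AE z in lebesgue. z \<in> spacetime \<longrightarrow> u z = w z"
    and wg: "AE z in lebesgue. z \<in> spacetime \<longrightarrow> weak_grad spacetime u z = G z"
  shows "AE t in lebesgue. t > 0 \<longrightarrow>
      (\<integral>\<^sup>+x. ennreal (\<bar>deriv_t u (x, t)\<bar>\<^sup>2) \<partial>lebesgue) = kinetic G t \<and>
      (\<integral>\<^sup>+x. ennreal ((norm (grad_x u (x, t)))\<^sup>2 + 2 * (max (u (x, t)) 0) powr \<gamma>) \<partial>lebesgue) = potential \<gamma> w G t \<and>
      (\<integral>\<^sup>+x. ennreal (\<epsilon> * \<bar>deriv_t u (x, t)\<bar>\<^sup>2 + (norm (grad_x u (x, t)))\<^sup>2) \<partial>lebesgue)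
        + 2 * (\<integral>\<^sup>+x. ennreal ((max (u (x, t)) 0) powr \<gamma>) \<partial>lebesgue)
      = (\<integral>\<^sup>+x. ennreal (\<epsilon> * \<bar>snd (G (x, t))\<bar>\<^sup>2 + (norm (fst (G (x, t))))\<^sup>2) \<partial>lborel)
        + 2 * (\<integral>\<^sup>+x. ennreal ((max (w (x, t)) 0) powr \<gamma>) \<partial>lborel)"
proof -
  have "AE z in lebesgue. z \<in> spacetime \<longrightarrow> u z = w z \<and> weak_grad spacetime u z = G z"
    using u wg by eventually_elim auto
  from AE_slices[OF this] show ?thesis
  proof eventually_elim
    case (elim t)
    show ?case
    proof
      assume "t > 0"
      then have ae: "AE x in lborel. u (x, t) = w (x, t) \<and> weak_grad spacetime u (x, t) = G (x, t)"
        using elim by (simp add: spacetime_def AE_completion_iff)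
      have c: "(\<integral>\<^sup>+x. f (u (x, t)) (weak_grad spacetime u (x, t)) \<partial>lborel)
          = (\<integral>\<^sup>+x. f (w (x, t)) (G (x, t)) \<partial>lborel)" for f :: "real \<Rightarrow> 'a \<times> real \<Rightarrow> ennreal"
        by (rule nn_integral_cong_AE) (use ae in \<open>eventually_elim, auto\<close>)
      show "(\<integral>\<^sup>+x. ennreal (\<bar>deriv_t u (x, t)\<bar>\<^sup>2) \<partial>lebesgue) = kinetic G t \<and>
      (\<integral>\<^sup>+x. ennreal ((norm (grad_x u (x, t)))\<^sup>2 + 2 * (max (u (x, t)) 0) powr \<gamma>) \<partial>lebesgue) = potential \<gamma> w G t \<and>
      (\<integral>\<^sup>+x. ennreal (\<epsilon> * \<bar>deriv_t u (x, t)\<bar>\<^sup>2 + (norm (grad_x u (x, t)))\<^sup>2) \<partial>lebesgue)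
        + 2 * (\<integral>\<^sup>+x. ennreal ((max (u (x, t)) 0) powr \<gamma>) \<partial>lebesgue)
      = (\<integral>\<^sup>+x. ennreal (\<epsilon> * \<bar>snd (G (x, t))\<bar>\<^sup>2 + (norm (fst (G (x, t))))\<^sup>2) \<partial>lborel)
        + 2 * (\<integral>\<^sup>+x. ennreal ((max (w (x, t)) 0) powr \<gamma>) \<partial>lborel)"
        unfolding kinetic_def potential_def deriv_t_def grad_x_def nn_integral_completion
        using c[of "\<lambda>a b. ennreal (\<bar>snd b\<bar>\<^sup>2)"] c[of "\<lambda>a b. ennreal ((norm (fst b))\<^sup>2 + 2 * max a 0 powr \<gamma>)"]
          c[of "\<lambda>a b. ennreal (\<epsilon> * \<bar>snd b\<bar>\<^sup>2 + (norm (fst b))\<^sup>2)"] c[of "\<lambda>a b. ennreal (max a 0 powr \<gamma>)"]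
        by simp
    qed
  qed
qed

lemma slice_energy:
  assumes "\<epsilon> > 0"
  shows "(\<integral>\<^sup>+x. ennreal (\<epsilon> * \<bar>snd (G (x, t))\<bar>\<^sup>2 + (norm (fst (G (x, t))))\<^sup>2) \<partial>lborel)
        + 2 * (\<integral>\<^sup>+x. ennreal ((max (w (x, t)) 0) powr \<gamma>) \<partial>lborel)
      = ennreal \<epsilon> * kinetic G t + potential \<gamma> w G t"
proof -
  have mG: "(\<lambda>x. G (x, t)) \<in> borel_measurable borel" and mw[measurable]: "(\<lambda>x. w (x, t)) \<in> borel_measurable borel"
    by (rule measurable_compose[OF _ G] measurable_compose[OF _ w], rule borel_measurable_continuous_onI,
        intro continuous_intros)+
  have [measurable]: "(\<lambda>x. snd (G (x, t))) \<in> borel_measurable borel" "(\<lambda>x. fst (G (x, t))) \<in> borel_measurable borel"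
    by (rule measurable_compose[OF mG], rule borel_measurable_continuous_onI,
        rule continuous_on_snd[OF continuous_on_id] continuous_on_fst[OF continuous_on_id])+
  let ?k = "\<lambda>x. ennreal (\<bar>snd (G (x, t))\<bar>\<^sup>2)" and ?g = "\<lambda>x. ennreal ((norm (fst (G (x, t))))\<^sup>2)"
    and ?p = "\<lambda>x. ennreal ((max (w (x, t)) 0) powr \<gamma>)"
  have "(\<integral>\<^sup>+x. ennreal (\<epsilon> * \<bar>snd (G (x, t))\<bar>\<^sup>2 + (norm (fst (G (x, t))))\<^sup>2) \<partial>lborel)
      = (\<integral>\<^sup>+x. ennreal \<epsilon> * ?k x + ?g x \<partial>lborel)"
    using assms by (intro nn_integral_cong, subst ennreal_plus) (simp_all add: ennreal_mult)
  also have "\<dots> = ennreal \<epsilon> * kinetic G t + (\<integral>\<^sup>+x. ?g x \<partial>lborel)"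
    unfolding kinetic_def by (subst nn_integral_add, measurable, subst nn_integral_cmult) measurable
  finally have 1: "(\<integral>\<^sup>+x. ennreal (\<epsilon> * \<bar>snd (G (x, t))\<bar>\<^sup>2 + (norm (fst (G (x, t))))\<^sup>2) \<partial>lborel)
      = ennreal \<epsilon> * kinetic G t + (\<integral>\<^sup>+x. ?g x \<partial>lborel)" .
  have "potential \<gamma> w G t = (\<integral>\<^sup>+x. ?g x + 2 * ?p x \<partial>lborel)"
    unfolding potential_def by (intro nn_integral_cong, subst ennreal_plus) (simp_all add: ennreal_mult)
  also have "\<dots> = (\<integral>\<^sup>+x. ?g x \<partial>lborel) + 2 * (\<integral>\<^sup>+x. ?p x \<partial>lborel)"
    by (subst nn_integral_add, measurable, subst nn_integral_cmult) measurable
  finally show ?thesis using 1 by (simp add: add.assoc)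
qed

lemma energy_eq:
  assumes u: "AE z in lebesgue. z \<in> spacetime \<longrightarrow> u z = w z"
    and wg: "AE z in lebesgue. z \<in> spacetime \<longrightarrow> weak_grad spacetime u z = G z" and "\<epsilon> > 0"
  shows "energy \<gamma> \<epsilon> u = (\<integral>\<^sup>+t\<in>{0<..}. ennreal (exp (- t / \<epsilon>) / \<epsilon>) * (ennreal \<epsilon> * kinetic G t + potential \<gamma> w G t) \<partial>lborel)"
proof -
  have "energy \<gamma> \<epsilon> u = (\<integral>\<^sup>+t\<in>{0<..}. ennreal (exp (- t / \<epsilon>) / \<epsilon>) * (ennreal \<epsilon> * kinetic G t + potential \<gamma> w G t) \<partial>lebesgue)"
    unfolding energy_def
  proof (rule nn_integral_cong_AE)
    show "AE t in lebesgue. ennreal (exp (- t / \<epsilon>) / \<epsilon>) *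
        ((\<integral>\<^sup>+x. ennreal (\<epsilon> * \<bar>deriv_t u (x, t)\<bar>\<^sup>2 + (norm (grad_x u (x, t)))\<^sup>2) \<partial>lebesgue)
         + 2 * (\<integral>\<^sup>+x. ennreal ((max (u (x, t)) 0) powr \<gamma>) \<partial>lebesgue)) * indicator {0<..} t
      = ennreal (exp (- t / \<epsilon>) / \<epsilon>) * (ennreal \<epsilon> * kinetic G t + potential \<gamma> w G t) * indicator {0<..} t"
      using slice_integrals[OF u wg, of \<gamma> \<epsilon>]
    proof eventually_elim
      case (elim t)
      then show ?case using slice_energy[OF \<open>\<epsilon> > 0\<close>, of t \<gamma>] by (cases "t > 0") auto
    qed
  qed
  then show ?thesis by (simp add: nn_integral_completion)
qed

lemma kinetic_integral_eq:
  assumes u: "AE z in lebesgue. z \<in> spacetime \<longrightarrow> u z = w z"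
    and wg: "AE z in lebesgue. z \<in> spacetime \<longrightarrow> weak_grad spacetime u z = G z" and A: "A \<subseteq> {0<..}"
  shows "(\<integral>\<^sup>+t\<in>A. (\<integral>\<^sup>+x. ennreal (\<bar>deriv_t u (x, t)\<bar>\<^sup>2) \<partial>lebesgue) \<partial>lebesgue) = (\<integral>\<^sup>+t\<in>A. kinetic G t \<partial>lborel)"
    and "(\<integral>\<^sup>+t\<in>A. (\<integral>\<^sup>+x. ennreal ((norm (grad_x u (x, t)))\<^sup>2 + 2 * (max (u (x, t)) 0) powr \<gamma>) \<partial>lebesgue) \<partial>lebesgue)
      = (\<integral>\<^sup>+t\<in>A. potential \<gamma> w G t \<partial>lborel)"
proof -
  have "(\<integral>\<^sup>+t\<in>A. f t \<partial>lebesgue) = (\<integral>\<^sup>+t\<in>A. g t \<partial>lborel)" if "AE t in lebesgue. t > 0 \<longrightarrow> f t = g t" for f g :: "real \<Rightarrow> ennreal"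
  proof -
    have "(\<integral>\<^sup>+t\<in>A. f t \<partial>lebesgue) = (\<integral>\<^sup>+t\<in>A. g t \<partial>lebesgue)"
      by (rule nn_integral_cong_AE, use that in eventually_elim) (use A in \<open>auto simp: indicator_def\<close>)
    then show ?thesis by (simp add: nn_integral_completion)
  qed
  note c = this
  show "(\<integral>\<^sup>+t\<in>A. (\<integral>\<^sup>+x. ennreal (\<bar>deriv_t u (x, t)\<bar>\<^sup>2) \<partial>lebesgue) \<partial>lebesgue) = (\<integral>\<^sup>+t\<in>A. kinetic G t \<partial>lborel)"
    by (rule c, use slice_integrals[OF u wg, of 1 1] in eventually_elim) blast
  show "(\<integral>\<^sup>+t\<in>A. (\<integral>\<^sup>+x. ennreal ((norm (grad_x u (x, t)))\<^sup>2 + 2 * (max (u (x, t)) 0) powr \<gamma>) \<partial>lebesgue) \<partial>lebesgue)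
      = (\<integral>\<^sup>+t\<in>A. potential \<gamma> w G t \<partial>lborel)"
    by (rule c, use slice_integrals[OF u wg, of \<gamma> 1] in eventually_elim) blast
qed

end

subsection \<open>Competitors\<close>

text \<open>An inequality only, because \<open>\<theta>\<close> maps \<open>{0..T}\<close> onto an
  interval that need not exhaust the line.\<close>

lemma substitution_bounded:
  fixes f :: "real \<Rightarrow> ennreal"
  assumes f[measurable]: "f \<in> borel_measurable borel" and d: "\<And>t. (\<theta> has_real_derivative \<theta>' t) (at t)"
    and c: "continuous_on UNIV \<theta>'" and p: "\<And>t. \<theta>' t > 0" and "T > 0"
  shows "(\<integral>\<^sup>+t\<in>{0..T}. f (\<theta> t) * ennreal (\<theta>' t) \<partial>lborel) \<le> (\<integral>\<^sup>+s. f s \<partial>lborel)"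
proof -
  have "(\<integral>\<^sup>+t. f (\<theta> t) * ennreal (\<theta>' t) * indicator {0..T} t \<partial>lborel) = (\<integral>\<^sup>+s. f s * indicator {\<theta> 0..\<theta> T} s \<partial>lborel)"
    by (rule nn_integral_substitution_aux[symmetric, OF f _ d])
      (use c p \<open>T > 0\<close> in \<open>auto intro: continuous_on_subset less_imp_le\<close>)
  also have "\<dots> \<le> (\<integral>\<^sup>+s. f s \<partial>lborel)" by (intro nn_integral_mono) (auto simp: indicator_def)
  finally show ?thesis .
qed

lemma nn_integral_Ioi_le:
  fixes f :: "real \<Rightarrow> ennreal"
  assumes [measurable]: "f \<in> borel_measurable borel"
    and b: "\<And>T. T > 0 \<Longrightarrow> (\<integral>\<^sup>+t\<in>{0<..T}. f t \<partial>lborel) \<le> E"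
  shows "(\<integral>\<^sup>+t\<in>{0<..}. f t \<partial>lborel) \<le> E"
proof -
  let ?g = "\<lambda>n t. f t * indicator {0<..real (Suc n)} t"
  have inc: "incseq ?g" by (intro incseq_SucI le_funI mult_left_mono) (auto simp: indicator_def)
  have "(SUP n. ?g n t) = f t * indicator {0<..} t" for t
  proof (rule LIMSEQ_unique[OF LIMSEQ_SUP])
    show "incseq (\<lambda>n. ?g n t)" using inc by (auto simp: incseq_def le_fun_def)
    obtain N where "t \<le> real N" using real_arch_simple by blast
    then show "(\<lambda>n. ?g n t) \<longlonglongrightarrow> f t * indicator {0<..} t"
      by (intro tendsto_eventually eventually_sequentiallyI[of N]) (auto simp: indicator_def)
  qed
  then have "(\<integral>\<^sup>+t\<in>{0<..}. f t \<partial>lborel) = (\<integral>\<^sup>+t. (SUP n. ?g n t) \<partial>lborel)" by simp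
  also have "\<dots> = (SUP n. \<integral>\<^sup>+t. ?g n t \<partial>lborel)"
    by (rule nn_integral_monotone_convergence_SUP[OF inc]) measurable
  also have "\<dots> \<le> E" by (intro SUP_least b) simp
  finally show ?thesis .
qed

text \<open>Bounded time intervals exhaust the half-line by monotone convergence. Cutting
  \<open>f\<close> off to positive arguments loses nothing, since \<open>\<theta>\<close> is
  positive at positive times, and it confines the right side to the half-line.\<close>

lemma substitution_pos:
  fixes f :: "real \<Rightarrow> ennreal"
  assumes f[measurable]: "f \<in> borel_measurable borel" and d: "\<And>t. (\<theta> has_real_derivative \<theta>' t) (at t)"
    and c: "continuous_on UNIV \<theta>'" and p: "\<And>t. \<theta>' t > 0"
    and pos: "\<And>t. t > 0 \<Longrightarrow> \<theta> t > 0"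
  shows "(\<integral>\<^sup>+t\<in>{0<..}. f (\<theta> t) * ennreal (\<theta>' t) \<partial>lborel) \<le> (\<integral>\<^sup>+s\<in>{0<..}. f s \<partial>lborel)"
proof -
  have [measurable]: "\<theta> \<in> borel_measurable borel"
    by (intro borel_measurable_continuous_onI continuous_at_imp_continuous_on ballI DERIV_isCont[OF d])
  have [measurable]: "\<theta>' \<in> borel_measurable borel" by (rule borel_measurable_continuous_onI[OF c])
  show ?thesis
  proof (rule nn_integral_Ioi_le)
    fix T :: real assume T: "T > 0"
    have "(\<integral>\<^sup>+t\<in>{0<..T}. f (\<theta> t) * ennreal (\<theta>' t) \<partial>lborel)
        \<le> (\<integral>\<^sup>+t\<in>{0..T}. (f (\<theta> t) * indicator {0<..} (\<theta> t)) * ennreal (\<theta>' t) \<partial>lborel)"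
      using pos by (intro nn_integral_mono) (auto simp: indicator_def)
    also have "\<dots> \<le> (\<integral>\<^sup>+s\<in>{0<..}. f s \<partial>lborel)"
      by (rule substitution_bounded[OF _ d c p T]) measurable
    finally show "(\<integral>\<^sup>+t\<in>{0<..T}. f (\<theta> t) * ennreal (\<theta>' t) \<partial>lborel) \<le> (\<integral>\<^sup>+s\<in>{0<..}. f s \<partial>lborel)" .
  qed measurable
qed

lemma nn_integral_Q_plus:
  fixes F :: "'a::euclidean_space \<times> real \<Rightarrow> ennreal"
  assumes F: "F \<in> borel_measurable borel"
  shows "(\<integral>\<^sup>+z\<in>Q_plus r. F z \<partial>lebesgue)
    = (\<integral>\<^sup>+x\<in>ball 0 r. (\<integral>\<^sup>+t\<in>{0<..<r\<^sup>2}. F (x, t) \<partial>lborel) \<partial>lborel)"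
proof -
  have [measurable]: "F \<in> borel_measurable (borel \<Otimes>\<^sub>M borel)" using F by (simp add: borel_prod)
  have Fx[measurable]: "(\<lambda>t. F (x, t)) \<in> borel_measurable borel" for x by measurable
  have m: "(\<lambda>z. F z * indicator (Q_plus r) z) \<in> borel_measurable (lborel \<Otimes>\<^sub>M lborel)"
    unfolding lborel_prod using F by (intro borel_measurable_times_ennreal borel_measurable_indicator)
      (simp_all add: borel_open open_Q_plus)
  have "(\<integral>\<^sup>+z\<in>Q_plus r. F z \<partial>lebesgue) = (\<integral>\<^sup>+z. F z * indicator (Q_plus r) z \<partial>(lborel \<Otimes>\<^sub>M lborel))"
    by (simp add: nn_integral_completion lborel_prod)
  also have "\<dots> = (\<integral>\<^sup>+x. \<integral>\<^sup>+t. F (x, t) * indicator (Q_plus r) (x, t) \<partial>lborel \<partial>lborel)"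
    using lborel.nn_integral_fst[OF m] by simp
  also have "\<dots> = (\<integral>\<^sup>+x\<in>ball 0 r. (\<integral>\<^sup>+t\<in>{0<..<r\<^sup>2}. F (x, t) \<partial>lborel) \<partial>lborel)"
  proof (rule nn_integral_cong)
    fix x :: 'a
    have "(\<integral>\<^sup>+t. F (x, t) * indicator (Q_plus r) (x, t) \<partial>lborel)
        = (\<integral>\<^sup>+t. (F (x, t) * indicator {0<..<r\<^sup>2} t) * indicator (ball 0 r) x \<partial>lborel)"
      by (intro nn_integral_cong) (auto simp: Q_plus_def indicator_def)
    also have "\<dots> = (\<integral>\<^sup>+t\<in>{0<..<r\<^sup>2}. F (x, t) \<partial>lborel) * indicator (ball 0 r) x"
      by (rule nn_integral_multc) measurable
    finally show "(\<integral>\<^sup>+t. F (x, t) * indicator (Q_plus r) (x, t) \<partial>lborel)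
        = (\<integral>\<^sup>+t\<in>{0<..<r\<^sup>2}. F (x, t) \<partial>lborel) * indicator (ball 0 r) x" .
  qed
  finally show ?thesis .
qed

definition time_map :: "(real \<Rightarrow> real) \<Rightarrow> 'a \<times> real \<Rightarrow> 'a \<times> real" where
  "time_map \<theta> z = (fst z, \<theta> (snd z))"

context
  fixes \<theta> \<theta>' :: "real \<Rightarrow> real"
  assumes d: "\<And>t. (\<theta> has_real_derivative \<theta>' t) (at t)"
    and c: "continuous_on UNIV \<theta>'" and p: "\<And>t. \<theta>' t > 0"
    and pos: "\<And>t. t > 0 \<Longrightarrow> \<theta> t > 0" and le: "\<And>t. t > 0 \<Longrightarrow> \<theta> t \<le> t"
begin

lemma time_map_measurable: "time_map \<theta> \<in> borel_measurable (borel :: ('a::euclidean_space \<times> real) measure)"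
proof -
  have "continuous_on UNIV \<theta>"
    by (intro continuous_at_imp_continuous_on ballI DERIV_isCont[OF d])
  then have "continuous_on UNIV (time_map \<theta> :: 'a \<times> real \<Rightarrow> _)"
    unfolding time_map_def
    by (intro continuous_on_Pair[OF continuous_on_fst[OF continuous_on_id]
          continuous_on_compose2[OF _ continuous_on_snd[OF continuous_on_id]]]) auto
  then show ?thesis by (rule borel_measurable_continuous_onI)
qed

text \<open>From 0 < \<theta>(t) \<le> t the cylinder is mapped into itself, which is what the
  condition \<theta>(t) \<le> t is for. The Jacobian is at least \<open>\<kappa>\<close> on the
  height of the cylinder, and dividing by it costs the constant.\<close>

lemma nn_integral_time_map_le:
  fixes F :: "'a::euclidean_space \<times> real \<Rightarrow> ennreal"
  assumes F: "F \<in> borel_measurable borel" and "r > 0"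
    and \<kappa>: "\<kappa> > 0" "\<And>t. t \<in> {0..r\<^sup>2} \<Longrightarrow> \<kappa> \<le> \<theta>' t"
  shows "(\<integral>\<^sup>+z\<in>Q_plus r. F (time_map \<theta> z) \<partial>lebesgue) \<le> ennreal (1 / \<kappa>) * (\<integral>\<^sup>+z\<in>Q_plus r. F z \<partial>lebesgue)"
proof -
  have [measurable]: "F \<in> borel_measurable (borel \<Otimes>\<^sub>M borel)" using F by (simp add: borel_prod)
  have Fx[measurable]: "(\<lambda>t. F (x, t)) \<in> borel_measurable borel" for x by measurable
  have [measurable]: "\<theta>' \<in> borel_measurable borel" by (rule borel_measurable_continuous_onI[OF c])
  have [measurable]: "\<theta> \<in> borel_measurable borel"
    by (intro borel_measurable_continuous_onI continuous_at_imp_continuous_on ballI DERIV_isCont[OF d])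
  have "(\<integral>\<^sup>+t\<in>{0<..<r\<^sup>2}. F (x, \<theta> t) \<partial>lborel) \<le> ennreal (1 / \<kappa>) * (\<integral>\<^sup>+t\<in>{0<..<r\<^sup>2}. F (x, t) \<partial>lborel)" for x
  proof -
    have "(\<integral>\<^sup>+t\<in>{0<..<r\<^sup>2}. F (x, \<theta> t) \<partial>lborel)
      \<le> (\<integral>\<^sup>+t. ennreal (1 / \<kappa>) * ((F (x, \<theta> t) * indicator {0<..<r\<^sup>2} (\<theta> t)) * ennreal (\<theta>' t) * indicator {0..r\<^sup>2} t) \<partial>lborel)"
    proof (rule nn_integral_mono)
      fix t
      show "F (x, \<theta> t) * indicator {0<..<r\<^sup>2} t
        \<le> ennreal (1 / \<kappa>) * ((F (x, \<theta> t) * indicator {0<..<r\<^sup>2} (\<theta> t)) * ennreal (\<theta>' t) * indicator {0..r\<^sup>2} t)"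
      proof (cases "0 < t \<and> t < r\<^sup>2")
        case True
        then have i: "\<theta> t \<in> {0<..<r\<^sup>2}" using pos[of t] le[of t] by auto
        have "1 \<le> 1 / \<kappa> * \<theta>' t" using \<kappa>(1) \<kappa>(2)[of t] True by (simp add: field_simps)
        then have "1 \<le> ennreal (1 / \<kappa>) * ennreal (\<theta>' t)"
          using \<kappa>(1) p[of t] by (subst ennreal_mult[symmetric]) (auto simp: less_imp_le)
        from mult_left_mono[OF this, of "F (x, \<theta> t)"] show ?thesis
          using True i by (simp add: mult_ac)
      qed (auto simp: indicator_def)
    qed
    also have "\<dots> = ennreal (1 / \<kappa>) * (\<integral>\<^sup>+t. (F (x, \<theta> t) * indicator {0<..<r\<^sup>2} (\<theta> t)) * ennreal (\<theta>' t) * indicator {0..r\<^sup>2} t \<partial>lborel)"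
      by (rule nn_integral_cmult) measurable
    also have "\<dots> \<le> ennreal (1 / \<kappa>) * (\<integral>\<^sup>+t\<in>{0<..<r\<^sup>2}. F (x, t) \<partial>lborel)"
      by (intro mult_left_mono substitution_bounded[OF _ d c p]) (use \<open>r > 0\<close> in auto)
    finally show ?thesis .
  qed
  note 1 = this
  have m: "(\<lambda>x. \<integral>\<^sup>+t\<in>{0<..<r\<^sup>2}. F (x, t) \<partial>lborel) \<in> borel_measurable borel"
    by (rule lborel.borel_measurable_nn_integral) measurable
  have "(\<integral>\<^sup>+z\<in>Q_plus r. F (time_map \<theta> z) \<partial>lebesgue) = (\<integral>\<^sup>+x\<in>ball 0 r. (\<integral>\<^sup>+t\<in>{0<..<r\<^sup>2}. F (x, \<theta> t) \<partial>lborel) \<partial>lborel)"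
    using nn_integral_Q_plus[OF measurable_compose[OF time_map_measurable F], of r] by (simp add: time_map_def)
  also have "\<dots> \<le> (\<integral>\<^sup>+x. ennreal (1 / \<kappa>) * ((\<integral>\<^sup>+t\<in>{0<..<r\<^sup>2}. F (x, t) \<partial>lborel) * indicator (ball 0 r) x) \<partial>lborel)"
    using 1 by (intro nn_integral_mono) (simp add: indicator_def)
  also have "\<dots> = ennreal (1 / \<kappa>) * (\<integral>\<^sup>+z\<in>Q_plus r. F z \<partial>lebesgue)"
    unfolding nn_integral_Q_plus[OF F] using m by (intro nn_integral_cmult) measurable
  finally show ?thesis .
qed

lemma time_map_smooth:
  fixes \<phi> :: "'a::euclidean_space \<times> real \<Rightarrow> real"
  assumes \<phi>: "smooth \<phi>" and s\<theta>: "smooth \<theta>"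
  shows "smooth (\<lambda>z. \<phi> (time_map \<theta> z))"
    and "gradc (\<lambda>z. \<phi> (time_map \<theta> z)) z
      = (fst (gradc \<phi> (time_map \<theta> z)), \<theta>' (snd z) * snd (gradc \<phi> (time_map \<theta> z)))"
proof -
  show "smooth (\<lambda>z. \<phi> (time_map \<theta> z))"
  proof (rule smooth_compose[OF \<phi>])
    fix b :: "'a \<times> real" assume b: "b \<in> Basis"
    have "smooth (\<lambda>z :: 'a \<times> real. \<theta> (snd z))"
      by (rule smooth_compose[OF s\<theta>])
        (auto intro!: smooth_bounded_linear bounded_linear_mult_const bounded_linear_snd)
    moreover have "smooth (\<lambda>z :: 'a \<times> real. fst z \<bullet> fst b)"
      by (intro smooth_bounded_linear bounded_linear_inner_left_comp bounded_linear_fst)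
    ultimately show "smooth (\<lambda>z. time_map \<theta> z \<bullet> b)"
      unfolding time_map_def inner_prod_def fst_conv snd_conv inner_real_def
      by (intro smooth_add smooth_mult smooth_const)
  qed
  have dt: "((\<lambda>z :: 'a \<times> real. \<theta> (snd z)) has_derivative (\<lambda>v. \<theta>' (snd z) * snd v)) (at z)" for z
    by (rule has_derivative_compose[OF has_derivative_snd[OF has_derivative_ident] d[unfolded has_field_derivative_def]])
  have "(time_map \<theta> has_derivative (\<lambda>v. (fst v, \<theta>' (snd z) * snd v))) (at z)"
    unfolding time_map_def[abs_def] by (intro has_derivative_Pair dt has_derivative_fst has_derivative_ident)
  note frechet_derivative_at[OF has_derivative_compose[OF this smooth_has_derivative[OF \<phi>]]]
  from fun_cong[OF this] have D: "frechet_derivative (\<lambda>z. \<phi> (time_map \<theta> z)) (at z) v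
      = frechet_derivative \<phi> (at (time_map \<theta> z)) (fst v, \<theta>' (snd z) * snd v)" for v
    by simp
  show "gradc (\<lambda>z. \<phi> (time_map \<theta> z)) z
      = (fst (gradc \<phi> (time_map \<theta> z)), \<theta>' (snd z) * snd (gradc \<phi> (time_map \<theta> z)))"
  proof (rule euclidean_eqI)
    fix b :: "'a \<times> real" assume b: "b \<in> Basis"
    interpret linear "frechet_derivative \<phi> (at (time_map \<theta> z))"
      by (rule has_derivative_linear[OF smooth_has_derivative[OF \<phi>]])
    consider i where "b = (i, 0)" "i \<in> Basis" | "b = (0, 1)" using b by (auto simp: Basis_prod_def)
    then show "gradc (\<lambda>z. \<phi> (time_map \<theta> z)) z \<bullet> b
      = (fst (gradc \<phi> (time_map \<theta> z)), \<theta>' (snd z) * snd (gradc \<phi> (time_map \<theta> z))) \<bullet> b"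
    proof cases
      case 1
      have "gradc \<phi> (time_map \<theta> z) \<bullet> b = fst (gradc \<phi> (time_map \<theta> z)) \<bullet> i"
        by (simp add: 1 inner_prod_def)
      then show ?thesis unfolding gradc_inner[OF b] D by (simp add: 1)
    next
      case 2
      have "gradc \<phi> (time_map \<theta> z) \<bullet> b = snd (gradc \<phi> (time_map \<theta> z))"
        by (simp add: 2 inner_prod_def)
      moreover have "frechet_derivative \<phi> (at (time_map \<theta> z)) (0, \<theta>' (snd z))
          = \<theta>' (snd z) * frechet_derivative \<phi> (at (time_map \<theta> z)) (0, 1)"
        using scale[of "\<theta>' (snd z)" "(0, 1)"] by simp
      ultimately show ?thesis unfolding gradc_inner[OF b] D by (simp add: 2)
    qed
  qed
qed

text \<open>The approximants of \<open>w\<close> are composed with the time change. On the finite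
  height of the cylinder \<open>\<theta>'\<close> has a positive minimum, which controls the change
  of variables, and a maximum, which controls the chain rule factor; \<open>\<theta> 0 = 0\<close>
  leaves the trace untouched.\<close>

lemma smoothly_approximable_time_map:
  assumes a: "smoothly_approximable w G u0" and s\<theta>: "smooth \<theta>" and \<theta>0: "\<theta> 0 = 0"
  shows "smoothly_approximable (\<lambda>z. w (time_map \<theta> z))
    (\<lambda>z. (fst (G (time_map \<theta> z)), \<theta>' (snd z) * snd (G (time_map \<theta> z)))) u0"
proof -
  have w: "w \<in> borel_measurable borel" and G: "G \<in> borel_measurable borel"
    using a by (auto simp: smoothly_approximable_def)
  have GT: "(\<lambda>z. G (time_map \<theta> z)) \<in> borel_measurable borel"
    by (rule measurable_compose[OF time_map_measurable G])
  show ?thesis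
    unfolding smoothly_approximable_def
  proof (intro conjI allI impI)
    show "(\<lambda>z. w (time_map \<theta> z)) \<in> borel_measurable borel"
      by (rule measurable_compose[OF time_map_measurable w])
    have "continuous_on UNIV (\<lambda>y :: ('a \<times> real) \<times> ('a \<times> real). \<theta>' (snd (snd y)))"
      by (rule continuous_on_compose2[OF c continuous_on_snd[OF continuous_on_snd[OF continuous_on_id]]]) simp
    then have "continuous_on UNIV (\<lambda>y :: ('a \<times> real) \<times> ('a \<times> real). (fst (fst y), \<theta>' (snd (snd y)) * snd (fst y)))"
      by (intro continuous_intros)
    then have "(\<lambda>y :: ('a \<times> real) \<times> ('a \<times> real). (fst (fst y), \<theta>' (snd (snd y)) * snd (fst y))) \<in> borel_measurable (borel \<Otimes>\<^sub>M borel)"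
      unfolding borel_prod by (rule borel_measurable_continuous_onI)
    from measurable_compose[OF measurable_Pair[OF GT measurable_ident_sets[OF refl]] this]
    show "(\<lambda>z. (fst (G (time_map \<theta> z)), \<theta>' (snd z) * snd (G (time_map \<theta> z)))) \<in> borel_measurable borel"
      by simp
    fix r :: real assume r: "r > 0"
    obtain \<phi> where s: "\<And>k::nat. smooth (\<phi> k)"
      and lw: "(\<lambda>k. L2_normsq (Q_plus r) (\<lambda>z. \<phi> k z - w z)) \<longlonglongrightarrow> 0"
      and lG: "(\<lambda>k. L2_normsq (Q_plus r) (\<lambda>z. gradc (\<phi> k) z - G z)) \<longlonglongrightarrow> 0"
      and l0: "(\<lambda>k. L2_normsq (ball 0 r) (\<lambda>x. \<phi> k (x, 0) - u0 x)) \<longlonglongrightarrow> 0"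
      using a r unfolding smoothly_approximable_def by meson
    have cT: "continuous_on {0..r\<^sup>2} \<theta>'" using c by (rule continuous_on_subset) auto
    obtain t0 where t0: "t0 \<in> {0..r\<^sup>2}" "\<And>t. t \<in> {0..r\<^sup>2} \<Longrightarrow> \<theta>' t0 \<le> \<theta>' t"
      using continuous_attains_inf[OF compact_Icc _ cT] by auto
    obtain t1 where t1: "t1 \<in> {0..r\<^sup>2}" "\<And>t. t \<in> {0..r\<^sup>2} \<Longrightarrow> \<theta>' t \<le> \<theta>' t1"
      using continuous_attains_sup[OF compact_Icc _ cT] by auto
    define \<kappa> where "\<kappa> = \<theta>' t0"
    \<comment> \<open>At least 1, since the spatial part of the gradient is not multiplied by
      \<open>\<theta>'\<close>.\<close>
    define M where "M = max 1 (\<theta>' t1)"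
    have \<kappa>: "\<kappa> > 0" "\<And>t. t \<in> {0..r\<^sup>2} \<Longrightarrow> \<kappa> \<le> \<theta>' t" using t0 p by (auto simp: \<kappa>_def)
    have M: "M \<ge> 1" "\<And>t. t \<in> {0..r\<^sup>2} \<Longrightarrow> \<theta>' t \<le> M"
      unfolding M_def using t1(2) by (simp, blast intro: max.coboundedI2)
    have T: "L2_normsq (Q_plus r) (\<lambda>z. f (time_map \<theta> z)) \<le> ennreal (1 / \<kappa>) * L2_normsq (Q_plus r) f"
      if f: "f \<in> borel_measurable borel" for f :: "'a \<times> real \<Rightarrow> 'b::euclidean_space"
    proof -
      have "(\<lambda>z. ennreal ((norm (f z))\<^sup>2)) \<in> borel_measurable borel" using f by measurable
      from nn_integral_time_map_le[OF this r \<kappa>] show ?thesis by (simp add: L2_normsq_def)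
    qed
    have tz: "(\<lambda>k. ennreal q * X k) \<longlonglongrightarrow> 0" if "X \<longlonglongrightarrow> 0" for q and X :: "nat \<Rightarrow> ennreal"
      using ennreal_tendsto_cmult[OF _ that, of "ennreal q"] by simp
    have 1: "(\<lambda>k. L2_normsq (Q_plus r) (\<lambda>z. \<phi> k (time_map \<theta> z) - w (time_map \<theta> z))) \<longlonglongrightarrow> 0"
    proof (rule tendsto_sandwich[OF _ _ tendsto_const tz[OF lw, of "1 / \<kappa>"]])
      have "(\<lambda>z. \<phi> k z - w z) \<in> borel_measurable borel" for k
        using w borel_measurable_continuous_onI[OF smooth_continuous[OF s]] by measurable
      from T[OF this] show "\<forall>\<^sub>F k in sequentially. L2_normsq (Q_plus r) (\<lambda>z. \<phi> k (time_map \<theta> z) - w (time_map \<theta> z))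
        \<le> ennreal (1 / \<kappa>) * L2_normsq (Q_plus r) (\<lambda>z. \<phi> k z - w z)" by simp
    qed simp
    have 2: "(\<lambda>k. L2_normsq (Q_plus r) (\<lambda>z. gradc (\<lambda>z. \<phi> k (time_map \<theta> z)) z
        - (fst (G (time_map \<theta> z)), \<theta>' (snd z) * snd (G (time_map \<theta> z))))) \<longlonglongrightarrow> 0"
    proof (rule tendsto_sandwich[OF _ _ tendsto_const tz[OF lG, of "1 / \<kappa> * M\<^sup>2"]])
      have "L2_normsq (Q_plus r) (\<lambda>z. gradc (\<lambda>z. \<phi> k (time_map \<theta> z)) z
        - (fst (G (time_map \<theta> z)), \<theta>' (snd z) * snd (G (time_map \<theta> z))))
        \<le> ennreal (1 / \<kappa> * M\<^sup>2) * L2_normsq (Q_plus r) (\<lambda>z. gradc (\<phi> k) z - G z)" for k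
      proof -
        have "L2_normsq (Q_plus r) (\<lambda>z. gradc (\<lambda>z. \<phi> k (time_map \<theta> z)) z
          - (fst (G (time_map \<theta> z)), \<theta>' (snd z) * snd (G (time_map \<theta> z))))
          \<le> L2_normsq (Q_plus r) (\<lambda>z. M *\<^sub>R (gradc (\<phi> k) (time_map \<theta> z) - G (time_map \<theta> z)))"
        proof (rule L2_normsq_mono)
          fix z :: "'a \<times> real" assume z: "z \<in> Q_plus r"
          define D where "D = gradc (\<phi> k) (time_map \<theta> z) - G (time_map \<theta> z)"
          have "gradc (\<lambda>z. \<phi> k (time_map \<theta> z)) z - (fst (G (time_map \<theta> z)), \<theta>' (snd z) * snd (G (time_map \<theta> z)))
              = (fst D, \<theta>' (snd z) * snd D)"
            unfolding time_map_smooth(2)[OF s s\<theta>] D_def by (simp add: prod_eq_iff algebra_simps)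
          moreover have "norm (fst D, \<theta>' (snd z) * snd D) \<le> norm (M *\<^sub>R D)"
          proof -
            have th: "\<theta>' (snd z) \<le> M" "\<theta>' (snd z) > 0" using M(2)[of "snd z"] p z by (auto simp: Q_plus_def)
            have "norm (fst D, \<theta>' (snd z) * snd D) = sqrt ((1 * norm (fst D))\<^sup>2 + (\<theta>' (snd z) * \<bar>snd D\<bar>)\<^sup>2)"
              using th by (simp add: norm_Pair abs_mult)
            also have "\<dots> \<le> sqrt ((M * norm (fst D))\<^sup>2 + (M * \<bar>snd D\<bar>)\<^sup>2)"
              using th M(1) by (intro real_sqrt_le_mono add_mono power_mono mult_right_mono) auto
            also have "\<dots> = norm (M *\<^sub>R D)"
              using M(1) by (cases D) (simp add: norm_Pair abs_mult)
            finally show ?thesis .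
          qed
          ultimately show "norm (gradc (\<lambda>z. \<phi> k (time_map \<theta> z)) z - (fst (G (time_map \<theta> z)), \<theta>' (snd z) * snd (G (time_map \<theta> z))))
            \<le> norm (M *\<^sub>R (gradc (\<phi> k) (time_map \<theta> z) - G (time_map \<theta> z)))" by (simp add: D_def)
        qed
        also have "\<dots> \<le> ennreal (1 / \<kappa>) * L2_normsq (Q_plus r) (\<lambda>z. M *\<^sub>R (gradc (\<phi> k) z - G z))"
          by (rule T) (use G borel_measurable_continuous_onI[OF gradc_continuous[OF s[of k]]] in measurable)
        also have "L2_normsq (Q_plus r) (\<lambda>z. M *\<^sub>R (gradc (\<phi> k) z - G z))
          = (\<integral>\<^sup>+z. ennreal (M\<^sup>2) * (ennreal ((norm (gradc (\<phi> k) z - G z))\<^sup>2) * indicator (Q_plus r) z) \<partial>lebesgue)"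
          unfolding L2_normsq_def
          by (intro nn_integral_cong) (simp add: power_mult_distrib ennreal_mult mult.assoc)
        also have "\<dots> = ennreal (M\<^sup>2) * L2_normsq (Q_plus r) (\<lambda>z. gradc (\<phi> k) z - G z)"
        proof -
          have "(\<lambda>z. ennreal ((norm (gradc (\<phi> k) z - G z))\<^sup>2)) \<in> borel_measurable lebesgue"
            by (rule borel_measurable_lebesgueI)
              (use G borel_measurable_continuous_onI[OF gradc_continuous[OF s[of k]]] in measurable)
          then show ?thesis unfolding L2_normsq_def
            by (intro nn_integral_cmult borel_measurable_times_ennreal borel_measurable_indicator Q_plus_lebesgue)
        qed
        finally show ?thesis using \<kappa>(1) by (simp add: ennreal_mult mult.assoc del: times_divide_eq_left)
      qed
      then show "\<forall>\<^sub>F k in sequentially. L2_normsq (Q_plus r) (\<lambda>z. gradc (\<lambda>z. \<phi> k (time_map \<theta> z)) z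
        - (fst (G (time_map \<theta> z)), \<theta>' (snd z) * snd (G (time_map \<theta> z))))
        \<le> ennreal (1 / \<kappa> * M\<^sup>2) * L2_normsq (Q_plus r) (\<lambda>z. gradc (\<phi> k) z - G z)" by simp
    qed simp
    have 3: "(\<lambda>k. L2_normsq (ball 0 r) (\<lambda>x. \<phi> k (time_map \<theta> (x, 0)) - u0 x)) \<longlonglongrightarrow> 0"
      using l0 by (simp add: time_map_def \<theta>0)
    show "\<exists>\<phi>. (\<forall>k::nat. smooth (\<phi> k)) \<and>
       (\<lambda>k. L2_normsq (Q_plus r) (\<lambda>z. \<phi> k z - w (time_map \<theta> z))) \<longlonglongrightarrow> 0 \<and>
       (\<lambda>k. L2_normsq (Q_plus r) (\<lambda>z. gradc (\<phi> k) z - (fst (G (time_map \<theta> z)), \<theta>' (snd z) * snd (G (time_map \<theta> z))))) \<longlonglongrightarrow> 0 \<and>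
       (\<lambda>k. L2_normsq (ball 0 r) (\<lambda>x. \<phi> k (x, 0) - u0 x)) \<longlonglongrightarrow> 0"
      by (rule exI[of _ "\<lambda>k z. \<phi> k (time_map \<theta> z)"]) (intro conjI allI time_map_smooth(1)[OF s s\<theta>] 1 2 3)
  qed
qed

end

section \<open>The time-independent competitor\<close>

lemma H1_representative:
  assumes "u0 \<in> H1 (UNIV :: 'a::euclidean_space set)"
  shows "\<exists>v G. v \<in> borel_measurable borel \<and> G \<in> borel_measurable borel \<and>
    (AE x in lebesgue. u0 x = v x) \<and> is_weak_gradient UNIV v G \<and>
    L2_normsq UNIV v < \<infinity> \<and> L2_normsq UNIV G < \<infinity>"
proof -
  obtain G' where G': "u0 \<in> Lp 2 UNIV" "G' \<in> Lp 2 UNIV" "is_weak_gradient UNIV u0 G'"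
    using assms by (auto simp: H1_def)
  have "u0 \<in> borel_measurable lebesgue" "G' \<in> borel_measurable lebesgue"
    using G'(1,2) by (auto simp: Lp_def lebesgue_on_UNIV_eq)
  then obtain v G where v: "v \<in> borel_measurable borel" "AE x in lebesgue. u0 x = v x"
    and G: "G \<in> borel_measurable borel" "AE x in lebesgue. G' x = G x"
    using borel_version[of u0] borel_version[of G'] by blast
  have vU: "AE x in lebesgue. x \<in> UNIV \<longrightarrow> u0 x = v x" and GU: "AE x in lebesgue. x \<in> UNIV \<longrightarrow> G' x = G x"
    using v(2) G(2) by auto
  have "locally_integrable UNIV u0" "locally_integrable UNIV G'"
    using G'(3) by (auto simp: is_weak_gradient_def)
  then have "is_weak_gradient UNIV v G"
    by (intro is_weak_gradient_cong_AE[OF G'(3) vU _ GU] locally_integrable_cong_AE[OF _ vU v(1)]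
        locally_integrable_cong_AE[OF _ GU G(1)])
  moreover have "L2_normsq UNIV v = L2_normsq UNIV u0"
    by (rule L2_normsq_cong_AE, use v(2) in eventually_elim) simp
  moreover have "L2_normsq UNIV G = L2_normsq UNIV G'"
    by (rule L2_normsq_cong_AE, use G(2) in eventually_elim) simp
  moreover have "L2_normsq UNIV u0 < \<infinity>" "L2_normsq UNIV G' < \<infinity>"
    using G'(1,2) Lp2_iff[of "UNIV :: 'a set" u0] Lp2_iff[of "UNIV :: 'a set" G'] by auto
  ultimately show ?thesis using v G by (intro exI[of _ v] exI[of _ G]) simp
qed

text \<open>The derivative falls on the kernel, which makes the convolution a test of
  \<open>v\<close> against a reflected kernel. The sign from the reflection cancels the sign in the
  definition of the weak gradient.\<close>

lemma conv_weak_gradient: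
  fixes v :: "'a::euclidean_space \<Rightarrow> real"
  assumes v: "loc_int v" and wg: "is_weak_gradient UNIV v G" and G: "G \<in> borel_measurable borel"
    and m: "mollifier d \<eta>" and b: "b \<in> Basis"
  shows "frechet_derivative (conv v \<eta>) (at x) b = conv (\<lambda>y. G y \<bullet> b) \<eta> x"
proof -
  have sm: "smooth \<eta>" and sup: "\<And>x. d < norm x \<Longrightarrow> \<eta> x = 0" using m by (auto simp: mollifier_def)
  have [measurable]: "v \<in> borel_measurable borel" using v by (simp add: loc_int_def)
  have [measurable]: "\<eta> \<in> borel_measurable borel" "(\<lambda>z. frechet_derivative \<eta> (at z) b) \<in> borel_measurable borel"
    by (intro borel_measurable_continuous_onI smooth_continuous smooth_derivative sm)+
  note [measurable] = G
  have "frechet_derivative (conv v \<eta>) (at x) b = conv v (\<lambda>z. frechet_derivative \<eta> (at z) b) x"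
    by (rule fun_cong[OF frechet_derivative_at[OF conv_has_derivative[OF v sm sup]], symmetric])
  also have "\<dots> = (\<integral>y. v y * frechet_derivative \<eta> (at (x - y)) b \<partial>lebesgue)"
    unfolding conv_def by (rule integral_completion[symmetric]) measurable
  also have "\<dots> = - (\<integral>y. v y * frechet_derivative (\<lambda>y. \<eta> (x - y)) (at y) b \<partial>lebesgue)"
    by (simp add: test_function_kernel(2)[OF sm sup subset_UNIV])
  also have "\<dots> = (\<integral>y. (G y \<bullet> b) * \<eta> (x - y) \<partial>lebesgue)"
    using is_weak_gradientD[OF wg test_function_kernel(1)[OF sm sup subset_UNIV] b] by simp
  also have "\<dots> = conv (\<lambda>y. G y \<bullet> b) \<eta> x"
    unfolding conv_def by (rule integral_completion) measurable
  finally show ?thesis .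
qed

text \<open>One kernel finer than the thresholds for \<open>v\<close> and for all components of
  \<open>G\<close> does everything, because the gradient of the mollified function is the mollified
  gradient. Summing the squared components produces the dimension.\<close>

lemma smooth_approximation:
  fixes v :: "'a::euclidean_space \<Rightarrow> real" and e :: real
  assumes v[measurable]: "v \<in> borel_measurable borel" and G[measurable]: "G \<in> borel_measurable borel"
    and wg: "is_weak_gradient UNIV v G"
    and fin: "L2_normsq UNIV v < \<infinity>" "L2_normsq UNIV G < \<infinity>" and "e > 0"
  shows "\<exists>\<psi>. smooth \<psi> \<and> L2_normsq (ball 0 r) (\<lambda>x. \<psi> x - v x) \<le> ennreal e \<and>
    L2_normsq (ball 0 r) (\<lambda>x. gradc \<psi> x - G x) \<le> ennreal (DIM('a) * e)"
proof -
  have L2: "(\<integral>\<^sup>+x\<in>ball 0 R. ennreal (\<bar>f x\<bar> ^ 2) \<partial>lborel) = L2_normsq (ball 0 R) f" for R and f :: "'a \<Rightarrow> real"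
    by (simp add: L2_normsq_def nn_integral_completion)
  have finv: "(\<integral>\<^sup>+x\<in>ball 0 R. ennreal (\<bar>v x\<bar> ^ 2) \<partial>lborel) < \<infinity>" for R
    unfolding L2 using L2_normsq_mono_set[OF subset_UNIV, of "ball 0 R" v] fin(1) by (rule le_less_trans)
  have finG: "(\<integral>\<^sup>+x\<in>ball 0 R. ennreal (\<bar>G x \<bullet> b\<bar> ^ 2) \<partial>lborel) < \<infinity>" if "b \<in> Basis" for R b
  proof -
    have "L2_normsq (ball 0 R) (\<lambda>x. G x \<bullet> b) \<le> L2_normsq (ball 0 R) G"
      by (rule L2_normsq_mono) (simp add: Basis_le_norm[OF that])
    also have "\<dots> \<le> L2_normsq UNIV G" by (rule L2_normsq_mono_set) simp
    finally show ?thesis unfolding L2 using fin(2) by (rule le_less_trans)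
  qed
  have li: "loc_int v" by (rule Lp_imp_loc_int[of 2, OF _ v finv]) simp
  obtain s where s: "s > 0" "\<And>d \<eta>. d \<le> s \<Longrightarrow> mollifier d \<eta> \<Longrightarrow>
      (\<integral>\<^sup>+x\<in>ball 0 r. ennreal (\<bar>conv v \<eta> x - v x\<bar> ^ 2) \<partial>lborel) \<le> ennreal e"
    using mollify_Lp[of 2 v e r] v finv \<open>e > 0\<close> by auto
  have "\<exists>s>0. \<forall>d \<eta>. d \<le> s \<and> mollifier d \<eta> \<longrightarrow>
      (\<integral>\<^sup>+x\<in>ball 0 r. ennreal (\<bar>conv (\<lambda>y. G y \<bullet> b) \<eta> x - G x \<bullet> b\<bar> ^ 2) \<partial>lborel) \<le> ennreal e"
    if "b \<in> Basis" for b
  proof (rule mollify_Lp)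
    show "(\<integral>\<^sup>+x\<in>ball 0 R. ennreal (\<bar>G x \<bullet> b\<bar> ^ 2) \<partial>lborel) < \<infinity>" for R by (rule finG[OF that])
  qed (use \<open>e > 0\<close> in auto)
  then have "\<forall>b\<in>Basis. \<exists>s>0. \<forall>d \<eta>. d \<le> s \<and> mollifier d \<eta> \<longrightarrow>
      (\<integral>\<^sup>+x\<in>ball 0 r. ennreal (\<bar>conv (\<lambda>y. G y \<bullet> b) \<eta> x - G x \<bullet> b\<bar> ^ 2) \<partial>lborel) \<le> ennreal e" by blast
  from bchoice[OF this] obtain \<sigma> where \<sigma>: "\<And>b. b \<in> Basis \<Longrightarrow> \<sigma> b > 0" "\<And>b d \<eta>. b \<in> Basis \<Longrightarrow> d \<le> \<sigma> b \<Longrightarrow> mollifier d \<eta> \<Longrightarrow>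
      (\<integral>\<^sup>+x\<in>ball 0 r. ennreal (\<bar>conv (\<lambda>y. G y \<bullet> b) \<eta> x - G x \<bullet> b\<bar> ^ 2) \<partial>lborel) \<le> ennreal e"
    by blast
  define d where "d = min s (Min (\<sigma> ` Basis))"
  have d: "d > 0" "d \<le> s" "b \<in> Basis \<Longrightarrow> d \<le> \<sigma> b" for b
    using s(1) \<sigma>(1) by (auto simp: d_def intro: min.coboundedI2)
  obtain \<eta> :: "'a \<Rightarrow> real" where m: "mollifier d \<eta>" using mollifier_exists[OF d(1)] by blast
  have sm: "smooth \<eta>" and sup: "\<And>x. d < norm x \<Longrightarrow> \<eta> x = 0" using m by (auto simp: mollifier_def)
  have sc: "smooth (conv v \<eta>)" by (rule smooth_conv[OF li sm sup])
  have 1: "L2_normsq (ball 0 r) (\<lambda>x. conv v \<eta> x - v x) \<le> ennreal e"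
    using s(2)[OF d(2) m] unfolding L2 .
  have [measurable]: "gradc (conv v \<eta>) \<in> borel_measurable borel"
    by (rule borel_measurable_continuous_onI[OF gradc_continuous[OF sc]])
  let ?D = "\<lambda>x. gradc (conv v \<eta>) x - G x"
  have "(norm (?D x))\<^sup>2 = (\<Sum>b\<in>Basis. \<bar>conv (\<lambda>y. G y \<bullet> b) \<eta> x - G x \<bullet> b\<bar> ^ 2)" for x
  proof -
    have "(norm (?D x))\<^sup>2 = (\<Sum>b\<in>Basis. (?D x \<bullet> b) * (?D x \<bullet> b))"
      by (simp add: power2_norm_eq_inner euclidean_inner[of "?D x" "?D x"])
    also have "\<dots> = (\<Sum>b\<in>Basis. \<bar>conv (\<lambda>y. G y \<bullet> b) \<eta> x - G x \<bullet> b\<bar> ^ 2)"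
    proof (rule sum.cong[OF refl])
      fix b :: 'a assume b: "b \<in> Basis"
      have "?D x \<bullet> b = conv (\<lambda>y. G y \<bullet> b) \<eta> x - G x \<bullet> b"
        by (simp add: inner_diff_left gradc_inner[OF b] conv_weak_gradient[OF li wg G m b])
      then show "(?D x \<bullet> b) * (?D x \<bullet> b) = \<bar>conv (\<lambda>y. G y \<bullet> b) \<eta> x - G x \<bullet> b\<bar> ^ 2"
        by (simp add: power2_eq_square)
    qed
    finally show ?thesis .
  qed
  then have "L2_normsq (ball 0 r) ?D = (\<integral>\<^sup>+x. (\<Sum>b\<in>Basis. ennreal (\<bar>conv (\<lambda>y. G y \<bullet> b) \<eta> x - G x \<bullet> b\<bar> ^ 2) * indicator (ball 0 r) x) \<partial>lborel)"
    unfolding L2_normsq_def nn_integral_completion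
    by (intro nn_integral_cong) (simp add: sum_distrib_right[symmetric] sum_ennreal)
  also have "\<dots> = (\<Sum>b\<in>Basis. \<integral>\<^sup>+x\<in>ball 0 r. ennreal (\<bar>conv (\<lambda>y. G y \<bullet> b) \<eta> x - G x \<bullet> b\<bar> ^ 2) \<partial>lborel)"
  proof (rule nn_integral_sum)
    fix b :: 'a assume b: "b \<in> Basis"
    have "conv (\<lambda>y. G y \<bullet> b) \<eta> = (\<lambda>x. gradc (conv v \<eta>) x \<bullet> b)"
      by (simp add: fun_eq_iff gradc_inner[OF b] conv_weak_gradient[OF li wg G m b])
    then have [measurable]: "conv (\<lambda>y. G y \<bullet> b) \<eta> \<in> borel_measurable borel" by simp
    show "(\<lambda>x. ennreal (\<bar>conv (\<lambda>y. G y \<bullet> b) \<eta> x - G x \<bullet> b\<bar> ^ 2) * indicator (ball 0 r) x) \<in> borel_measurable lborel"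
      by measurable
  qed
  also have "\<dots> \<le> (\<Sum>b\<in>(Basis :: 'a set). ennreal e)"
    by (intro sum_mono \<sigma>(2)[OF _ d(3) m])
  also have "\<dots> = ennreal (DIM('a) * e)" using \<open>e > 0\<close> by (simp add: ennreal_mult ennreal_of_nat_eq_real_of_nat)
  finally show ?thesis using 1 sc by blast
qed

lemma gradc_fst:
  fixes \<psi> :: "'a::euclidean_space \<Rightarrow> real"
  assumes \<psi>: "smooth \<psi>"
  shows "smooth (\<lambda>z :: 'a \<times> real. \<psi> (fst z))" "gradc (\<lambda>z :: 'a \<times> real. \<psi> (fst z)) z = (gradc \<psi> (fst z), 0)"
proof -
  show "smooth (\<lambda>z :: 'a \<times> real. \<psi> (fst z))"
    by (rule smooth_compose[OF \<psi>]) (intro smooth_bounded_linear bounded_linear_inner_left_comp bounded_linear_fst)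
  have D: "frechet_derivative (\<lambda>z :: 'a \<times> real. \<psi> (fst z)) (at z) v = frechet_derivative \<psi> (at (fst z)) (fst v)" for v z
    by (rule fun_cong[OF frechet_derivative_at[OF has_derivative_compose[OF has_derivative_fst[OF
          has_derivative_ident] smooth_has_derivative[OF \<psi>]]], symmetric])
  show "gradc (\<lambda>z :: 'a \<times> real. \<psi> (fst z)) z = (gradc \<psi> (fst z), 0)"
  proof (rule euclidean_eqI)
    fix b :: "'a \<times> real" assume b: "b \<in> Basis"
    interpret linear "frechet_derivative \<psi> (at (fst z))"
      by (rule has_derivative_linear[OF smooth_has_derivative[OF \<psi>]])
    consider i where "b = (i, 0)" "i \<in> Basis" | "b = (0, 1)" using b by (auto simp: Basis_prod_def)
    then show "gradc (\<lambda>z :: 'a \<times> real. \<psi> (fst z)) z \<bullet> b = (gradc \<psi> (fst z), 0) \<bullet> b"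
      unfolding gradc_inner[OF b] D by cases (auto simp: gradc_inner zero)
  qed
qed

lemma L2_normsq_Q_plus_static:
  fixes f :: "'a::euclidean_space \<times> real \<Rightarrow> 'b::euclidean_space" and g :: "'a \<Rightarrow> 'c::euclidean_space"
  assumes f: "\<And>z. norm (f z) = norm (g (fst z))" and g[measurable]: "g \<in> borel_measurable borel"
  shows "L2_normsq (Q_plus r) f = ennreal (r\<^sup>2) * L2_normsq (ball 0 r) g"
proof -
  have mf: "(\<lambda>z :: 'a \<times> real. g (fst z)) \<in> borel_measurable borel"
    by (rule measurable_compose[OF borel_measurable_continuous_onI[OF continuous_on_fst[OF continuous_on_id]] g])
  have "(\<lambda>z :: 'a \<times> real. ennreal ((norm (g (fst z)))\<^sup>2)) \<in> borel_measurable borel"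
    using mf by measurable
  from nn_integral_Q_plus[OF this, of r] have "L2_normsq (Q_plus r) f
      = (\<integral>\<^sup>+x\<in>ball 0 r. (\<integral>\<^sup>+t\<in>{0<..<r\<^sup>2}. ennreal ((norm (g x))\<^sup>2) \<partial>lborel) \<partial>lborel)"
    by (simp add: L2_normsq_def f)
  also have "\<dots> = (\<integral>\<^sup>+x. ennreal (r\<^sup>2) * (ennreal ((norm (g x))\<^sup>2) * indicator (ball 0 r) x) \<partial>lborel)"
    by (intro nn_integral_cong) (simp add: nn_integral_cmult_indicator mult_ac)
  also have "\<dots> = ennreal (r\<^sup>2) * L2_normsq (ball 0 r) g"
    unfolding L2_normsq_def nn_integral_completion by (rule nn_integral_cmult) measurable
  finally show ?thesis .
qed

text \<open>The approximants are constant in time as well, so all errors on the cylinder are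
  \<open>r\<^sup>2\<close> times errors on the ball, and the trace error is the spatial error
  itself.\<close>

lemma smoothly_approximable_static:
  fixes v u0 :: "'a::euclidean_space \<Rightarrow> real"
  assumes v[measurable]: "v \<in> borel_measurable borel" and G[measurable]: "G \<in> borel_measurable borel"
    and ae: "AE x in lebesgue. u0 x = v x" and wg: "is_weak_gradient UNIV v G"
    and fin: "L2_normsq UNIV v < \<infinity>" "L2_normsq UNIV G < \<infinity>"
  shows "smoothly_approximable (\<lambda>z. v (fst z)) (\<lambda>z. (G (fst z), 0)) u0"
  unfolding smoothly_approximable_def
proof (intro conjI allI impI)
  have mfst: "(fst :: 'a \<times> real \<Rightarrow> 'a) \<in> borel_measurable borel"
    by (rule borel_measurable_continuous_onI[OF continuous_on_fst[OF continuous_on_id]])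
  show "(\<lambda>z :: 'a \<times> real. v (fst z)) \<in> borel_measurable borel"
    by (rule measurable_compose[OF mfst v])
  have "(\<lambda>y :: 'a. (y, 0 :: real)) \<in> borel_measurable borel"
    by (rule borel_measurable_continuous_onI) (intro continuous_intros)
  from measurable_compose[OF measurable_compose[OF mfst G] this]
  show "(\<lambda>z :: 'a \<times> real. (G (fst z), 0 :: real)) \<in> borel_measurable borel" .
  fix r :: real assume r: "r > 0"
  have "\<forall>k::nat. \<exists>\<psi>. smooth \<psi> \<and> L2_normsq (ball 0 r) (\<lambda>x. \<psi> x - v x) \<le> ennreal (inverse (real (Suc k))) \<and>
    L2_normsq (ball 0 r) (\<lambda>x. gradc \<psi> x - G x) \<le> ennreal (DIM('a) * inverse (real (Suc k)))"
  proof
    fix k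
    show "\<exists>\<psi>. smooth \<psi> \<and> L2_normsq (ball 0 r) (\<lambda>x. \<psi> x - v x) \<le> ennreal (inverse (real (Suc k))) \<and>
      L2_normsq (ball 0 r) (\<lambda>x. gradc \<psi> x - G x) \<le> ennreal (DIM('a) * inverse (real (Suc k)))"
      using smooth_approximation[OF v G wg fin, of "inverse (real (Suc k))" r] by simp
  qed
  from choice[OF this] obtain \<psi> where \<psi>: "\<And>k. smooth (\<psi> k)"
    "\<And>k::nat. L2_normsq (ball 0 r) (\<lambda>x. \<psi> k x - v x) \<le> ennreal (inverse (real (Suc k)))"
    "\<And>k::nat. L2_normsq (ball 0 r) (\<lambda>x. gradc (\<psi> k) x - G x) \<le> ennreal (DIM('a) * inverse (real (Suc k)))"
    by blast
  have "(\<lambda>k. ennreal (inverse (real (Suc k)))) \<longlonglongrightarrow> ennreal 0"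
    by (rule tendsto_ennrealI[OF LIMSEQ_inverse_real_of_nat])
  then have z1: "(\<lambda>k. ennreal (inverse (real (Suc k)))) \<longlonglongrightarrow> 0" by simp
  have "(\<lambda>k. ennreal (DIM('a) * inverse (real (Suc k)))) \<longlonglongrightarrow> ennreal (real DIM('a) * 0)"
    by (rule tendsto_ennrealI[OF tendsto_mult_left[OF LIMSEQ_inverse_real_of_nat]])
  then have z2: "(\<lambda>k. ennreal (DIM('a) * inverse (real (Suc k)))) \<longlonglongrightarrow> 0" by simp
  have lv: "(\<lambda>k. L2_normsq (ball 0 r) (\<lambda>x. \<psi> k x - v x)) \<longlonglongrightarrow> 0"
    by (rule tendsto_sandwich[OF _ _ tendsto_const z1]) (auto simp: \<psi>(2) simp del: of_nat_Suc)
  have lG: "(\<lambda>k. L2_normsq (ball 0 r) (\<lambda>x. gradc (\<psi> k) x - G x)) \<longlonglongrightarrow> 0"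
    by (rule tendsto_sandwich[OF _ _ tendsto_const z2]) (auto simp: \<psi>(3) simp del: of_nat_Suc)
  have [measurable]: "\<psi> k \<in> borel_measurable borel" "gradc (\<psi> k) \<in> borel_measurable borel" for k
    by (intro borel_measurable_continuous_onI smooth_continuous gradc_continuous \<psi>(1))+
  have e1: "L2_normsq (Q_plus r) (\<lambda>z. \<psi> k (fst z) - v (fst z)) = ennreal (r\<^sup>2) * L2_normsq (ball 0 r) (\<lambda>x. \<psi> k x - v x)" for k
    by (rule L2_normsq_Q_plus_static) auto
  have e2: "L2_normsq (Q_plus r) (\<lambda>z :: 'a \<times> real. gradc (\<lambda>z. \<psi> k (fst z)) z - (G (fst z), 0))
      = ennreal (r\<^sup>2) * L2_normsq (ball 0 r) (\<lambda>x. gradc (\<psi> k) x - G x)" for k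
    by (rule L2_normsq_Q_plus_static) (auto simp: gradc_fst(2)[OF \<psi>(1)] norm_Pair)
  have e3: "L2_normsq (ball 0 r) (\<lambda>x. \<psi> k x - u0 x) = L2_normsq (ball 0 r) (\<lambda>x. \<psi> k x - v x)" for k
    by (rule L2_normsq_cong_AE, use ae in eventually_elim) simp
  show "\<exists>\<phi>. (\<forall>k::nat. smooth (\<phi> k)) \<and>
       (\<lambda>k. L2_normsq (Q_plus r) (\<lambda>z. \<phi> k z - v (fst z))) \<longlonglongrightarrow> 0 \<and>
       (\<lambda>k. L2_normsq (Q_plus r) (\<lambda>z. gradc (\<phi> k) z - (G (fst z), 0))) \<longlonglongrightarrow> 0 \<and>
       (\<lambda>k. L2_normsq (ball 0 r) (\<lambda>x. \<phi> k (x, 0) - u0 x)) \<longlonglongrightarrow> 0"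
    using ennreal_tendsto_cmult[OF _ lv, of "ennreal (r\<^sup>2)"] ennreal_tendsto_cmult[OF _ lG, of "ennreal (r\<^sup>2)"] lv
    by (intro exI[of _ "\<lambda>k z. \<psi> k (fst z)"] conjI allI gradc_fst(1) \<psi>(1)) (simp_all add: e1 e2 e3)
qed

subsection \<open>Inner variations in time\<close>

text \<open>In the variable \<open>q = exp (- t / \<epsilon>)\<close> the time shifts used below move \<open>q\<close> by
  \<open>\<delta> * g q\<close> with \<open>g q = q * eta a q\<close>, whose derivative is \<open>slope a q - 1\<close>. This \<open>g\<close> is a
  smooth stand-in for \<open>min (1 - q) (q * (1 / a - 1))\<close>: near the initial time it is the shift that
  isolates the kinetic term, and beyond \<open>q = a\<close> it is a rigid translation.\<close>

definition eta :: "real \<Rightarrow> real \<Rightarrow> real" where "eta a q = (1 - q) / (q + a)"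

definition slope :: "real \<Rightarrow> real \<Rightarrow> real" where "slope a q = a * (1 + a) / (q + a)\<^sup>2"

definition deform :: "real \<Rightarrow> real \<Rightarrow> real \<Rightarrow> real" where "deform a \<delta> p = p * (1 + \<delta> * eta a p)"

definition ddeform :: "real \<Rightarrow> real \<Rightarrow> real \<Rightarrow> real" where "ddeform a \<delta> p = 1 + \<delta> * (slope a p - 1)"

text \<open>Stated for all p > 0 rather than p \<le> 1: the time shift must be smooth on the whole
  line, and negative times correspond to p > 1.\<close>

lemma deform_pos:
  assumes "0 < a" "0 < \<delta>" "\<delta> < 1" "0 < p"
  shows "1 + \<delta> * eta a p > 0" "deform a \<delta> p > 0" "ddeform a \<delta> p > 0"
proof -
  have "eta a p \<ge> -1" using assms by (simp add: eta_def field_simps)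
  then have "\<delta> * eta a p \<ge> \<delta> * (-1)" using assms by (intro mult_left_mono) auto
  then show "1 + \<delta> * eta a p > 0" using assms by simp
  then show "deform a \<delta> p > 0" using assms by (simp add: deform_def)
  have "slope a p > 0" using assms by (simp add: slope_def)
  then have "\<delta> * (slope a p - 1) \<ge> \<delta> * (-1)" using assms by (intro mult_left_mono) auto
  then show "ddeform a \<delta> p > 0" using assms by (simp add: ddeform_def)
qed

lemma deform_derivative:
  assumes "0 < a" "0 < p"
  shows "(deform a \<delta> has_real_derivative ddeform a \<delta> p) (at p)"
proof -
  have nz: "p + a \<noteq> 0" using assms by simp
  have "((\<lambda>p. p * (1 + \<delta> * ((1 - p) / (p + a)))) has_real_derivative
      (1 + \<delta> * ((1 - p) / (p + a))) + p * (\<delta> * (((0 - 1) * (p + a) - (1 - p) * 1) / ((p + a) * (p + a))))) (at p)"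
    by (rule derivative_eq_intros refl nz | simp)+
  moreover have "(1 + \<delta> * ((1 - p) / (p + a))) + p * (\<delta> * (((0 - 1) * (p + a) - (1 - p) * 1) / ((p + a) * (p + a))))
      = ddeform a \<delta> p"
    unfolding ddeform_def slope_def using nz by (simp add: divide_simps) algebra
  ultimately show ?thesis unfolding deform_def[abs_def] eta_def by simp
qed

text \<open>For p \<le> 1 the value increases with \<delta>, because \<open>eta a p\<close> is
  nonnegative there, and at \<delta> = 1 it is still \<open>1 - (1 - p) * a / (p + a)\<close>. In
  terms of time, positive times move backwards but stay positive.\<close>

lemma deform_bounds:
  assumes "0 < a" "0 < \<delta>" "\<delta> < 1" "0 < p" "p \<le> 1"
  shows "p \<le> deform a \<delta> p" "deform a \<delta> p \<le> 1" "p < 1 \<Longrightarrow> deform a \<delta> p < 1"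
proof -
  have e: "eta a p \<ge> 0" using assms by (simp add: eta_def)
  then show "p \<le> deform a \<delta> p" using assms by (simp add: deform_def)
  have "p * (1 + \<delta> * eta a p) \<le> p * (1 + 1 * eta a p)"
    using assms e by (intro mult_left_mono add_left_mono mult_right_mono) auto
  also have "p * (1 + 1 * eta a p) = 1 - (1 - p) * a / (p + a)"
    using assms by (simp add: eta_def field_simps)
  finally have b: "deform a \<delta> p \<le> 1 - (1 - p) * a / (p + a)" by (simp add: deform_def)
  have "(1 - p) * a / (p + a) \<ge> 0" using assms by simp
  then show "deform a \<delta> p \<le> 1" using b by simp
  have "(1 - p) * a / (p + a) > 0" if "p < 1" using assms that by simp
  then show "p < 1 \<Longrightarrow> deform a \<delta> p < 1" using b by fastforce
qed

text \<open>Second-order Taylor bounds, uniform in \<open>p\<close>, for the coefficients that the change of variables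
  \<open>q = deform a \<delta> p\<close> puts in front of the potential and of the kinetic term.\<close>

lemma deform_expansion:
  assumes a: "0 < a" "a \<le> 1" and \<delta>: "0 < \<delta>" "\<delta> \<le> 1 / 2" and p: "0 < p" "p \<le> 1"
  defines "q \<equiv> deform a \<delta> p" and "D \<equiv> ddeform a \<delta> p" and "L \<equiv> 1 / a"
  defines "K \<equiv> 4 * L\<^sup>2 + 2 * L + 3 * L\<^sup>2 + 3 * L ^ 3 + 3 * L\<^sup>2 * (4 * L\<^sup>2)"
  shows "1 \<le> (1 - \<delta> * (slope a q - 1) + K * \<delta>\<^sup>2) * D"
    and "(p / q)\<^sup>2 * D \<le> 1 - \<delta> * (2 * eta a q - (slope a q - 1)) + K * \<delta>\<^sup>2"
proof -
  have \<delta>1: "\<delta> < 1" "\<delta> \<le> 1" using \<delta> by auto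
  have pq: "p \<le> q" "q \<le> 1" "0 < q"
    using deform_bounds[OF a(1) \<delta>(1) \<delta>1(1) p] deform_pos(2)[OF a(1) \<delta>(1) \<delta>1(1) p(1)] by (auto simp: q_def)
  have L1: "L \<ge> 1" using a by (simp add: L_def)
  \<comment> \<open>The coefficients are expanded at the image \<open>q\<close>, because after the
    substitution the image time is the variable of integration.\<close>
  define y where "y = eta a q"
  define x where "x = slope a q - 1"
  have y: "0 \<le> y" "y \<le> L" "y \<le> eta a p"
  proof -
    show "0 \<le> y" using pq a by (simp add: y_def eta_def)
    have "(1 - q) / (q + a) \<le> 1 / a" using pq a by (intro frac_le) auto
    then show "y \<le> L" by (simp add: y_def eta_def L_def)
    show "y \<le> eta a p" unfolding y_def eta_def using pq p a by (intro frac_le) auto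
  qed
  have x: "-1 \<le> x" "x \<le> L"
  proof -
    show "-1 \<le> x" using pq a by (simp add: x_def slope_def)
    have "a * (1 + a) / (q + a)\<^sup>2 \<le> a * (1 + a) / a\<^sup>2"
      using pq a by (intro divide_left_mono power_mono mult_pos_pos) auto
    also have "\<dots> = L + 1" using a by (simp add: L_def field_simps power2_eq_square)
    finally show "x \<le> L" by (simp add: x_def slope_def)
  qed
  have qp: "q - p \<le> \<delta>"
  proof -
    have "q - p = \<delta> * (p * (1 - p) / (p + a))" by (simp add: q_def deform_def eta_def algebra_simps)
    moreover have "p * (1 - p) / (p + a) \<le> 1"
    proof -
      have "p * (1 - p) \<le> p * 1" using p by (intro mult_left_mono) auto
      then show ?thesis using p a by (simp add: field_simps)
    qed
    ultimately have "q - p \<le> \<delta> * 1" using \<delta> mult_left_mono by (metis less_imp_le)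
    then show ?thesis by simp
  qed
  \<comment> \<open>Moving the slope from \<open>p\<close> to \<open>q\<close> costs an error of
    order \<delta>, which enters \<open>D\<close> multiplied by another \<delta>.\<close>
  have xp: "x \<le> slope a p - 1" "slope a p - 1 \<le> x + 4 * L\<^sup>2 * \<delta>"
  proof -
    show "x \<le> slope a p - 1"
      unfolding x_def slope_def using pq p a by (intro diff_right_mono divide_left_mono power_mono mult_pos_pos) auto
    have "slope a p - slope a q = a * (1 + a) * ((q - p) * ((q + a) + (p + a))) / ((p + a)\<^sup>2 * (q + a)\<^sup>2)"
      unfolding slope_def using p pq a by (simp add: divide_simps) algebra
    also have "\<dots> \<le> a * (1 + a) * (\<delta> * (2 * (q + a))) / ((p + a)\<^sup>2 * (q + a)\<^sup>2)"
      using p pq a qp \<delta> by (intro divide_right_mono mult_left_mono mult_mono) auto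
    also have "\<dots> = 2 * a * (1 + a) * \<delta> / ((p + a)\<^sup>2 * (q + a))"
    proof (subst frac_eq_eq)
      have "p + a \<noteq> 0" "q + a \<noteq> 0" using p pq a by auto
      then show "(p + a)\<^sup>2 * (q + a)\<^sup>2 \<noteq> 0" "(p + a)\<^sup>2 * (q + a) \<noteq> 0" by simp_all
    qed (simp add: power2_eq_square algebra_simps)
    also have "\<dots> \<le> 2 * a * 2 * \<delta> / (a\<^sup>2 * a)"
      using p pq a \<delta> by (intro frac_le mult_mono power_mono) auto
    also have "\<dots> = 4 * L\<^sup>2 * \<delta>" using a by (simp add: L_def field_simps power2_eq_square)
    finally show "slope a p - 1 \<le> x + 4 * L\<^sup>2 * \<delta>" by (simp add: x_def)
  qed
  have D: "1 + \<delta> * x \<le> D" "D \<le> 1 + \<delta> * x + 4 * L\<^sup>2 * \<delta>\<^sup>2" "D > 0"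
  proof -
    show "1 + \<delta> * x \<le> D" using mult_left_mono[OF xp(1), of \<delta>] \<delta> by (simp add: D_def ddeform_def)
    have "\<delta> * (slope a p - 1) \<le> \<delta> * (x + 4 * L\<^sup>2 * \<delta>)" using xp(2) \<delta> by (intro mult_left_mono) auto
    then show "D \<le> 1 + \<delta> * x + 4 * L\<^sup>2 * \<delta>\<^sup>2" by (simp add: D_def ddeform_def power2_eq_square algebra_simps)
    show "D > 0" unfolding D_def by (rule deform_pos(3)[OF a(1) \<delta>(1) \<delta>1(1) p(1)])
  qed
  have K2: "2 * L\<^sup>2 \<le> K" "0 \<le> K" using L1 by (auto simp: K_def)
  have xx: "x\<^sup>2 \<le> L\<^sup>2" using x L1 by (intro abs_le_square_iff[THEN iffD1]) auto
  have dx: "1 / 2 \<le> 1 + \<delta> * x" using mult_left_mono[OF x(1), of \<delta>] \<delta> by simp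
  have "0 \<le> 1 - \<delta> * x + K * \<delta>\<^sup>2"
  proof -
    have "\<delta> * x \<le> \<delta> * L" using x \<delta> by (intro mult_left_mono) auto
    moreover have "L\<^sup>2 * \<delta>\<^sup>2 \<le> K * \<delta>\<^sup>2" using K2 by (intro mult_right_mono) auto
    moreover have "\<delta> * L \<le> 1 + L\<^sup>2 * \<delta>\<^sup>2"
    proof -
      have "0 \<le> \<delta> * L" using \<delta> L1 by simp
      moreover have "2 * (\<delta> * L) \<le> 1 + L\<^sup>2 * \<delta>\<^sup>2"
        using sum_squares_bound[of 1 "\<delta> * L"] by (simp add: power_mult_distrib mult.commute)
      ultimately show ?thesis by linarith
    qed
    ultimately show ?thesis by linarith
  qed
  then have "(1 - \<delta> * x + K * \<delta>\<^sup>2) * (1 + \<delta> * x) \<le> (1 - \<delta> * x + K * \<delta>\<^sup>2) * D"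
    using D(1) by (intro mult_left_mono)
  \<comment> \<open>The product equals
    \<open>1 + \<delta>\<^sup>2 * (K * (1 + \<delta> * x) - x\<^sup>2)\<close>, and
    \<open>1 + \<delta> * x\<close> is at least 1/2; so \<open>2 * L\<^sup>2 \<le> K\<close> is
    enough.\<close>
  moreover have "1 \<le> (1 - \<delta> * x + K * \<delta>\<^sup>2) * (1 + \<delta> * x)"
  proof -
    have "K * (1 / 2) \<le> K * (1 + \<delta> * x)" using K2 dx by (intro mult_left_mono) auto
    then have "x\<^sup>2 \<le> K * (1 + \<delta> * x)" using K2 xx by linarith
    then have "0 \<le> \<delta>\<^sup>2 * (K * (1 + \<delta> * x) - x\<^sup>2)" by simp
    then show ?thesis by (simp add: power2_eq_square algebra_simps)
  qed
  ultimately show "1 \<le> (1 - \<delta> * (slope a q - 1) + K * \<delta>\<^sup>2) * D" by (simp add: x_def)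
  define z where "z = \<delta> * y"
  have z: "0 \<le> z" using y \<delta> by (simp add: z_def)
  have "p / q \<le> 1 / (1 + z)"
  proof -
    have "1 + z \<le> 1 + \<delta> * eta a p" using mult_left_mono[OF y(3), of \<delta>] \<delta> by (simp add: z_def)
    then have "p * (1 + z) \<le> p * (1 + \<delta> * eta a p)" using p by (intro mult_left_mono) auto
    then have "p * (1 + z) \<le> q" by (simp add: q_def deform_def)
    then show ?thesis using pq z by (simp add: field_simps)
  qed
  then have "(p / q)\<^sup>2 \<le> (1 / (1 + z))\<^sup>2" using p pq by (intro power_mono) auto
  \<comment> \<open>The second Taylor polynomial of 1/(1 + z)^2; multiplied by (1 + z)^2 it becomes
    1 + 4 z^3 + 3 z^4.\<close>
  also have "\<dots> \<le> 1 - 2 * z + 3 * z\<^sup>2"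
  proof -
    have "0 \<le> 4 * z ^ 3 + 3 * z ^ 4" using z by simp
    then have "1 \<le> (1 - 2 * z + 3 * z\<^sup>2) * (1 + z)\<^sup>2"
      by (simp add: power2_eq_square power3_eq_cube power4_eq_xxxx algebra_simps)
    then show ?thesis using z by (simp add: power_one_over divide_le_eq)
  qed
  finally have P: "(p / q)\<^sup>2 \<le> 1 - 2 * z + 3 * z\<^sup>2" .
  have P0: "0 \<le> 1 - 2 * z + 3 * z\<^sup>2" using P by (rule order_trans[OF zero_le_power2])
  have "(p / q)\<^sup>2 * D \<le> (1 - 2 * z + 3 * z\<^sup>2) * D" using P D by (intro mult_right_mono) auto
  also have "\<dots> \<le> (1 - 2 * z + 3 * z\<^sup>2) * (1 + \<delta> * x + 4 * L\<^sup>2 * \<delta>\<^sup>2)"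
    using D P0 by (intro mult_left_mono)
  also have "\<dots> = 1 - \<delta> * (2 * y - x) + \<delta>\<^sup>2 * (4 * L\<^sup>2 + 2 * y * (- x) + 3 * y\<^sup>2 + 3 * (\<delta> * (x * y\<^sup>2))
      + 3 * (\<delta>\<^sup>2 * (y\<^sup>2 * (4 * L\<^sup>2))) - 2 * \<delta> * y * (4 * L\<^sup>2))"
    unfolding z_def by (simp add: power2_eq_square algebra_simps)
  \<comment> \<open>Here \<open>K\<close> originates: it is the sum of the bounds of the terms in
    the bracket that follow from 0 \<le> y \<le> L, -1 \<le> x \<le> L and \<delta> \<le> 1.\<close>
  also have "\<dots> \<le> 1 - \<delta> * (2 * y - x) + \<delta>\<^sup>2 * K"
  proof (intro add_left_mono mult_left_mono)
    have y2: "y\<^sup>2 \<le> L\<^sup>2" using y by (intro power_mono) auto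
    have "y * (- x) \<le> y * 1" using x y by (intro mult_left_mono) auto
    then have "y * (- x) \<le> L" using y by simp
    moreover have "\<delta> * (x * y\<^sup>2) \<le> L ^ 3"
    proof -
      have "x * y\<^sup>2 \<le> L * L\<^sup>2" using x y2 L1 by (intro mult_mono) auto
      then have "\<delta> * (x * y\<^sup>2) \<le> \<delta> * (L * L\<^sup>2)" using \<delta> by (intro mult_left_mono) auto
      also have "\<dots> \<le> 1 * (L * L\<^sup>2)" using \<delta>1 L1 by (intro mult_right_mono) auto
      finally show ?thesis by (simp add: power3_eq_cube power2_eq_square mult.assoc)
    qed
    moreover have "\<delta>\<^sup>2 * (y\<^sup>2 * (4 * L\<^sup>2)) \<le> 1 * (L\<^sup>2 * (4 * L\<^sup>2))"
      using y2 \<delta>1 \<delta> by (intro mult_mono mult_right_mono power_le_one) auto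
    moreover have "0 \<le> 2 * \<delta> * y * (4 * L\<^sup>2)" using \<delta> y by simp
    ultimately show "4 * L\<^sup>2 + 2 * y * (- x) + 3 * y\<^sup>2 + 3 * (\<delta> * (x * y\<^sup>2))
      + 3 * (\<delta>\<^sup>2 * (y\<^sup>2 * (4 * L\<^sup>2))) - 2 * \<delta> * y * (4 * L\<^sup>2) \<le> K"
      using y2 unfolding K_def by linarith
  qed auto
  finally show "(p / q)\<^sup>2 * D \<le> 1 - \<delta> * (2 * eta a q - (slope a q - 1)) + K * \<delta>\<^sup>2"
    by (simp add: x_def y_def mult.commute)
qed

definition time_shift :: "real \<Rightarrow> real \<Rightarrow> real \<Rightarrow> real \<Rightarrow> real" where
  "time_shift \<epsilon> a \<delta> t = - \<epsilon> * ln (deform a \<delta> (exp (- t / \<epsilon>)))"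

text \<open>Everything is read off in the variable exp (-t/\<epsilon>), where the shift acts as
  \<open>deform a \<delta>\<close>: the bound \<open>p \<le> deform a \<delta> p\<close> becomes
  \<theta>(t) \<le> t, and values below 1 become positive times. The last clause gives the weight at
  the shifted time.\<close>

lemma time_shift_properties:
  assumes e: "\<epsilon> > 0" and a: "0 < a" and \<delta>: "0 < \<delta>" "\<delta> < 1"
  defines "\<theta>' \<equiv> \<lambda>t. exp (- t / \<epsilon>) * ddeform a \<delta> (exp (- t / \<epsilon>)) / deform a \<delta> (exp (- t / \<epsilon>))"
  shows "smooth (time_shift \<epsilon> a \<delta>)" "time_shift \<epsilon> a \<delta> 0 = 0"
    "(time_shift \<epsilon> a \<delta> has_real_derivative \<theta>' t) (at t)" "continuous_on UNIV \<theta>'" "\<theta>' t > 0"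
    "t > 0 \<Longrightarrow> time_shift \<epsilon> a \<delta> t > 0" "t > 0 \<Longrightarrow> time_shift \<epsilon> a \<delta> t \<le> t"
    "exp (- time_shift \<epsilon> a \<delta> t / \<epsilon>) = deform a \<delta> (exp (- t / \<epsilon>))"
proof -
  note pos = deform_pos[OF a \<delta> exp_gt_zero]
  have "smooth (\<lambda>t. exp (- t / \<epsilon>))"
    by (intro smooth_exp smooth_bounded_linear) (auto intro!: bounded_linear_intros simp: bounded_linear_divide bounded_linear_minus)
  then have "smooth (\<lambda>t. exp (- t / \<epsilon>) * (1 + \<delta> * ((1 - exp (- t / \<epsilon>)) * inverse (exp (- t / \<epsilon>) + a))))"
  proof (intro smooth_mult smooth_add smooth_minus smooth_const smooth_inverse)
    show "exp (- t / \<epsilon>) + a \<noteq> 0" for t using a exp_gt_zero[of "- t / \<epsilon>"] by linarith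
  qed
  then have "smooth (\<lambda>t. deform a \<delta> (exp (- t / \<epsilon>)))"
    by (simp add: deform_def eta_def divide_inverse)
  then show s: "smooth (time_shift \<epsilon> a \<delta>)"
    unfolding time_shift_def[abs_def] by (intro smooth_mult smooth_const smooth_ln pos(2))
  show "time_shift \<epsilon> a \<delta> 0 = 0" by (simp add: time_shift_def deform_def eta_def)
  have d: "(time_shift \<epsilon> a \<delta> has_real_derivative \<theta>' t) (at t)" for t
  proof -
    have "((\<lambda>t. exp (- t / \<epsilon>)) has_real_derivative exp (- t / \<epsilon>) * (- 1 / \<epsilon>)) (at t)"
      by (rule DERIV_fun_exp) (use e in \<open>auto intro!: derivative_eq_intros\<close>)
    from DERIV_chain2[OF deform_derivative[OF a exp_gt_zero] this]
    have "((\<lambda>t. deform a \<delta> (exp (- t / \<epsilon>))) has_real_derivative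
      ddeform a \<delta> (exp (- t / \<epsilon>)) * (exp (- t / \<epsilon>) * (- 1 / \<epsilon>))) (at t)" .
    from DERIV_cmult[OF DERIV_chain2[OF DERIV_ln[OF pos(2)] this], of "- \<epsilon>"]
    show ?thesis unfolding time_shift_def[abs_def] \<theta>'_def
      by (rule DERIV_cong) (use e in \<open>simp add: divide_inverse mult_ac\<close>)
  qed
  then show "(time_shift \<epsilon> a \<delta> has_real_derivative \<theta>' t) (at t)" .
  \<comment> \<open>Continuity of the derivative is inherited from smoothness, by differentiating in
    direction 1.\<close>
  have "frechet_derivative (time_shift \<epsilon> a \<delta>) (at t) 1 = \<theta>' t" for t
    using fun_cong[OF frechet_derivative_at[OF d[of t, unfolded has_field_derivative_def]], of 1] by simp
  then show "continuous_on UNIV \<theta>'"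
    using smooth_continuous[OF smooth_derivative[OF s, of 1], of UNIV] by simp
  show "\<theta>' t > 0" unfolding \<theta>'_def using pos by simp
  show ex: "exp (- time_shift \<epsilon> a \<delta> t / \<epsilon>) = deform a \<delta> (exp (- t / \<epsilon>))" for t
    using e pos(2) by (simp add: time_shift_def)
  assume t: "t > 0"
  have p1: "exp (- t / \<epsilon>) < 1" using t e by simp
  have "ln (deform a \<delta> (exp (- t / \<epsilon>))) < 0"
    using deform_bounds(3)[OF a \<delta> exp_gt_zero _ p1] p1 pos(2) by simp
  then show "time_shift \<epsilon> a \<delta> t > 0" using e by (simp add: time_shift_def mult_pos_neg)
  have "ln (exp (- t / \<epsilon>)) \<le> ln (deform a \<delta> (exp (- t / \<epsilon>)))"
    using deform_bounds(1)[OF a \<delta> exp_gt_zero, of "- t / \<epsilon>"] p1 pos(2) by (subst ln_le_cancel_iff) auto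
  then have "\<epsilon> * ln (exp (- t / \<epsilon>)) \<le> \<epsilon> * ln (deform a \<delta> (exp (- t / \<epsilon>)))"
    using e by (intro mult_left_mono) auto
  then have "- t \<le> \<epsilon> * ln (deform a \<delta> (exp (- t / \<epsilon>)))" using e by simp
  then show "time_shift \<epsilon> a \<delta> t \<le> t" by (simp add: time_shift_def)
qed

lemma slope_lower_bound: "0 < a \<Longrightarrow> 0 < q \<Longrightarrow> q \<le> a \<Longrightarrow> 1 / (4 * a) \<le> slope a q"
proof -
  assume a: "0 < a" and q: "0 < q" "q \<le> a"
  have "a * 1 / (2 * a)\<^sup>2 \<le> a * (1 + a) / (q + a)\<^sup>2"
    using a q by (intro frac_le mult_left_mono power_mono) auto
  then show ?thesis using a by (simp add: slope_def power2_eq_square)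
qed

text \<open>The weight equals (2q + a - q^2)/(q + a)^2. Since q^2 \<le> q its numerator is at least
  q + a, so q times the weight is at least q/(q + a).\<close>

lemma eta_slope_bounds:
  assumes "0 < a" "0 < q" "q \<le> 1"
  shows "2 * eta a q - (slope a q - 1) \<ge> 0" "a \<le> q \<Longrightarrow> 1 / 2 \<le> q * (2 * eta a q - (slope a q - 1))"
proof -
  have eq: "2 * eta a q - (slope a q - 1) = (2 * q + a - q\<^sup>2) / (q + a)\<^sup>2"
    using assms by (simp add: eta_def slope_def divide_simps) algebra
  have "q\<^sup>2 \<le> q" using assms by (simp add: power2_eq_square mult_left_le)
  then have n: "q + a \<le> 2 * q + a - q\<^sup>2" by simp
  then show "2 * eta a q - (slope a q - 1) \<ge> 0" unfolding eq using assms by simp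
  assume "a \<le> q"
  then have "1 / 2 \<le> q / (q + a)" using assms by (simp add: field_simps)
  also have "q / (q + a) = q * ((q + a) / (q + a)\<^sup>2)" using assms by (simp add: power2_eq_square)
  also have "q * ((q + a) / (q + a)\<^sup>2) \<le> q * ((2 * q + a - q\<^sup>2) / (q + a)\<^sup>2)"
    using assms n by (intro mult_left_mono divide_right_mono) auto
  finally show "1 / 2 \<le> q * (2 * eta a q - (slope a q - 1))" unfolding eq .
qed

text \<open>For small \<delta> > 0 the time shift is a competitor. Changing variables to the shifted
  time and expanding the coefficients gives E + \<delta> Y \<le> (1 + \<delta> + K \<delta>^2) E,
  with Y and E the left and right sides of the claim. Finiteness of E allows it to be cancelled;
  then \<delta> is divided out and sent to 0.\<close>

lemma first_variation:
  fixes I R :: "real \<Rightarrow> ennreal"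
  assumes e: "\<epsilon> > 0" and a: "0 < a" "a \<le> 1"
    and I[measurable]: "I \<in> borel_measurable borel" and R[measurable]: "R \<in> borel_measurable borel"
    and fin: "(\<integral>\<^sup>+t\<in>{0<..}. ennreal (exp (- t / \<epsilon>) / \<epsilon>) * (I t + R t) \<partial>lborel) < \<infinity>"
    and minimal: "\<And>\<theta> \<theta>'. smooth \<theta> \<Longrightarrow> \<theta> 0 = 0 \<Longrightarrow> (\<And>t. (\<theta> has_real_derivative \<theta>' t) (at t)) \<Longrightarrow>
      continuous_on UNIV \<theta>' \<Longrightarrow> (\<And>t. \<theta>' t > 0) \<Longrightarrow> (\<And>t. t > 0 \<Longrightarrow> \<theta> t > 0) \<Longrightarrow> (\<And>t. t > 0 \<Longrightarrow> \<theta> t \<le> t) \<Longrightarrow>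
      (\<integral>\<^sup>+t\<in>{0<..}. ennreal (exp (- t / \<epsilon>) / \<epsilon>) * (I t + R t) \<partial>lborel)
      \<le> (\<integral>\<^sup>+t\<in>{0<..}. ennreal (exp (- t / \<epsilon>) / \<epsilon>) * (ennreal ((\<theta>' t)\<^sup>2) * I (\<theta> t) + R (\<theta> t)) \<partial>lborel)"
  shows "(\<integral>\<^sup>+t\<in>{0<..}. ennreal (exp (- t / \<epsilon>) / \<epsilon>) *
      (ennreal (2 * eta a (exp (- t / \<epsilon>)) - (slope a (exp (- t / \<epsilon>)) - 1)) * I t + ennreal (slope a (exp (- t / \<epsilon>))) * R t) \<partial>lborel)
    \<le> (\<integral>\<^sup>+t\<in>{0<..}. ennreal (exp (- t / \<epsilon>) / \<epsilon>) * (I t + R t) \<partial>lborel)" (is "?Y \<le> ?E")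
proof -
  define L where "L = 1 / a"
  define K where "K = 4 * L\<^sup>2 + 2 * L + 3 * L\<^sup>2 + 3 * L ^ 3 + 3 * L\<^sup>2 * (4 * L\<^sup>2)"
  have K0: "K \<ge> 0" using a by (simp add: K_def L_def)
  have L1: "L \<ge> 1" using a by (simp add: L_def)
  define q where "q t = exp (- t / \<epsilon>)" for t
  define A where "A t = 2 * eta a (q t) - (slope a (q t) - 1)" for t
  define B where "B t = slope a (q t)" for t
  have q: "0 < q t" "t > 0 \<Longrightarrow> q t < 1" for t using e by (auto simp: q_def)
  have A0: "A t \<ge> 0" if "t > 0" for t unfolding A_def using eta_slope_bounds(1)[OF a(1) q(1)] q(2)[OF that] by simp
  have B0: "B t \<ge> 0" for t using a by (simp add: B_def slope_def)
  have A1: "A t \<le> 2 * L + 1" if "t > 0" for t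
  proof -
    have "eta a (q t) \<le> L" unfolding eta_def L_def using q[of t] a that by (intro frac_le) auto
    then show ?thesis using B0[of t] by (simp add: A_def B_def)
  qed
  have B1: "B t \<le> L + 1" for t
  proof -
    have "a * (1 + a) / (q t + a)\<^sup>2 \<le> a * (1 + a) / a\<^sup>2"
      using q(1)[of t] a by (intro divide_left_mono power_mono mult_pos_pos) auto
    also have "\<dots> = L + 1" using a by (simp add: L_def field_simps power2_eq_square)
    finally show ?thesis by (simp add: B_def slope_def)
  qed
  have [measurable]: "q \<in> borel_measurable borel" unfolding q_def[abs_def] by measurable
  have [measurable]: "A \<in> borel_measurable borel" "B \<in> borel_measurable borel"
    unfolding A_def[abs_def] B_def[abs_def] eta_def slope_def by measurable
  have Yeq: "?Y = (\<integral>\<^sup>+t\<in>{0<..}. ennreal (q t / \<epsilon>) * (ennreal (A t) * I t + ennreal (B t) * R t) \<partial>lborel)"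
    unfolding A_def B_def q_def ..
  \<comment> \<open>The smallness of \<delta> keeps the coefficients \<open>cA\<close> and
    \<open>cB\<close> below nonnegative on positive times; \<open>ennreal\<close> would replace
    negative values by 0 and destroy the cancellation with \<open>?Y\<close>.\<close>
  have Y_le: "?Y \<le> ennreal (1 + K * \<delta>) * ?E" if \<delta>0: "0 < \<delta>" "\<delta> * (2 * L + 1) \<le> 1" for \<delta>
  proof -
    have "\<delta> * 3 \<le> \<delta> * (2 * L + 1)" using L1 \<delta>0 by (intro mult_left_mono) auto
    then have "\<delta> * 3 \<le> 1" using \<delta>0(2) by (rule order_trans)
    then have \<delta>: "0 < \<delta>" "\<delta> \<le> 1 / 2" using \<delta>0 by simp_all
    have \<delta>1: "\<delta> < 1" using \<delta> by simp
    define \<theta> where "\<theta> = time_shift \<epsilon> a \<delta>"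
    define \<theta>' where "\<theta>' t = q t * ddeform a \<delta> (q t) / deform a \<delta> (q t)" for t
    note ts = time_shift_properties[OF e a(1) \<delta>(1) \<delta>1, folded \<theta>_def q_def, folded \<theta>'_def]
    define cA where "cA t = 1 - \<delta> * A t + K * \<delta>\<^sup>2" for t
    define cB where "cB t = 1 - \<delta> * (B t - 1) + K * \<delta>\<^sup>2" for t
    have [measurable]: "cA \<in> borel_measurable borel" "cB \<in> borel_measurable borel"
      unfolding cA_def[abs_def] cB_def[abs_def] by measurable
    define f where "f t = ennreal (q t / \<epsilon>) * (ennreal (cA t) * I t + ennreal (cB t) * R t)" for t
    have [measurable]: "f \<in> borel_measurable borel" unfolding f_def[abs_def] by measurable
    have pointwise: "ennreal (q t / \<epsilon>) * (ennreal ((\<theta>' t)\<^sup>2) * I (\<theta> t) + R (\<theta> t)) \<le> f (\<theta> t) * ennreal (\<theta>' t)"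
      if t: "t > 0" for t
    proof -
      have qt: "q (\<theta> t) = deform a \<delta> (q t)" using ts(8)[of t] by (simp add: q_def)
      define P where "P = q t"
      define Q where "Q = q (\<theta> t)"
      define D where "D = ddeform a \<delta> P"
      have P: "0 < P" "P \<le> 1" and Q: "0 < Q" using q t by (auto simp: P_def Q_def less_imp_le)
      have th: "\<theta>' t = P * D / Q" by (simp add: \<theta>'_def qt P_def D_def Q_def)
      have exB: "1 \<le> cB (\<theta> t) * D" and exA: "(P / Q)\<^sup>2 * D \<le> cA (\<theta> t)"
        using deform_expansion[OF a \<delta> P]
        unfolding cA_def cB_def A_def B_def L_def K_def D_def P_def Q_def qt by auto
      have th0: "\<theta>' t > 0" by (rule ts(5))
      have D0: "D > 0" using deform_pos(3)[OF a(1) \<delta>(1) \<delta>1 P(1)] by (simp add: D_def)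
      \<comment> \<open>One of the two factors \<open>\<theta>'\<close> is kept for the
        substitution; the other, P D / Q, turns the weight P into Q (P/Q)^2 D, which is the
        expression that was expanded.\<close>
      have "P / \<epsilon> * (\<theta>' t)\<^sup>2 \<le> Q / \<epsilon> * cA (\<theta> t) * \<theta>' t"
      proof -
        have "P * \<theta>' t = Q * ((P / Q)\<^sup>2 * D)" using Q by (simp add: th power2_eq_square)
        also have "\<dots> \<le> Q * cA (\<theta> t)" using exA Q by (intro mult_left_mono) auto
        finally have "P * \<theta>' t / \<epsilon> * \<theta>' t \<le> Q * cA (\<theta> t) / \<epsilon> * \<theta>' t"
          using e th0 by (intro mult_right_mono divide_right_mono) auto
        then show ?thesis by (simp add: power2_eq_square)
      qed
      then have 1: "ennreal (P / \<epsilon>) * ennreal ((\<theta>' t)\<^sup>2) \<le> ennreal (Q / \<epsilon>) * ennreal (cA (\<theta> t)) * ennreal (\<theta>' t)"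
        using P Q e th0 exA D0 order_trans[OF mult_nonneg_nonneg[OF zero_le_power2] exA]
        by (simp flip: ennreal_mult' ennreal_mult'' add: ennreal_leI)
      have "P / \<epsilon> \<le> Q / \<epsilon> * cB (\<theta> t) * \<theta>' t"
      proof -
        have "P * 1 \<le> P * (cB (\<theta> t) * D)" using exB P by (intro mult_left_mono) auto
        also have "\<dots> = Q * cB (\<theta> t) * \<theta>' t" using Q by (simp add: th)
        finally have "P / \<epsilon> \<le> Q * cB (\<theta> t) * \<theta>' t / \<epsilon>" using e by (intro divide_right_mono) auto
        then show ?thesis by simp
      qed
      then have 2: "ennreal (P / \<epsilon>) \<le> ennreal (Q / \<epsilon>) * ennreal (cB (\<theta> t)) * ennreal (\<theta>' t)"
        using Q e th0 by (simp flip: ennreal_mult' ennreal_mult'' add: ennreal_leI)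
      have "ennreal (P / \<epsilon>) * (ennreal ((\<theta>' t)\<^sup>2) * I (\<theta> t) + R (\<theta> t))
          = ennreal (P / \<epsilon>) * ennreal ((\<theta>' t)\<^sup>2) * I (\<theta> t) + ennreal (P / \<epsilon>) * R (\<theta> t)"
        by (simp add: distrib_left mult.assoc)
      also have "\<dots> \<le> ennreal (Q / \<epsilon>) * ennreal (cA (\<theta> t)) * ennreal (\<theta>' t) * I (\<theta> t)
          + ennreal (Q / \<epsilon>) * ennreal (cB (\<theta> t)) * ennreal (\<theta>' t) * R (\<theta> t)"
        by (intro add_mono mult_right_mono 1 2) auto
      also have "\<dots> = f (\<theta> t) * ennreal (\<theta>' t)"
        by (simp add: f_def Q_def distrib_left distrib_right mult_ac)
      finally show ?thesis by (simp add: P_def)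
    qed
    have "?E \<le> (\<integral>\<^sup>+t\<in>{0<..}. ennreal (q t / \<epsilon>) * (ennreal ((\<theta>' t)\<^sup>2) * I (\<theta> t) + R (\<theta> t)) \<partial>lborel)"
      unfolding q_def by (rule minimal) (use ts in auto)
    also have "\<dots> \<le> (\<integral>\<^sup>+t\<in>{0<..}. f (\<theta> t) * ennreal (\<theta>' t) \<partial>lborel)"
      using pointwise by (intro nn_integral_mono) (simp add: indicator_def)
    also have "\<dots> \<le> (\<integral>\<^sup>+t\<in>{0<..}. f t \<partial>lborel)"
      by (rule substitution_pos) (use ts in auto)
    finally have E_le: "?E \<le> (\<integral>\<^sup>+t\<in>{0<..}. f t \<partial>lborel)" .
    \<comment> \<open>Adding \<open>?Y\<close> on both sides, instead of subtracting, stays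
      meaningful before \<open>?Y\<close> is known to be finite.\<close>
    have "?E + ennreal \<delta> * ?Y \<le> (\<integral>\<^sup>+t\<in>{0<..}. f t \<partial>lborel) + ennreal \<delta> * ?Y"
      using E_le by (rule add_right_mono)
    also have "\<dots> = (\<integral>\<^sup>+t. f t * indicator {0<..} t + ennreal \<delta> * (ennreal (q t / \<epsilon>) * (ennreal (A t) * I t + ennreal (B t) * R t) * indicator {0<..} t) \<partial>lborel)"
    proof -
      let ?H = "\<lambda>t. ennreal (q t / \<epsilon>) * (ennreal (A t) * I t + ennreal (B t) * R t) * indicator {0<..} t"
      have "(\<integral>\<^sup>+t. f t * indicator {0<..} t + ennreal \<delta> * ?H t \<partial>lborel)
          = (\<integral>\<^sup>+t\<in>{0<..}. f t \<partial>lborel) + (\<integral>\<^sup>+t. ennreal \<delta> * ?H t \<partial>lborel)"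
        by (rule nn_integral_add) measurable
      also have "(\<integral>\<^sup>+t. ennreal \<delta> * ?H t \<partial>lborel) = ennreal \<delta> * ?Y"
        unfolding Yeq by (rule nn_integral_cmult) measurable
      finally show ?thesis ..
    qed
    also have "\<dots> \<le> (\<integral>\<^sup>+t. ennreal (1 + \<delta> + K * \<delta>\<^sup>2) * (ennreal (q t / \<epsilon>) * (I t + R t) * indicator {0<..} t) \<partial>lborel)"
    proof (rule nn_integral_mono)
      fix t
      show "f t * indicator {0<..} t + ennreal \<delta> * (ennreal (q t / \<epsilon>) * (ennreal (A t) * I t + ennreal (B t) * R t) * indicator {0<..} t)
        \<le> ennreal (1 + \<delta> + K * \<delta>\<^sup>2) * (ennreal (q t / \<epsilon>) * (I t + R t) * indicator {0<..} t)"
      proof (cases "t > 0")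
        case True
        have "\<delta> * A t \<le> \<delta> * (2 * L + 1)" using A1[OF True] \<delta> by (intro mult_left_mono) auto
        then have "\<delta> * A t \<le> 1" using \<delta>0(2) by (rule order_trans)
        moreover have Kd: "0 \<le> K * \<delta>\<^sup>2" using K0 by simp
        ultimately have cA0: "cA t \<ge> 0" unfolding cA_def by linarith
        have "\<delta> * (B t - 1) \<le> \<delta> * (2 * L + 1)" using B1[of t] L1 \<delta> by (intro mult_left_mono) auto
        then have "\<delta> * (B t - 1) \<le> 1" using \<delta>0(2) by (rule order_trans)
        then have cB0: "cB t \<ge> 0" unfolding cB_def using Kd by linarith
        \<comment> \<open>In the kinetic coefficient the summand \<delta> on the right is spare. In
          the potential one it is used up, because \<open>cB\<close> subtracts \<delta> times
          \<open>B t - 1\<close> while \<delta> times \<open>B t\<close> is added.\<close>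
        have cA: "ennreal (cA t) + ennreal \<delta> * ennreal (A t) \<le> ennreal (1 + \<delta> + K * \<delta>\<^sup>2)"
          using \<delta> A0[OF True] cA0
          by (simp flip: ennreal_mult ennreal_plus) (auto simp: cA_def intro!: ennreal_leI)
        have cB: "ennreal (cB t) + ennreal \<delta> * ennreal (B t) \<le> ennreal (1 + \<delta> + K * \<delta>\<^sup>2)"
          using \<delta> B0[of t] cB0
          by (simp flip: ennreal_mult ennreal_plus) (auto simp: cB_def algebra_simps intro!: ennreal_leI)
        have "f t + ennreal \<delta> * (ennreal (q t / \<epsilon>) * (ennreal (A t) * I t + ennreal (B t) * R t))
            = ennreal (q t / \<epsilon>) * ((ennreal (cA t) + ennreal \<delta> * ennreal (A t)) * I t + (ennreal (cB t) + ennreal \<delta> * ennreal (B t)) * R t)"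
          by (simp add: f_def distrib_left distrib_right mult_ac add_ac)
        also have "\<dots> \<le> ennreal (q t / \<epsilon>) * (ennreal (1 + \<delta> + K * \<delta>\<^sup>2) * I t + ennreal (1 + \<delta> + K * \<delta>\<^sup>2) * R t)"
          by (intro mult_left_mono add_mono mult_right_mono cA cB) auto
        also have "\<dots> = ennreal (1 + \<delta> + K * \<delta>\<^sup>2) * (ennreal (q t / \<epsilon>) * (I t + R t))"
          by (simp add: distrib_left mult_ac)
        finally show ?thesis using True by simp
      qed simp
    qed
    also have "\<dots> = ennreal (1 + \<delta> + K * \<delta>\<^sup>2) * ?E"
      unfolding q_def by (rule nn_integral_cmult) measurable
    finally have main: "?E + ennreal \<delta> * ?Y \<le> ennreal (1 + \<delta> + K * \<delta>\<^sup>2) * ?E" .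
    obtain x where x: "x \<ge> 0" "?E = ennreal x" using fin by (cases ?E) auto
    \<comment> \<open>As \<open>?E\<close> is finite and \<delta> is positive, the estimate
      \<open>main\<close> itself shows that \<open>?Y\<close> is finite; from here on the comparison
      is between real numbers.\<close>
    have "ennreal (1 + \<delta> + K * \<delta>\<^sup>2) * ?E < top" unfolding x(2) by (simp add: ennreal_mult_less_top)
    then have "?Y \<noteq> top" using main \<delta> by (auto simp: ennreal_mult_top top_unique)
    then obtain y where y: "y \<ge> 0" "?Y = ennreal y" by (cases ?Y) auto
    have "x + \<delta> * y \<le> (1 + \<delta> + K * \<delta>\<^sup>2) * x"
      using main x(1) y(1) \<delta> K0 unfolding x(2) y(2)
      by (simp flip: ennreal_mult ennreal_plus add: ennreal_le_iff)
    then have "\<delta> * y \<le> \<delta> * ((1 + K * \<delta>) * x)" by (simp add: power2_eq_square algebra_simps)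
    then have "y \<le> (1 + K * \<delta>) * x" using \<delta> by simp
    then have "ennreal y \<le> ennreal ((1 + K * \<delta>) * x)" by (rule ennreal_leI)
    also have "\<dots> = ennreal (1 + K * \<delta>) * ennreal x" using x(1) K0 \<delta> by (intro ennreal_mult) auto
    finally show ?thesis unfolding x(2) y(2) .
  qed
  obtain x where x: "x \<ge> 0" "?E = ennreal x" using fin by (cases ?E) auto
  show ?thesis
  proof (rule ennreal_le_epsilon)
    fix e' :: real assume e': "e' > 0"
    \<comment> \<open>The first entry makes \<open>Y_le\<close> applicable, the second keeps
      \<open>K * x * \<delta>\<close> below \<open>e'\<close>; the summand 1 avoids a zero
      denominator.\<close>
    define \<delta> where "\<delta> = min (1 / (2 * L + 1)) (e' / (K * x + 1))"
    have Kx: "K * x \<ge> 0" using K0 x by simp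
    have \<delta>: "0 < \<delta>" "\<delta> \<le> 1 / (2 * L + 1)" "\<delta> \<le> e' / (K * x + 1)"
      using L1 e' Kx by (auto simp: \<delta>_def)
    have "K * x * \<delta> \<le> (K * x + 1) * \<delta>" using \<delta> by simp
    also have "\<dots> \<le> e'" using \<delta>(3) Kx by (simp add: field_simps)
    finally have "(1 + K * \<delta>) * x \<le> x + e'" by (simp add: algebra_simps)
    have "?Y \<le> ennreal (1 + K * \<delta>) * ?E"
      by (rule Y_le) (use \<delta> L1 in \<open>auto simp: field_simps\<close>)
    also have "\<dots> = ennreal ((1 + K * \<delta>) * x)"
      unfolding x(2) using x(1) K0 \<delta> by (intro ennreal_mult[symmetric]) auto
    also have "\<dots> \<le> ennreal (x + e')" by (rule ennreal_leI) fact
    finally show "?Y \<le> ?E + ennreal e'" unfolding x(2) using x(1) e' by simp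
  qed
qed

lemma integral_bounds:
  fixes k R :: "real \<Rightarrow> ennreal"
  assumes e: "\<epsilon> > 0" and k[measurable]: "k \<in> borel_measurable borel" and R[measurable]: "R \<in> borel_measurable borel"
    and Y: "\<And>a. 0 < a \<Longrightarrow> a \<le> 1 \<Longrightarrow> (\<integral>\<^sup>+t\<in>{0<..}. ennreal (exp (- t / \<epsilon>) / \<epsilon>) *
      (ennreal (2 * eta a (exp (- t / \<epsilon>)) - (slope a (exp (- t / \<epsilon>)) - 1)) * (ennreal \<epsilon> * k t)
        + ennreal (slope a (exp (- t / \<epsilon>))) * R t) \<partial>lborel) \<le> E"
  shows "(\<integral>\<^sup>+t\<in>{0<..}. k t \<partial>lborel) \<le> 2 * E"
    and "\<epsilon> \<le> r \<Longrightarrow> (\<integral>\<^sup>+t\<in>{0<..<r}. R t \<partial>lborel) \<le> ennreal (24 * r) * E"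
proof -
  have 1: "(\<integral>\<^sup>+t\<in>{0<..T}. k t \<partial>lborel) \<le> 2 * E" if "T \<ge> 0" for T
  proof -
    define a where "a = exp (- T / \<epsilon>)"
    have a: "0 < a" "a \<le> 1" using e that by (auto simp: a_def)
    have "ennreal (1 / 2) * (\<integral>\<^sup>+t\<in>{0<..T}. k t \<partial>lborel) = (\<integral>\<^sup>+t. ennreal (1 / 2) * (k t * indicator {0<..T} t) \<partial>lborel)"
      by (rule nn_integral_cmult[symmetric]) measurable
    also have "\<dots> \<le> E"
    proof (rule order_trans[OF nn_integral_mono Y[OF a]])
      fix t
      let ?q = "exp (- t / \<epsilon>)" and ?A = "2 * eta a (exp (- t / \<epsilon>)) - (slope a (exp (- t / \<epsilon>)) - 1)"
      show "ennreal (1 / 2) * (k t * indicator {0<..T} t) \<le> ennreal (?q / \<epsilon>) *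
        (ennreal ?A * (ennreal \<epsilon> * k t) + ennreal (slope a ?q) * R t) * indicator {0<..} t"
      proof (cases "0 < t \<and> t \<le> T")
        case True
        have q: "0 < ?q" "?q \<le> 1" "a \<le> ?q" using True e by (auto simp: a_def divide_right_mono)
        note A = eta_slope_bounds[OF a(1) q(1,2)]
        have "ennreal (1 / 2) * k t \<le> ennreal (?q * ?A) * k t"
          using A(2)[OF q(3)] by (intro mult_right_mono ennreal_leI) auto
        \<comment> \<open>The factor \<open>\<epsilon>\<close> of the kinetic energy cancels the
          normalisation of the exponential weight, so the bound on \<open>k\<close> is free of
          \<open>\<epsilon>\<close>.\<close>
        also have "\<dots> = ennreal (?q / \<epsilon>) * (ennreal ?A * (ennreal \<epsilon> * k t))"
        proof -
          have "ennreal (?q * ?A) = ennreal (?q / \<epsilon>) * (ennreal ?A * ennreal \<epsilon>)"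
            using e A(1) by (simp flip: ennreal_mult)
          then show ?thesis by (simp add: mult.assoc)
        qed
        also have "\<dots> \<le> ennreal (?q / \<epsilon>) * (ennreal ?A * (ennreal \<epsilon> * k t) + ennreal (slope a ?q) * R t)"
          by (intro mult_left_mono) auto
        finally show ?thesis using True by simp
      qed (auto simp: indicator_def)
    qed
    finally have "2 * (ennreal (1 / 2) * (\<integral>\<^sup>+t\<in>{0<..T}. k t \<partial>lborel)) \<le> 2 * E" by (intro mult_left_mono) auto
    moreover have "2 * ennreal (1 / 2) = 1"
      using ennreal_mult[of 2 "1 / 2"] by simp
    ultimately show ?thesis by (simp add: mult.assoc[symmetric])
  qed
  show "(\<integral>\<^sup>+t\<in>{0<..}. k t \<partial>lborel) \<le> 2 * E" by (rule nn_integral_Ioi_le[OF k 1]) simp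
  \<comment> \<open>The constant is 3 * 4: within a time \<open>\<epsilon>\<close> after
    \<open>T\<close> the exponential loses at most a factor exp 1 \<le> 3, and the slope is at least
    1/(4a), so q times the slope is at least 1/12.\<close>
  have 2: "(\<integral>\<^sup>+t. R t * indicator ({T..T + \<epsilon>} \<inter> {0<..}) t \<partial>lborel) \<le> ennreal (12 * \<epsilon>) * E" if "T \<ge> 0" for T
  proof -
    define a where "a = exp (- T / \<epsilon>)"
    have a: "0 < a" "a \<le> 1" using e that by (auto simp: a_def)
    have "(\<integral>\<^sup>+t. R t * indicator ({T..T + \<epsilon>} \<inter> {0<..}) t \<partial>lborel)
      \<le> (\<integral>\<^sup>+t. ennreal (12 * \<epsilon>) * (ennreal (exp (- t / \<epsilon>) / \<epsilon>) *
        (ennreal (2 * eta a (exp (- t / \<epsilon>)) - (slope a (exp (- t / \<epsilon>)) - 1)) * (ennreal \<epsilon> * k t)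
        + ennreal (slope a (exp (- t / \<epsilon>))) * R t) * indicator {0<..} t) \<partial>lborel)"
    proof (rule nn_integral_mono)
      fix t
      let ?q = "exp (- t / \<epsilon>)" and ?A = "2 * eta a (exp (- t / \<epsilon>)) - (slope a (exp (- t / \<epsilon>)) - 1)"
      show "R t * indicator ({T..T + \<epsilon>} \<inter> {0<..}) t \<le> ennreal (12 * \<epsilon>) * (ennreal (?q / \<epsilon>) *
        (ennreal ?A * (ennreal \<epsilon> * k t) + ennreal (slope a ?q) * R t) * indicator {0<..} t)"
      proof (cases "T \<le> t \<and> t \<le> T + \<epsilon> \<and> 0 < t")
        case True
        have q: "0 < ?q" "?q \<le> a" using True e by (auto simp: a_def divide_right_mono)
        have "a / 3 \<le> ?q"
        proof -
          have "exp (T / \<epsilon> - t / \<epsilon>) \<ge> exp (- 1)"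
            using True e by (simp add: field_simps)
          moreover have "exp (- 1) \<ge> (1 / 3 :: real)" using exp_le by (simp add: exp_minus field_simps)
          ultimately have "1 / 3 \<le> exp (T / \<epsilon> - t / \<epsilon>)" by (rule order_trans[rotated])
          then have "a * (1 / 3) \<le> a * exp (T / \<epsilon> - t / \<epsilon>)" using a by (intro mult_left_mono) auto
          then show ?thesis by (simp add: a_def flip: exp_add)
        qed
        have s: "1 / (4 * a) \<le> slope a ?q" by (rule slope_lower_bound[OF a(1) q])
        have s0: "slope a ?q \<ge> 0" using a by (simp add: slope_def)
        have "1 \<le> 12 * (a / 3 * (1 / (4 * a)))" using a by simp
        also have "\<dots> \<le> 12 * (?q * slope a ?q)"
          using s s0 \<open>a / 3 \<le> ?q\<close> a by (intro mult_left_mono mult_mono) auto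
        also have "\<dots> = 12 * \<epsilon> * (?q / \<epsilon> * slope a ?q)" using e by simp
        finally have "1 \<le> ennreal (12 * \<epsilon>) * (ennreal (?q / \<epsilon>) * ennreal (slope a ?q))"
          using e s0 by (simp flip: ennreal_mult add: ennreal_leI)
        then have "1 * R t \<le> ennreal (12 * \<epsilon>) * (ennreal (?q / \<epsilon>) * ennreal (slope a ?q)) * R t"
          by (intro mult_right_mono) auto
        also have "\<dots> = ennreal (12 * \<epsilon>) * (ennreal (?q / \<epsilon>) * (ennreal (slope a ?q) * R t))" by (simp add: mult.assoc)
        also have "\<dots> \<le> ennreal (12 * \<epsilon>) * (ennreal (?q / \<epsilon>) * (ennreal ?A * (ennreal \<epsilon> * k t) + ennreal (slope a ?q) * R t))"
          by (intro mult_left_mono) auto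
        finally show ?thesis using True by simp
      qed (auto simp: indicator_def)
    qed
    also have "\<dots> = ennreal (12 * \<epsilon>) * (\<integral>\<^sup>+t\<in>{0<..}. ennreal (exp (- t / \<epsilon>) / \<epsilon>) *
      (ennreal (2 * eta a (exp (- t / \<epsilon>)) - (slope a (exp (- t / \<epsilon>)) - 1)) * (ennreal \<epsilon> * k t)
        + ennreal (slope a (exp (- t / \<epsilon>))) * R t) \<partial>lborel)"
      unfolding eta_def slope_def by (rule nn_integral_cmult) measurable
    also have "\<dots> \<le> ennreal (12 * \<epsilon>) * E" by (intro mult_left_mono Y a) auto
    finally show ?thesis .
  qed
  assume r: "\<epsilon> \<le> r"
  \<comment> \<open>Covering the times up to \<open>r\<close> takes at most r/\<epsilon> + 1
    intervals of length \<open>\<epsilon>\<close>. The assumption \<epsilon> \<le> r turns this into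
    2 r/\<epsilon>, which doubles 12 to 24.\<close>
  define N where "N = nat \<lceil>r / \<epsilon>\<rceil>"
  have N: "r / \<epsilon> \<le> real N" "real N \<le> 2 * (r / \<epsilon>)"
  proof -
    have "1 \<le> r / \<epsilon>" using r e by simp
    then show "r / \<epsilon> \<le> real N" "real N \<le> 2 * (r / \<epsilon>)"
      unfolding N_def by linarith+
  qed
  have "(\<integral>\<^sup>+t\<in>{0<..<r}. R t \<partial>lborel)
    \<le> (\<integral>\<^sup>+t. (\<Sum>j<N. R t * indicator ({real j * \<epsilon>..real j * \<epsilon> + \<epsilon>} \<inter> {0<..}) t) \<partial>lborel)"
  proof (rule nn_integral_mono)
    fix t
    show "R t * indicator {0<..<r} t \<le> (\<Sum>j<N. R t * indicator ({real j * \<epsilon>..real j * \<epsilon> + \<epsilon>} \<inter> {0<..}) t)"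
    proof (cases "0 < t \<and> t < r")
      case True
      define j where "j = nat \<lfloor>t / \<epsilon>\<rfloor>"
      have te: "0 < t / \<epsilon>" "t / \<epsilon> < r / \<epsilon>" using True e by (auto simp: divide_strict_right_mono)
      have j: "real j \<le> t / \<epsilon>" "t / \<epsilon> \<le> real j + 1" unfolding j_def using te by linarith+
      have "j < N" using j te N by linarith
      have "real j * \<epsilon> \<le> t" "t \<le> real j * \<epsilon> + \<epsilon>" using j e by (simp_all add: field_simps)
      then have "R t * indicator {0<..<r} t = R t * indicator ({real j * \<epsilon>..real j * \<epsilon> + \<epsilon>} \<inter> {0<..}) t"
        using True by simp
      also have "\<dots> \<le> (\<Sum>j<N. R t * indicator ({real j * \<epsilon>..real j * \<epsilon> + \<epsilon>} \<inter> {0<..}) t)"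
        using \<open>j < N\<close> by (intro member_le_sum) auto
      finally show ?thesis .
    qed (auto simp: indicator_def)
  qed
  also have "\<dots> = (\<Sum>j<N. \<integral>\<^sup>+t. R t * indicator ({real j * \<epsilon>..real j * \<epsilon> + \<epsilon>} \<inter> {0<..}) t \<partial>lborel)"
    by (rule nn_integral_sum) measurable
  also have "\<dots> \<le> (\<Sum>j<N. ennreal (12 * \<epsilon>) * E)" using e by (intro sum_mono 2) simp
  also have "\<dots> = ennreal (real N * (12 * \<epsilon>)) * E"
    using e by (simp add: ennreal_mult ennreal_of_nat_eq_real_of_nat mult.assoc)
  also have "\<dots> \<le> ennreal (24 * r) * E"
  proof (intro mult_right_mono ennreal_leI)
    have "real N * (12 * \<epsilon>) \<le> 2 * (r / \<epsilon>) * (12 * \<epsilon>)" using N(2) e by (intro mult_right_mono) auto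
    then show "real N * (12 * \<epsilon>) \<le> 24 * r" using e by simp
  qed simp
  finally show "(\<integral>\<^sup>+t\<in>{0<..<r}. R t \<partial>lborel) \<le> ennreal (24 * r) * E" .
qed

section \<open>Comparison of the minimizer with its competitors\<close>

lemma exponential_weight_integral:
  assumes e: "\<epsilon> > 0"
  shows "(\<integral>\<^sup>+t\<in>{0<..}. ennreal (exp (- t / \<epsilon>) / \<epsilon>) \<partial>lborel) \<le> 1"
proof -
  have "(\<integral>\<^sup>+t\<in>{0<..}. ennreal (exp (- t / \<epsilon>) / \<epsilon>) \<partial>lborel) \<le> (\<integral>\<^sup>+t\<in>{0..}. ennreal (exp (- t / \<epsilon>) / \<epsilon>) \<partial>lborel)"
    by (intro nn_integral_mono mult_left_mono) (auto simp: indicator_def)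
  also have "\<dots> = ennreal (0 - (- exp (- 0 / \<epsilon>)))"
  proof (rule nn_integral_FTC_atLeast)
    show "((\<lambda>t. - exp (- t / \<epsilon>)) has_real_derivative exp (- t / \<epsilon>) / \<epsilon>) (at t)" for t
      using e by (auto intro!: derivative_eq_intros)
    have "filterlim (\<lambda>t. inverse \<epsilon> * t) at_top at_top"
      using e by (intro filterlim_tendsto_pos_mult_at_top[OF tendsto_const _ filterlim_ident]) auto
    then have "filterlim (\<lambda>t. - (inverse \<epsilon> * t)) at_bot at_top"
      by (simp add: filterlim_uminus_at_top)
    from tendsto_minus[OF filterlim_compose[OF exp_at_bot this]]
    show "((\<lambda>t. - exp (- t / \<epsilon>)) \<longlongrightarrow> 0) at_top" by (simp add: divide_inverse mult.commute)
  qed (use e in auto)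
  finally show ?thesis by simp
qed

lemma energy_representative:
  assumes a: "smoothly_approximable w G u0" and e: "\<epsilon> > 0"
  shows "energy \<gamma> \<epsilon> w
    = (\<integral>\<^sup>+t\<in>{0<..}. ennreal (exp (- t / \<epsilon>) / \<epsilon>) * (ennreal \<epsilon> * kinetic G t + potential \<gamma> w G t) \<partial>lborel)"
proof (rule energy_eq)
  show "w \<in> borel_measurable borel" "G \<in> borel_measurable borel" using a by (auto simp: smoothly_approximable_def)
  show "AE z in lebesgue. z \<in> spacetime \<longrightarrow> weak_grad spacetime w z = G z"
    by (rule weak_grad_AE[OF open_spacetime smoothly_approximable_U0(2)[OF a]])
qed (use e in auto)

lemma kinetic_time_map:
  assumes G: "G \<in> borel_measurable borel"
  shows "kinetic (\<lambda>z. (fst (G (time_map \<theta> z)), \<theta>' (snd z) * snd (G (time_map \<theta> z)))) t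
    = ennreal ((\<theta>' t)\<^sup>2) * kinetic G (\<theta> t)"
proof -
  have "(\<lambda>x. ennreal (\<bar>snd (G (x, \<theta> t))\<bar>\<^sup>2)) \<in> borel_measurable borel"
    by (rule measurable_slices(2)[OF kinetic_integrand[OF G]])
  then have m: "(\<lambda>x. ennreal (\<bar>snd (G (x, \<theta> t))\<bar>\<^sup>2)) \<in> borel_measurable lborel" by simp
  show ?thesis
    unfolding kinetic_def time_map_def nn_integral_cmult[OF m, symmetric]
    by (intro nn_integral_cong) (simp add: power_mult_distrib flip: ennreal_mult)
qed

lemma potential_time_map:
  "potential \<gamma> (\<lambda>z. w (time_map \<theta> z)) (\<lambda>z. (fst (G (time_map \<theta> z)), \<theta>' (snd z) * snd (G (time_map \<theta> z)))) t
    = potential \<gamma> w G (\<theta> t)"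
  by (simp add: potential_def time_map_def)

definition initial_energy :: "real \<Rightarrow> ('a::euclidean_space \<Rightarrow> real) \<Rightarrow> ('a \<Rightarrow> 'a) \<Rightarrow> ennreal" where
  "initial_energy \<gamma> v G = (\<integral>\<^sup>+x. ennreal ((norm (G x))\<^sup>2 + 2 * max (v x) 0 powr \<gamma>) \<partial>lborel)"

text \<open>A static function has no kinetic part and the same potential at every time, and the
  exponential weight has total mass at most 1; hence a bound that does not see
  \<open>\<epsilon>\<close>.\<close>

lemma energy_static_le:
  assumes a: "smoothly_approximable (\<lambda>z. v (fst z)) (\<lambda>z. (G (fst z), 0)) u0" and e: "\<epsilon> > 0"
  shows "energy \<gamma> \<epsilon> (\<lambda>z. v (fst z)) \<le> initial_energy \<gamma> v G"
proof -
  have k: "kinetic (\<lambda>z. (G (fst z), 0 :: real)) t = 0" for t by (simp add: kinetic_def)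
  have p: "potential \<gamma> (\<lambda>z. v (fst z)) (\<lambda>z. (G (fst z), 0 :: real)) t = initial_energy \<gamma> v G" for t
    by (simp add: potential_def initial_energy_def)
  have "energy \<gamma> \<epsilon> (\<lambda>z. v (fst z)) = (\<integral>\<^sup>+t. initial_energy \<gamma> v G * (ennreal (exp (- t / \<epsilon>) / \<epsilon>) * indicator {0<..} t) \<partial>lborel)"
    unfolding energy_representative[OF a e] k p by (intro nn_integral_cong) (simp add: mult_ac)
  also have "\<dots> = initial_energy \<gamma> v G * (\<integral>\<^sup>+t\<in>{0<..}. ennreal (exp (- t / \<epsilon>) / \<epsilon>) \<partial>lborel)"
    by (rule nn_integral_cmult) measurable
  also have "\<dots> \<le> initial_energy \<gamma> v G * 1"
    by (intro mult_left_mono exponential_weight_integral e) auto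
  finally show ?thesis by simp
qed

text \<open>The static competitor makes the energy of \<open>u\<close> finite and bounds it
  independently of \<open>\<epsilon>\<close>; the time changes of \<open>u\<close> supply the
  hypothesis of \<open>first_variation\<close>. Both comparisons are phrased through the same pair
  of profiles.\<close>

lemma minimizer_bounds:
  fixes u0 :: "'a::euclidean_space \<Rightarrow> real"
  assumes e: "\<epsilon> > 0" and min: "is_minimizer \<gamma> \<epsilon> u0 u"
    and a0: "smoothly_approximable (\<lambda>z. v (fst z)) (\<lambda>z. (G0 (fst z), 0)) u0"
    and fin: "initial_energy \<gamma> v G0 < \<infinity>"
  shows "(\<integral>\<^sup>+t\<in>{0<..}. (\<integral>\<^sup>+x. ennreal (\<bar>deriv_t u (x, t)\<bar>\<^sup>2) \<partial>lebesgue) \<partial>lebesgue) \<le> 2 * initial_energy \<gamma> v G0"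
    and "\<epsilon> \<le> r \<Longrightarrow> (\<integral>\<^sup>+t\<in>{0<..<r}.
        (\<integral>\<^sup>+x. ennreal ((norm (grad_x u (x, t)))\<^sup>2 + 2 * (max (u (x, t)) 0) powr \<gamma>) \<partial>lebesgue) \<partial>lebesgue)
      \<le> ennreal (24 * r) * initial_energy \<gamma> v G0"
proof -
  have u: "u \<in> U0_space u0" and le: "\<And>w. w \<in> U0_space u0 \<Longrightarrow> energy \<gamma> \<epsilon> u \<le> energy \<gamma> \<epsilon> w"
    using min by (auto simp: is_minimizer_def)
  have E0: "energy \<gamma> \<epsilon> u \<le> initial_energy \<gamma> v G0"
    using le[OF smoothly_approximable_U0(1)[OF a0]] energy_static_le[OF a0 e] by (rule order_trans)
  obtain w G where a: "smoothly_approximable w G u0"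
    and uw: "AE z in lebesgue. z \<in> spacetime \<longrightarrow> u z = w z"
    and uG: "AE z in lebesgue. z \<in> spacetime \<longrightarrow> weak_grad spacetime u z = G z"
    using U0_space_representative[OF u] by blast
  have w: "w \<in> borel_measurable borel" and G: "G \<in> borel_measurable borel"
    using a by (auto simp: smoothly_approximable_def)
  let ?k = "kinetic G" and ?R = "potential \<gamma> w G"
  have k: "?k \<in> borel_measurable borel" and R: "?R \<in> borel_measurable borel"
    by (rule kinetic_measurable[OF G], rule potential_measurable[OF w G])
  note E = energy_eq[OF w G uw uG e, of \<gamma>]
  have I: "(\<lambda>t. ennreal \<epsilon> * ?k t) \<in> borel_measurable borel" using k by measurable
  have Y: "(\<integral>\<^sup>+t\<in>{0<..}. ennreal (exp (- t / \<epsilon>) / \<epsilon>) *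
      (ennreal (2 * eta b (exp (- t / \<epsilon>)) - (slope b (exp (- t / \<epsilon>)) - 1)) * (ennreal \<epsilon> * ?k t)
        + ennreal (slope b (exp (- t / \<epsilon>))) * ?R t) \<partial>lborel) \<le> initial_energy \<gamma> v G0"
    if b: "0 < b" "b \<le> 1" for b
  proof (rule order_trans[OF first_variation[OF e b I R]])
    show "(\<integral>\<^sup>+t\<in>{0<..}. ennreal (exp (- t / \<epsilon>) / \<epsilon>) * (ennreal \<epsilon> * ?k t + ?R t) \<partial>lborel) \<le> initial_energy \<gamma> v G0"
      using E0 unfolding E .
    then show "(\<integral>\<^sup>+t\<in>{0<..}. ennreal (exp (- t / \<epsilon>) / \<epsilon>) * (ennreal \<epsilon> * ?k t + ?R t) \<partial>lborel) < \<infinity>"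
      using fin by (rule le_less_trans)
    fix \<theta> \<theta>' :: "real \<Rightarrow> real"
    assume \<theta>: "smooth \<theta>" "\<theta> 0 = 0" "\<And>t. (\<theta> has_real_derivative \<theta>' t) (at t)" "continuous_on UNIV \<theta>'"
      "\<And>t. \<theta>' t > 0" "\<And>t. t > 0 \<Longrightarrow> \<theta> t > 0" "\<And>t. t > 0 \<Longrightarrow> \<theta> t \<le> t"
    note c = smoothly_approximable_time_map[OF \<theta>(3-7) a \<theta>(1,2)]
    \<comment> \<open>The Borel representative is varied instead of \<open>u\<close>; the energy of
      \<open>u\<close> itself is expressed through its profiles in \<open>E\<close>.\<close>
    have "energy \<gamma> \<epsilon> u \<le> energy \<gamma> \<epsilon> (\<lambda>z. w (time_map \<theta> z))"
      by (rule le[OF smoothly_approximable_U0(1)[OF c]])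
    also have "\<dots> = (\<integral>\<^sup>+t\<in>{0<..}. ennreal (exp (- t / \<epsilon>) / \<epsilon>) *
        (ennreal ((\<theta>' t)\<^sup>2) * (ennreal \<epsilon> * ?k (\<theta> t)) + ?R (\<theta> t)) \<partial>lborel)"
      using energy_representative[OF c e, of \<gamma>]
      by (simp only: kinetic_time_map[OF G] potential_time_map mult.left_commute[of "ennreal \<epsilon>"])
    finally show "(\<integral>\<^sup>+t\<in>{0<..}. ennreal (exp (- t / \<epsilon>) / \<epsilon>) * (ennreal \<epsilon> * ?k t + ?R t) \<partial>lborel)
      \<le> (\<integral>\<^sup>+t\<in>{0<..}. ennreal (exp (- t / \<epsilon>) / \<epsilon>) * (ennreal ((\<theta>' t)\<^sup>2) * (ennreal \<epsilon> * ?k (\<theta> t)) + ?R (\<theta> t)) \<partial>lborel)"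
      unfolding E .
  qed
  show "(\<integral>\<^sup>+t\<in>{0<..}. (\<integral>\<^sup>+x. ennreal (\<bar>deriv_t u (x, t)\<bar>\<^sup>2) \<partial>lebesgue) \<partial>lebesgue) \<le> 2 * initial_energy \<gamma> v G0"
    unfolding kinetic_integral_eq(1)[OF w G uw uG order_refl] by (rule integral_bounds(1)[OF e k R Y])
  assume r: "\<epsilon> \<le> r"
  have "{0<..<r} \<subseteq> {0<..}" by auto
  then show "(\<integral>\<^sup>+t\<in>{0<..<r}.
        (\<integral>\<^sup>+x. ennreal ((norm (grad_x u (x, t)))\<^sup>2 + 2 * (max (u (x, t)) 0) powr \<gamma>) \<partial>lebesgue) \<partial>lebesgue)
      \<le> ennreal (24 * r) * initial_energy \<gamma> v G0"
    unfolding kinetic_integral_eq(2)[OF w G uw uG \<open>{0<..<r} \<subseteq> {0<..}\<close>] by (intro integral_bounds(2)[OF e k R Y r])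
qed

text \<open>The gradient part is finite by square integrability of \<open>G\<close>, and the
  positive part of \<open>v\<close> is dominated by its absolute value, whose \<gamma>-th power is
  integrable.\<close>

lemma initial_energy_finite:
  fixes u0 :: "'a::euclidean_space \<Rightarrow> real"
  assumes v[measurable]: "v \<in> borel_measurable borel" and G[measurable]: "G \<in> borel_measurable borel"
    and ae: "AE x in lebesgue. u0 x = v x" and "u0 \<in> Lp \<gamma> UNIV" and fin: "L2_normsq UNIV G < \<infinity>" and "0 \<le> \<gamma>"
  shows "initial_energy \<gamma> v G < \<infinity>"
proof -
  have "integrable lebesgue (\<lambda>x. norm (u0 x) powr \<gamma>)"
    using assms(4) by (simp add: Lp_def lebesgue_on_UNIV_eq)
  then have "(\<integral>\<^sup>+x. ennreal (\<bar>u0 x\<bar> powr \<gamma>) \<partial>lebesgue) < \<infinity>" by (simp add: integrable_iff_bounded)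
  also have "(\<integral>\<^sup>+x. ennreal (\<bar>u0 x\<bar> powr \<gamma>) \<partial>lebesgue) = (\<integral>\<^sup>+x. ennreal (\<bar>v x\<bar> powr \<gamma>) \<partial>lebesgue)"
    by (rule nn_integral_cong_AE, use ae in eventually_elim) simp
  finally have p: "(\<integral>\<^sup>+x. ennreal (\<bar>v x\<bar> powr \<gamma>) \<partial>lborel) < \<infinity>" by (simp add: nn_integral_completion)
  have g: "(\<integral>\<^sup>+x. ennreal ((norm (G x))\<^sup>2) \<partial>lborel) < \<infinity>"
    using fin by (simp add: L2_normsq_def nn_integral_completion)
  have "initial_energy \<gamma> v G \<le> (\<integral>\<^sup>+x. ennreal ((norm (G x))\<^sup>2) + 2 * ennreal (\<bar>v x\<bar> powr \<gamma>) \<partial>lborel)"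
    unfolding initial_energy_def
  proof (rule nn_integral_mono)
    fix x
    have "max (v x) 0 powr \<gamma> \<le> \<bar>v x\<bar> powr \<gamma>" using \<open>0 \<le> \<gamma>\<close> by (intro powr_mono2) auto
    then have "ennreal ((norm (G x))\<^sup>2 + 2 * max (v x) 0 powr \<gamma>) \<le> ennreal ((norm (G x))\<^sup>2 + 2 * \<bar>v x\<bar> powr \<gamma>)"
      by (intro ennreal_leI) simp
    also have "\<dots> = ennreal ((norm (G x))\<^sup>2) + 2 * ennreal (\<bar>v x\<bar> powr \<gamma>)" by (subst ennreal_plus) (auto simp: ennreal_mult)
    finally show "ennreal ((norm (G x))\<^sup>2 + 2 * max (v x) 0 powr \<gamma>) \<le> ennreal ((norm (G x))\<^sup>2) + 2 * ennreal (\<bar>v x\<bar> powr \<gamma>)" .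
  qed
  also have "\<dots> = (\<integral>\<^sup>+x. ennreal ((norm (G x))\<^sup>2) \<partial>lborel) + 2 * (\<integral>\<^sup>+x. ennreal (\<bar>v x\<bar> powr \<gamma>) \<partial>lborel)"
    by (subst nn_integral_add, measurable, subst nn_integral_cmult) measurable
  also have "\<dots> < \<infinity>" using p g by (simp add: ennreal_mult_less_top)
  finally show ?thesis .
qed

theorem proposition2p3:
  fixes \<gamma> :: real and u0 :: "real ^ 'n \<Rightarrow> real"
  assumes "1 \<le> \<gamma>" and "\<gamma> < 2"
    and "u0 \<in> H1 UNIV" and "u0 \<in> Lp \<gamma> UNIV"
    and "AE x in lebesgue. 0 \<le> u0 x"
  shows "\<exists>C::real. C > 0 \<and>
    (\<forall>\<epsilon>::real. 0 < \<epsilon> \<and> \<epsilon> < 1 \<longrightarrow>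
      (\<forall>u :: (real ^ 'n) \<times> real \<Rightarrow> real. is_minimizer \<gamma> \<epsilon> u0 u \<longrightarrow>
        (\<integral>\<^sup>+t\<in>{0<..}. (\<integral>\<^sup>+x. ennreal (\<bar>deriv_t u (x, t)\<bar>\<^sup>2) \<partial>lebesgue) \<partial>lebesgue) \<le> ennreal C \<and>
        (\<forall>r\<ge>\<epsilon>. (\<integral>\<^sup>+t\<in>{0<..<r}.
            (\<integral>\<^sup>+x. ennreal ((norm (grad_x u (x, t)))\<^sup>2 + 2 * (max (u (x, t)) 0) powr \<gamma>) \<partial>lebesgue)
            \<partial>lebesgue) \<le> ennreal (C * r))))"
proof -
  obtain v G where v: "v \<in> borel_measurable borel" and G: "G \<in> borel_measurable borel"
    and ae: "AE x in lebesgue. u0 x = v x" and wg: "is_weak_gradient UNIV v G"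
    and L2: "L2_normsq UNIV v < \<infinity>" "L2_normsq UNIV G < \<infinity>"
    using H1_representative[OF assms(3)] by blast
  have a0: "smoothly_approximable (\<lambda>z. v (fst z)) (\<lambda>z. (G (fst z), 0)) u0"
    by (rule smoothly_approximable_static[OF v G ae wg L2])
  have fin: "initial_energy \<gamma> v G < \<infinity>"
    by (rule initial_energy_finite[OF v G ae assms(4) L2(2)]) (use assms(1) in simp)
  then obtain e0 where e0: "e0 \<ge> 0" "initial_energy \<gamma> v G = ennreal e0"
    by (cases "initial_energy \<gamma> v G") auto
  show ?thesis
  \<comment> \<open>The factor 24 of the second bound also covers the 2 of the first, and the
    summand 1 keeps the constant positive when the initial energy is 0.\<close>
  proof (rule exI[of _ "24 * e0 + 1"], intro conjI allI impI)
    show "24 * e0 + 1 > 0" using e0 by simp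
    fix \<epsilon> :: real and u :: "(real ^ 'n) \<times> real \<Rightarrow> real"
    assume e: "0 < \<epsilon> \<and> \<epsilon> < 1" and m: "is_minimizer \<gamma> \<epsilon> u0 u"
    note b = minimizer_bounds[OF conjunct1[OF e] m a0 fin, unfolded e0(2)]
    have "2 * ennreal e0 = ennreal (2 * e0)" using e0(1) by (simp add: ennreal_mult)
    also have "\<dots> \<le> ennreal (24 * e0 + 1)" using e0(1) by (intro ennreal_leI) simp
    finally show "(\<integral>\<^sup>+t\<in>{0<..}. (\<integral>\<^sup>+x. ennreal (\<bar>deriv_t u (x, t)\<bar>\<^sup>2) \<partial>lebesgue) \<partial>lebesgue) \<le> ennreal (24 * e0 + 1)"
      using b(1) by (rule order_trans[rotated])
    fix r assume r: "\<epsilon> \<le> r"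
    have "ennreal (24 * r) * ennreal e0 = ennreal (24 * r * e0)" using e0(1) e r by (simp add: ennreal_mult)
    also have "\<dots> \<le> ennreal ((24 * e0 + 1) * r)" using e r by (intro ennreal_leI) (simp add: algebra_simps)
    finally show "(\<integral>\<^sup>+t\<in>{0<..<r}.
            (\<integral>\<^sup>+x. ennreal ((norm (grad_x u (x, t)))\<^sup>2 + 2 * (max (u (x, t)) 0) powr \<gamma>) \<partial>lebesgue)
            \<partial>lebesgue) \<le> ennreal ((24 * e0 + 1) * r)"
      using b(2)[OF r] by (rule order_trans[rotated])
  qed
qed

end
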